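(* Let $e\ge3$ and let $A$ and $B$ be arm sequences. Then for every $n\in\mathbb N$ the crystals $\mathcal R_A^{(n)}$ and $\mathcal R_B^{(n)}$ are isomorphic, and the crystals $\mathcal R_A$ and $\mathcal R_B$ are isomorphic.
   Context: An arm sequence is an integer sequence $A=(A_1,A_2,\dots)$ with $t-1\le A_t\le(e-1)t$ and $A_{t+u}\in\{A_t+A_u,A_t+A_u+1\}$ for all $t,u\ge1$. A partition is $A$-regular if it has no hook of length $et$ and arm length $A_t$ for any $t\ge1$ (hook at $(r,c)$ has length $\lambda_r-c+\lambda'_c-r+1$ and arm length $\lambda_r-c$). The crystal $\mathcal R_A$ is the directed graph on $A$-regular partitions with arrows $\lambda\xrightarrow{i}f_i\lambda$, $i\in\mathbb Z/e\mathbb Z$, where: the residue of node $(r,c)$ is $c-r+e\mathbb Z$; for distinct $i$-nodes $(r,c),(s,d)$, write $s-r+c-d=et$, swapping if needed so $t\ge0$, and put $(r,c)\prec(s,d)$ iff $c-d\le A_t$ ($A_0:=0$); list the addable and removable $i$-nodes of $\lambda$ in decreasing $\prec$-order as a word in $+$ (addable) and $-$ (removable), delete adjacent pairs $+-$ repeatedly; $f_i\lambda$ is $\lambda$ with the node of the first remaining $+$ added (or $0$ if none). $\mathcal R_A^{(n)}$ is the induced subgraph on partitions of size at most $ne$. A crystal isomorphism is a bijection of vertex sets preserving labelled arrows in both directions. *)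

theory Defs
  imports Main
begin

(* Partitions are represented by their Young diagrams: finite sets of nodes (r,c),
   1-indexed (row r, column c), closed downwards. *)
type_synonym node = "nat \<times> nat"

definition young :: "node set \<Rightarrow> bool" where
  "young Y \<longleftrightarrow> finite Y \<and>
     (\<forall>(r,c)\<in>Y. r \<ge> 1 \<and> c \<ge> 1 \<and> (r > 1 \<longrightarrow> (r - 1, c) \<in> Y) \<and> (c > 1 \<longrightarrow> (r, c - 1) \<in> Y))"

definition row_len :: "node set \<Rightarrow> nat \<Rightarrow> nat" where
  "row_len Y r = card {c. (r, c) \<in> Y}"

definition col_len :: "node set \<Rightarrow> nat \<Rightarrow> nat" where
  "col_len Y c = card {r. (r, c) \<in> Y}"

definition arm_len :: "node set \<Rightarrow> node \<Rightarrow> int" where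
  "arm_len Y x = int (row_len Y (fst x)) - int (snd x)"

definition hook_len :: "node set \<Rightarrow> node \<Rightarrow> int" where
  "hook_len Y x = int (row_len Y (fst x)) - int (snd x) + int (col_len Y (snd x)) - int (fst x) + 1"

(* arm sequences; A is indexed from 1, its value at 0 is irrelevant *)
definition arm_seq :: "nat \<Rightarrow> (nat \<Rightarrow> int) \<Rightarrow> bool" where
  "arm_seq e A \<longleftrightarrow>
     (\<forall>t\<ge>1. int t - 1 \<le> A t \<and> A t \<le> (int e - 1) * int t) \<and>
     (\<forall>t\<ge>1. \<forall>u\<ge>1. A (t + u) = A t + A u \<or> A (t + u) = A t + A u + 1)"

definition A_regular :: "nat \<Rightarrow> (nat \<Rightarrow> int) \<Rightarrow> node set \<Rightarrow> bool" where
  "A_regular e A Y \<longleftrightarrow> young Y \<and>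
     \<not> (\<exists>x\<in>Y. \<exists>t\<ge>1. hook_len Y x = int e * int t \<and> arm_len Y x = A t)"

definition residue :: "nat \<Rightarrow> node \<Rightarrow> nat" where
  "residue e x = nat ((int (snd x) - int (fst x)) mod int e)"

definition addable :: "node set \<Rightarrow> node \<Rightarrow> bool" where
  "addable Y x \<longleftrightarrow> x \<notin> Y \<and> young (insert x Y)"

definition removable :: "node set \<Rightarrow> node \<Rightarrow> bool" where
  "removable Y x \<longleftrightarrow> x \<in> Y \<and> young (Y - {x})"

definition Aval :: "(nat \<Rightarrow> int) \<Rightarrow> nat \<Rightarrow> int" where
  "Aval A t = (if t = 0 then 0 else A t)"

(* (r,c) \<prec> (s,d): with s-r+c-d = e t; if t \<ge> 0 then (r,c) \<prec> (s,d) iff c-d \<le> A_t;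
   if t < 0 the roles are swapped, i.e. (s,d) \<prec> (r,c) iff d-c \<le> A_{-t},
   and (r,c) \<prec> (s,d) holds iff (s,d) \<prec> (r,c) fails. *)
definition prec :: "nat \<Rightarrow> (nat \<Rightarrow> int) \<Rightarrow> node \<Rightarrow> node \<Rightarrow> bool" where
  "prec e A x y =
     (let k = int (fst y) - int (fst x) + int (snd x) - int (snd y) in
      if k \<ge> 0 then int (snd x) - int (snd y) \<le> Aval A (nat (k div int e))
      else \<not> (int (snd y) - int (snd x) \<le> Aval A (nat ((- k) div int e))))"

definition i_nodes :: "nat \<Rightarrow> node set \<Rightarrow> nat \<Rightarrow> node set" where
  "i_nodes e Y i = {x. (addable Y x \<or> removable Y x) \<and> residue e x = i}"

definition sorted_i_nodes :: "nat \<Rightarrow> (nat \<Rightarrow> int) \<Rightarrow> node set \<Rightarrow> nat \<Rightarrow> node list" where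
  "sorted_i_nodes e A Y i = (SOME xs. distinct xs \<and> set xs = i_nodes e Y i \<and>
        sorted_wrt (\<lambda>x y. prec e A y x) xs)"

(* signs: True = '+' (addable), False = '-' (removable) *)
definition i_word :: "nat \<Rightarrow> (nat \<Rightarrow> int) \<Rightarrow> node set \<Rightarrow> nat \<Rightarrow> (bool \<times> node) list" where
  "i_word e A Y i = map (\<lambda>x. (addable Y x, x)) (sorted_i_nodes e A Y i)"

(* result of repeatedly deleting adjacent pairs '+-' *)
fun reduce_word :: "(bool \<times> node) list \<Rightarrow> (bool \<times> node) list" where
  "reduce_word [] = []"
| "reduce_word (a # w) =
     (case reduce_word w of
        [] \<Rightarrow> [a]
      | b # w' \<Rightarrow> (if fst a \<and> \<not> fst b then w' else a # b # w'))"

definition f_op :: "nat \<Rightarrow> (nat \<Rightarrow> int) \<Rightarrow> nat \<Rightarrow> node set \<Rightarrow> node set option" where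
  "f_op e A i Y = (case filter fst (reduce_word (i_word e A Y i)) of
       [] \<Rightarrow> None
     | p # _ \<Rightarrow> Some (insert (snd p) Y))"

definition R_vertices :: "nat \<Rightarrow> (nat \<Rightarrow> int) \<Rightarrow> node set set" where
  "R_vertices e A = {Y. A_regular e A Y}"

definition Rn_vertices :: "nat \<Rightarrow> (nat \<Rightarrow> int) \<Rightarrow> nat \<Rightarrow> node set set" where
  "Rn_vertices e A n = {Y. A_regular e A Y \<and> card Y \<le> n * e}"

definition crystal_arrow :: "nat \<Rightarrow> (nat \<Rightarrow> int) \<Rightarrow> node set set \<Rightarrow> node set \<Rightarrow> nat \<Rightarrow> node set \<Rightarrow> bool" where
  "crystal_arrow e A V Y i Z \<longleftrightarrow> Y \<in> V \<and> Z \<in> V \<and> i < e \<and> f_op e A i Y = Some Z"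

definition crystal_iso :: "nat \<Rightarrow> (nat \<Rightarrow> int) \<Rightarrow> node set set \<Rightarrow> (nat \<Rightarrow> int) \<Rightarrow> node set set \<Rightarrow> bool" where
  "crystal_iso e A V B W \<longleftrightarrow> (\<exists>\<phi>. bij_betw \<phi> V W \<and>
     (\<forall>Y\<in>V. \<forall>Z\<in>V. \<forall>i. crystal_arrow e A V Y i Z \<longleftrightarrow> crystal_arrow e B W (\<phi> Y) i (\<phi> Z)))"

end

(* Encode a partition by its profile (diagonal lengths, equivalently the abacus). The order on
   i-nodes is governed by an integer "defect" that is additive up to 0 or 1, and A-regularity says
   that a bead above a gap never has defect 1. Consequently an addable and a removable node that
   cancel have defect at least 2; this makes the A-regular partitions closed under the crystal
   operators, and an extremal argument with the slope of A shows that only the empty partition is a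
   source. For residues that are not adjacent the operators commute; for adjacent residues the two
   signatures order the sites alike up to pairs controlled by regularity, which yields Stembridge's
   local axioms (this uses e >= 3). Crystals satisfying these axioms with a unique source and equal
   weights are isomorphic, by induction on the rank. *)
theory Submission
  imports Defs Complex_Main
begin

text \<open>The obstacle is that the nodes of residue i and those of residue i + 1 carry different
  orders, each depending on the partition through the columns. Freezing all other residues turns
  both into orders on one fixed set of windows, and one arises from the other by shifting the defect
  by the difference in bead numbers. They can therefore disagree only at defect exactly 1, the value
  that regularity restricts. The recurring device: if the defects of (x, y) and (y, z) are positive
  and that of (x, z) is 1, near-additivity forces both summands to be 1, and one of the two pairs is
  forbidden. Adding and removing nodes are handled together by a polarity that transposes the order
  and negates the signs, so the upward and downward axioms share one proof. The isomorphism pairs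
  vertices reached by the same word of arrows; that this is well defined at rank N + 1 follows by
  going down a square or octagon in one crystal and up its copy in the other.\<close>

section \<open>Signatures\<close>

definition psum :: "'s set \<Rightarrow> ('s \<Rightarrow> 's \<Rightarrow> bool) \<Rightarrow> ('s \<Rightarrow> int) \<Rightarrow> 's \<Rightarrow> int" where
  "psum N le s x = (\<Sum>y\<in>{y\<in>N. le y x}. s y)"

definition good :: "'s set \<Rightarrow> ('s \<Rightarrow> 's \<Rightarrow> bool) \<Rightarrow> ('s \<Rightarrow> int) \<Rightarrow> 's \<Rightarrow> bool" where
  "good N le s p \<longleftrightarrow> p \<in> N \<and> 1 \<le> psum N le s p \<and>
     (\<forall>y\<in>N. psum N le s y \<le> psum N le s p \<and>
        (le y p \<and> y \<noteq> p \<longrightarrow> psum N le s y < psum N le s p))"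

definition height :: "'s set \<Rightarrow> ('s \<Rightarrow> 's \<Rightarrow> bool) \<Rightarrow> ('s \<Rightarrow> int) \<Rightarrow> int" where
  "height N le s = Max (insert 0 (psum N le s ` N))"

text \<open>A signature is a finite linearly ordered set with signs \<open>1\<close> (removable) and
  \<open>-1\<close> (addable). The removable node that lowers the crystal element is the first place
  where the prefix sum is maximal, and the maximum is the string length. Reversing the order and
  negating the signs gives the addable node.\<close>

locale lin_carrier =
  fixes N :: "'s set" and le :: "'s \<Rightarrow> 's \<Rightarrow> bool"
  assumes fin: "finite N"
    and refl: "x \<in> N \<Longrightarrow> le x x"
    and antisym: "\<lbrakk>x \<in> N; y \<in> N; le x y; le y x\<rbrakk> \<Longrightarrow> x = y"
    and trans: "\<lbrakk>x \<in> N; y \<in> N; z \<in> N; le x y; le y z\<rbrakk> \<Longrightarrow> le x z"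
    and total: "\<lbrakk>x \<in> N; y \<in> N\<rbrakk> \<Longrightarrow> le x y \<or> le y x"
begin

lemma dual: "lin_carrier N (\<lambda>x y. le y x)"
proof
  fix x y z assume "x \<in> N" "y \<in> N" "z \<in> N" "le y x" "le z y"
  then show "le z x" using trans[of z y x] by simp
qed (simp_all add: fin refl antisym total)

lemma sub_carrier: 
  assumes "M \<subseteq> N" shows "lin_carrier M le"
proof
  show "finite M" using assms fin by (rule finite_subset)
next
  fix x y z assume "x \<in> M" "y \<in> M" "z \<in> M" "le x y" "le y z"
  then show "le x z" using trans[of x y z] assms by auto
next
  fix x y assume "x \<in> M" "y \<in> M" then show "le x y \<or> le y x" using total[of x y] assms by auto
next
  fix x y assume "x \<in> M" "y \<in> M" "le x y" "le y x" then show "x = y" using antisym[of x y] assms by auto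
next
  fix x assume "x \<in> M" then show "le x x" using refl[of x] assms by auto
qed

lemma ex_last: 
  assumes "S \<subseteq> N" "S \<noteq> {}" shows "\<exists>m\<in>S. \<forall>y\<in>S. le y m"
proof -
  have "finite S" using assms(1) fin finite_subset by blast
  then show ?thesis using assms(2,1)
  proof (induction rule: finite_ne_induct)
    case (singleton x) then show ?case using refl by auto
  next
    case (insert x F)
    then obtain m where m: "m \<in> F" "\<forall>y\<in>F. le y m" by auto
    have mx: "m \<in> N" "x \<in> N" "F \<subseteq> N" using m insert by auto
    show ?case
    proof (cases "le x m")
      case True then show ?thesis using m by auto
    next
      case False
      then have "le m x" using total mx by blast
      then have "\<forall>y\<in>insert x F. le y x" using m mx trans refl by blast
      then show ?thesis by blast
    qed
  qed
qed

lemma ex_first: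
  assumes "S \<subseteq> N" "S \<noteq> {}" shows "\<exists>m\<in>S. \<forall>y\<in>S. le m y"
  using lin_carrier.ex_last[OF dual assms] .

lemma psum_le_height: "x \<in> N \<Longrightarrow> psum N le s x \<le> height N le s"
  unfolding height_def using fin by simp

lemma height_nonneg: "0 \<le> height N le s"
  unfolding height_def using fin by simp

lemma height_attained: "height N le s = 0 \<or> (\<exists>x\<in>N. psum N le s x = height N le s)"
proof -
  have "height N le s \<in> insert 0 (psum N le s ` N)"
    unfolding height_def using fin by (intro Max_in) auto
  then show ?thesis by auto
qed

lemma height_eqI:
  assumes "0 \<le> m" "\<And>x. x \<in> N \<Longrightarrow> psum N le s x \<le> m" "m = 0 \<or> (\<exists>x\<in>N. psum N le s x = m)"
  shows "height N le s = m"
  unfolding height_def using fin assms by (intro Max_eqI) auto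

text \<open>Prefix sums are indexed by elements of \<open>N\<close>; this passes to arbitrary
  initial segments, including the empty one, so that they can be compared with
  \<open>height\<close>.\<close>

lemma seg_psum:
  assumes "I \<subseteq> N" "\<And>x y. \<lbrakk>x \<in> I; y \<in> N; le y x\<rbrakk> \<Longrightarrow> y \<in> I"
  shows "I = {} \<or> (\<exists>m\<in>I. sum s I = psum N le s m)"
proof (cases "I = {}")
  case False
  then obtain m where m: "m \<in> I" "\<forall>y\<in>I. le y m" using ex_last[OF assms(1)] by auto
  then have "I = {y\<in>N. le y m}" using assms(1) assms(2)[OF m(1)] by auto
  then have "sum s I = psum N le s m" unfolding psum_def by (rule arg_cong)
  then show ?thesis using m(1) by blast
qed simp

lemma seg_le_height:
  assumes "I \<subseteq> N" "\<And>x y. \<lbrakk>x \<in> I; y \<in> N; le y x\<rbrakk> \<Longrightarrow> y \<in> I"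
  shows "sum s I \<le> height N le s"
proof -
  consider "I = {}" | m where "m \<in> I" "sum s I = psum N le s m"
    using seg_psum[of I s] assms by metis
  then show ?thesis
  proof cases
    case 1 then show ?thesis using height_nonneg by simp
  next
    case 2 then show ?thesis using psum_le_height assms by auto
  qed
qed

lemma psum_split:
  assumes "x \<in> N" shows "psum N le s x = (\<Sum>y\<in>{y\<in>N. le y x \<and> y \<noteq> x}. s y) + s x"
proof -
  have "{y\<in>N. le y x} = insert x {y\<in>N. le y x \<and> y \<noteq> x}" using assms refl by auto
  then show ?thesis unfolding psum_def using fin by simp
qed

text \<open>Replaces an enumeration of \<open>N\<close>: an element is either first or has an
  immediate predecessor \<open>m\<close>, from which its prefix sum differs by its own sign.\<close>

lemma pred_cases:
  assumes "x \<in> N"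
  shows "psum N le s x = s x \<and> (\<forall>y\<in>N. le y x \<longrightarrow> y = x) \<or>
    (\<exists>m\<in>N. le m x \<and> m \<noteq> x \<and> psum N le s x = psum N le s m + s x \<and> (\<forall>y\<in>N. le y x \<and> y \<noteq> x \<longrightarrow> le y m))"
proof -
  let ?I = "{y\<in>N. le y x \<and> y \<noteq> x}"
  show ?thesis
  proof (cases "?I = {}")
    case True then have "psum N le s x = s x" using psum_split[OF assms, of s]
      by (metis (lifting) add_0 sum.empty)
    then show ?thesis using True by blast
  next
    case False
    then obtain m where m: "m \<in> ?I" "\<forall>y\<in>?I. le y m" using ex_last[of ?I] by blast
    have "?I = {y\<in>N. le y m}"
    proof
      show "{y\<in>N. le y m} \<subseteq> ?I"
      proof
        fix y assume y: "y \<in> {y\<in>N. le y m}"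
        then have "le y x" using m trans[of y m x] assms by auto
        moreover have "y \<noteq> x" using y m antisym[of x m] assms by auto
        ultimately show "y \<in> ?I" using y by auto
      qed
    qed (use m in auto)
    then have "psum N le s x = psum N le s m + s x" using psum_split[OF assms, of s] unfolding psum_def by simp
    then show ?thesis using m by blast
  qed
qed

lemma good_height: "good N le s p \<Longrightarrow> psum N le s p = height N le s"
  unfolding good_def by (intro height_eqI[symmetric]) auto

lemma goodI:
  assumes "p \<in> N" "1 \<le> psum N le s p" "\<And>y. y \<in> N \<Longrightarrow> psum N le s y \<le> psum N le s p"
    "\<And>y. \<lbrakk>y \<in> N; \<not> le p y\<rbrakk> \<Longrightarrow> psum N le s y < psum N le s p"
  shows "good N le s p"
  unfolding good_def using assms antisym by blast

lemma good_unique: "\<lbrakk>good N le s p; good N le s q\<rbrakk> \<Longrightarrow> p = q"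
  unfolding good_def using total by (metis less_le_not_le)

lemma good_before: "\<lbrakk>good N le s p; y \<in> N; \<not> le p y\<rbrakk> \<Longrightarrow> psum N le s y < height N le s"
  using good_height[of s p] total refl unfolding good_def by metis

lemma good_sign: 
  assumes "good N le s p" shows "1 \<le> s p"
proof -
  have p: "p \<in> N" using assms unfolding good_def by simp
  show ?thesis using pred_cases[OF p, of s] assms unfolding good_def by force
qed

lemma ex_first_level:
  assumes "x \<in> N" "Q x" shows "\<exists>m\<in>N. Q m \<and> (\<forall>y\<in>N. Q y \<longrightarrow> le m y)"
  using ex_first[of "{y\<in>N. Q y}"] assms by blast

lemma ex_good:
  assumes "0 < height N le s" shows "\<exists>p. good N le s p"
proof -
  obtain x where "x \<in> N" "psum N le s x = height N le s" using height_attained[of s] assms by auto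
  then obtain m where m: "m\<in>N" "psum N le s m = height N le s" "\<forall>y\<in>N. psum N le s y = height N le s \<longrightarrow> le m y"
    using ex_first_level[of x "\<lambda>x. psum N le s x = height N le s"] by blast
  then have "good N le s m" using assms psum_le_height[where s=s]
    by (intro goodI) (auto simp: order_less_le)
  then show ?thesis ..
qed

lemma good_pos: "good N le s p \<Longrightarrow> 0 < height N le s"
  using good_height[of s p] unfolding good_def by auto

section \<open>Changing one sign and reversing the order\<close>

lemma psum_upd:
  assumes "p \<in> N"
  shows "psum N le (s(p := s p + d)) x = psum N le s x + (if le p x then d else 0)"
proof (cases "le p x")
  case True
  have f: "finite {y\<in>N. le y x}" "p \<in> {y\<in>N. le y x}" using fin True assms by auto
  have "sum (s(p := s p + d)) ({y\<in>N. le y x} - {p}) = sum s ({y\<in>N. le y x} - {p})"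
    by (rule sum.cong) auto
  then show ?thesis unfolding psum_def using True sum.remove[OF f, of s] sum.remove[OF f, of "s(p := s p + d)"] by simp
next
  case False
  then show ?thesis unfolding psum_def by (auto intro!: sum.cong)
qed

text \<open>Precisely the prefix sums at or after \<open>p\<close> go up, so the maximum moves only
  if it was already attained there. This dichotomy later separates squares from octagons.\<close>

lemma height_upd:
  assumes "p \<in> N"
  shows "height N le (s(p := s p + 1)) =
     (if \<exists>x\<in>N. le p x \<and> psum N le s x = height N le s then height N le s + 1 else height N le s)"
proof (rule height_eqI)
  note U = psum_upd[OF assms, of s 1]
  show "0 \<le> (if \<exists>x\<in>N. le p x \<and> psum N le s x = height N le s then height N le s + 1 else height N le s)"
    using height_nonneg[of s] by simp
  fix x assume "x \<in> N"
  then show "psum N le (s(p := s p + 1)) x \<le> (if \<exists>x\<in>N. le p x \<and> psum N le s x = height N le s then height N le s + 1 else height N le s)"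
    using psum_le_height[of x s] unfolding U by force
next
  note U = psum_upd[OF assms, of s 1]
  show "(if \<exists>x\<in>N. le p x \<and> psum N le s x = height N le s then height N le s + 1 else height N le s) = 0 \<or>
    (\<exists>x\<in>N. psum N le (s(p := s p + 1)) x = (if \<exists>x\<in>N. le p x \<and> psum N le s x = height N le s then height N le s + 1 else height N le s))"
  proof (cases "\<exists>x\<in>N. le p x \<and> psum N le s x = height N le s")
    case True then show ?thesis unfolding U by auto
  next
    case False then show ?thesis using height_attained[of s] unfolding U by auto
  qed
qed

text \<open>A negated suffix sum is the complementary prefix sum minus the total, the empty prefix
  corresponding to the full suffix. In the crystal this says that the two string lengths differ by
  the weight.\<close>

lemma height_dual: "height N (\<lambda>x y. le y x) (\<lambda>x. - s x) = height N le s - sum s N"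
proof (rule lin_carrier.height_eqI[OF dual])
  have S: "sum s (N - I) = sum s N - sum s I" if "I \<subseteq> N" for I
    using sum_diff[OF fin that] .
  show "0 \<le> height N le s - sum s N" using seg_le_height[of N s] by auto
  fix x assume x: "x \<in> N"
  let ?J = "{y \<in> N. le x y}"
  have "sum s (N - ?J) \<le> height N le s"
    by (rule seg_le_height) (use x trans in blast)+
  then show "psum N (\<lambda>x y. le y x) (\<lambda>x. - s x) x \<le> height N le s - sum s N"
    using S[of ?J] unfolding psum_def by (simp add: sum_negf)
next
  have S: "sum s (N - I) = sum s N - sum s I" if "I \<subseteq> N" for I
    using sum_diff[OF fin that] .
  have "\<exists>I. I \<subseteq> N \<and> sum s I = height N le s \<and> (\<forall>x\<in>I. \<forall>y\<in>N. le y x \<longrightarrow> y \<in> I)"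
    using height_attained[of s]
  proof
    assume "height N le s = 0" then show ?thesis by (intro exI[of _ "{}"]) simp
  next
    assume "\<exists>x\<in>N. psum N le s x = height N le s"
    then obtain x where x: "x \<in> N" "psum N le s x = height N le s" by auto
    then have "\<forall>u\<in>{y\<in>N. le y x}. \<forall>y\<in>N. le y u \<longrightarrow> y \<in> {y\<in>N. le y x}" using trans by blast
    then show ?thesis using x by (intro exI[of _ "{y\<in>N. le y x}"]) (auto simp: psum_def)
  qed
  then obtain I where I: "I \<subseteq> N" "sum s I = height N le s" "\<forall>x\<in>I. \<forall>y\<in>N. le y x \<longrightarrow> y \<in> I" by blast
  show "height N le s - sum s N = 0 \<or>
    (\<exists>x\<in>N. psum N (\<lambda>x y. le y x) (\<lambda>x. - s x) x = height N le s - sum s N)"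
  proof (cases "I = N")
    case False
    have "N - I = {} \<or> (\<exists>m\<in>N-I. sum (\<lambda>x. - s x) (N - I) = psum N (\<lambda>x y. le y x) (\<lambda>x. - s x) m)"
      by (rule lin_carrier.seg_psum[OF dual]) (use I in auto)
    then obtain m where "m\<in>N-I" "sum (\<lambda>x. - s x) (N - I) = psum N (\<lambda>x y. le y x) (\<lambda>x. - s x) m"
      using False I by auto
    moreover have "sum (\<lambda>x. - s x) (N - I) = height N le s - sum s N" using S[OF I(1)] I by (simp add: sum_negf)
    ultimately show ?thesis by auto
  next
    case True then show ?thesis using I(2) by simp
  qed
qed

lemma psum_dual:
  assumes "x \<in> N" shows "psum N (\<lambda>x y. le y x) (\<lambda>x. - s x) x = psum N le s x - s x - sum s N"
proof -
  let ?I = "{y\<in>N. le y x \<and> y \<noteq> x}" and ?J = "{y\<in>N. le x y}"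
  have "y \<in> N \<Longrightarrow> (\<not> le x y) = (le y x \<and> y \<noteq> x)" for y
    using assms total[of x y] refl antisym[of x y] by auto
  then have "N - ?J = ?I" by auto
  then have "sum s ?I = sum s N - sum s ?J" using sum_diff[OF fin, of ?J s] by auto
  then show ?thesis using psum_split[OF assms, of s] unfolding psum_def by (simp add: sum_negf)
qed

text \<open>The reason why adding and removing are mutually inverse: prefix sums stay below the
  maximum before \<open>p\<close> and never exceed it afterwards, so after the flip the suffix
  starting at \<open>p\<close> is the one selected by the reversed rule.\<close>

lemma good_flip:
  assumes g: "good N le s p" and sp: "s p = 1"
  shows "good N (\<lambda>x y. le y x) (\<lambda>x. - (s(p := -1)) x) p"
proof -
  have p: "p \<in> N" using g unfolding good_def by simp
  have T: "sum (s(p := -1)) N = sum s N - 2" 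
    using sum.remove[OF fin p, of "s(p := -1)"] sum.remove[OF fin p, of s] sp by simp
  have U: "psum N le (s(p := -1)) x = psum N le s x + (if le p x then -2 else 0)" for x
    using psum_upd[OF p, of s "-2" x] sp by simp
  let ?h = "height N le s"
  have V: "psum N (\<lambda>x y. le y x) (\<lambda>x. - (s(p := -1)) x) x =
     psum N le s x + (if le p x then -2 else 0) - (if x = p then -1 else s x) - sum s N + 2" if "x \<in> N" for x
    using psum_dual[OF that, of "s(p := -1)"] U T by simp
  have hp: "psum N le s p = ?h" using g by (rule good_height)
  have Vp: "psum N (\<lambda>x y. le y x) (\<lambda>x. - (s(p := -1)) x) p = ?h + 1 - sum s N"
    using V[OF p] hp refl[OF p] by simp
  \<comment> \<open>The left side is the sum strictly before \<open>x\<close>; it can reach the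
    height only if \<open>p\<close> itself lies strictly before \<open>x\<close>.\<close>
  have Q: "psum N le s x - s x \<le> ?h - (if le p x \<and> x \<noteq> p then 0 else 1)" if x: "x \<in> N" for x
  proof -
    consider "psum N le s x = s x" 
      | m where "m\<in>N" "le m x" "m \<noteq> x" "psum N le s x = psum N le s m + s x"
      using pred_cases[OF x, of s] by blast
    then show ?thesis
    proof cases
      case 1 then show ?thesis using good_pos[OF g] by auto
    next
      case 2
      have "psum N le s m \<le> ?h" using psum_le_height 2 by auto
      moreover have "psum N le s m < ?h" if "\<not> (le p x \<and> x \<noteq> p)"
      proof (rule good_before[OF g \<open>m\<in>N\<close>])
        show "\<not> le p m" using that 2 antisym[of x m] antisym[of p x] trans[of p m x] p x by auto
      qed
      ultimately show ?thesis using 2 by auto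
    qed
  qed
  have "sum s N \<le> ?h" using seg_le_height[of N s] by auto
  show ?thesis
  proof (rule lin_carrier.goodI[OF dual p])
    show "1 \<le> psum N (\<lambda>x y. le y x) (\<lambda>x. - (s(p := -1)) x) p" using Vp \<open>sum s N \<le> ?h\<close> by simp
    fix y assume y: "y \<in> N"
    show "psum N (\<lambda>x y. le y x) (\<lambda>x. - (s(p := -1)) x) y \<le> psum N (\<lambda>x y. le y x) (\<lambda>x. - (s(p := -1)) x) p"
      using Q[OF y] V[OF y] Vp sp by (cases "y = p") (auto split: if_splits)
    assume "\<not> le y p"
    then have "le p y" "y \<noteq> p" using total y p refl by auto
    then show "psum N (\<lambda>x y. le y x) (\<lambda>x. - (s(p := -1)) x) y < psum N (\<lambda>x y. le y x) (\<lambda>x. - (s(p := -1)) x) p"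
      using Q[OF y] V[OF y] Vp by auto
  qed
qed

lemma height_flip:
  assumes g: "good N le s p" and sp: "s p = 1"
  shows "height N le (s(p := -1)) = height N le s - 1"
proof (rule height_eqI)
  have p: "p \<in> N" using g unfolding good_def by simp
  have U: "psum N le (s(p := -1)) x = psum N le s x + (if le p x then -2 else 0)" for x
    using psum_upd[OF p, of s "-2" x] sp by simp
  show "0 \<le> height N le s - 1" using good_pos[OF g] by simp
  show "psum N le (s(p := -1)) x \<le> height N le s - 1" if "x \<in> N" for x
    using good_before[OF g that] psum_le_height[OF that, of s] unfolding U by (cases "le p x") auto
  note hp = good_height[OF g]
  show "height N le s - 1 = 0 \<or> (\<exists>x\<in>N. psum N le (s(p := -1)) x = height N le s - 1)"
    using pred_cases[OF p, of s]
  proof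
    assume "psum N le s p = s p \<and> (\<forall>y\<in>N. le y p \<longrightarrow> y = p)"
    then show ?thesis using hp sp by simp
  next
    assume "\<exists>m\<in>N. le m p \<and> m \<noteq> p \<and> psum N le s p = psum N le s m + s p \<and> (\<forall>y\<in>N. le y p \<and> y \<noteq> p \<longrightarrow> le y m)"
    then obtain m where m: "m \<in> N" "le m p" "m \<noteq> p" "psum N le s p = psum N le s m + s p" by blast
    then have "\<not> le p m" using antisym[of p m] p by auto
    then have "psum N le (s(p := -1)) m = height N le s - 1" unfolding U using m hp sp by simp
    then show ?thesis using m(1) by blast
  qed
qed

lemma good_carrier:
  assumes "M \<subseteq> N" "\<And>x. x \<in> N - M \<Longrightarrow> s x = 0"
  shows "good N le s p \<longleftrightarrow> good M le s p" and "height N le s = height M le s"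
proof -
  interpret M: lin_carrier M le using sub_carrier assms(1) .
  have E: "psum N le s x = sum s {y\<in>M. le y x}" for x
    unfolding psum_def by (rule sum.mono_neutral_right) (use fin assms in auto)
  have EM: "psum N le s x = psum M le s x" for x
    using E unfolding psum_def by simp
  have X: "psum N le s x = 0 \<or> (\<exists>m\<in>M. le m x \<and> psum N le s x = psum M le s m)" if "x \<in> N" for x
    using M.seg_psum[of "{y\<in>M. le y x}" s] E[of x] trans that assms(1) by (smt (verit) mem_Collect_eq subsetD subsetI sum.empty)
  show "height N le s = height M le s"
  proof (rule height_eqI)
    show "psum N le s x \<le> height M le s" if "x \<in> N" for x
      using X[OF that] M.psum_le_height M.height_nonneg by auto
    show "height M le s = 0 \<or> (\<exists>x\<in>N. psum N le s x = height M le s)"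
      using M.height_attained[of s] EM assms(1) by auto
  qed (rule M.height_nonneg)
  show "good N le s p \<longleftrightarrow> good M le s p"
  proof
    assume g: "good N le s p"
    then have "p \<in> M" using good_sign[OF g] assms(2)[of p] unfolding good_def by force
    then show "good M le s p" using g assms(1) unfolding good_def EM by blast
  next
    assume g: "good M le s p"
    show "good N le s p"
    proof (rule goodI)
      show "p \<in> N" using g assms(1) unfolding good_def by auto
      show "1 \<le> psum N le s p" using g EM unfolding good_def by auto
      fix y assume y: "y \<in> N"
      show "psum N le s y \<le> psum N le s p"
        using X[OF y] g EM unfolding good_def by force
      assume np: "\<not> le p y"
      have "m \<noteq> p \<and> le m p" if "m\<in>M" "le m y" for m
        using that np total \<open>p\<in>N\<close> y assms(1) trans by blast
      then show "psum N le s y < psum N le s p"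
        using X[OF y] g EM unfolding good_def by force
    qed
  qed
qed

text \<open>Without a negative sign strictly between, the prefix sum at \<open>x\<close> would
  exceed the maximum at \<open>p\<close>. It supplies the intermediate node in the arguments with
  unit defects.\<close>

lemma between:
  assumes "good N le s p" "x \<in> N" "\<not> le x p" "1 \<le> s x"
  shows "\<exists>z\<in>N. \<not> le z p \<and> \<not> le x z \<and> s z < 0"
proof (rule ccontr)
  assume "\<not> ?thesis"
  then have A: "s z \<ge> 0" if "z \<in> N" "\<not> le z p" "\<not> le x z" for z using that by force
  have p: "p \<in> N" using assms unfolding good_def by auto
  have px: "le p x" using total assms p by blast
  let ?I = "{y\<in>N. le y p}" and ?J = "{y\<in>N. le y x}"
  have sub: "?I \<subseteq> ?J" using px trans p assms by blast
  have "sum s ?J = sum s ?I + sum s (?J - ?I)" using sum.subset_diff[OF sub, of s] fin by simp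
  moreover have "sum s (?J - ?I) = s x + sum s (?J - ?I - {x})"
    using sum.remove[of "?J - ?I" x s] fin assms refl by auto
  moreover have "sum s (?J - ?I - {x}) \<ge> 0"
    by (intro sum_nonneg A) (use antisym assms in auto)
  ultimately have "psum N le s x > psum N le s p" using assms unfolding psum_def by linarith
  then show False using assms unfolding good_def by force
qed

end

section \<open>Two adjacent residues\<close>

text \<open>Model of two adjacent residues \<open>i\<close>, \<open>i + 1\<close>: a site is a
  window of three consecutive abacus positions holding one bead (\<open>w\<close> true) or two beads
  (\<open>w\<close> false). The state is given by two bits, \<open>a\<close> changed by residue
  \<open>i\<close> and \<open>b\<close> changed by residue \<open>i + 1\<close>; residue
  \<open>i\<close> has a node at a site iff \<open>b \<noteq> w\<close>, residue \<open>i +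
  1\<close> iff \<open>a = w\<close>. A site \<open>x\<close> precedes \<open>y\<close> iff \<open>D
  x y \<ge> 1\<close>. The two residues order the sites alike except for pairs with \<open>D x y =
  1\<close> where \<open>x\<close> has two beads and \<open>y\<close> one, and regularity excludes
  the states in which such a pair is middle-middle.\<close>

definition sgA :: "'s set \<Rightarrow> ('s \<Rightarrow> bool) \<Rightarrow> ('s \<Rightarrow> bool) \<Rightarrow> ('s \<Rightarrow> bool) \<Rightarrow> 's \<Rightarrow> int" where
  "sgA P w a b x = (if x \<in> P \<and> b x \<noteq> w x then (if a x then 1 else -1) else 0)"

definition shifted :: "('s \<Rightarrow> 's \<Rightarrow> int) \<Rightarrow> ('s \<Rightarrow> bool) \<Rightarrow> 's \<Rightarrow> 's \<Rightarrow> int" where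
  "shifted D w x y = D x y + of_bool (w x) - of_bool (w y)"

locale defect_order =
  fixes P :: "'s set" and D :: "'s \<Rightarrow> 's \<Rightarrow> int"
  assumes finP: "finite P"
    and D_refl: "x \<in> P \<Longrightarrow> D x x = 0"
    and D_sym: "\<lbrakk>x \<in> P; y \<in> P; x \<noteq> y\<rbrakk> \<Longrightarrow> D x y + D y x = 1"
    and D_tri: "\<lbrakk>x \<in> P; y \<in> P; z \<in> P\<rbrakk> \<Longrightarrow> D x z \<le> D x y + D y z"
    and D_tri': "\<lbrakk>x \<in> P; y \<in> P; z \<in> P\<rbrakk> \<Longrightarrow> D x y + D y z \<le> D x z + 1"
begin

lemma lin: "lin_carrier P (\<lambda>x y. D y x \<le> 0)"
proof
  fix x y z assume "x \<in> P" "y \<in> P" "z \<in> P" "D y x \<le> 0" "D z y \<le> 0"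
  then show "D z x \<le> 0" using D_tri[of z y x] by simp
next
  fix x y assume "x \<in> P" "y \<in> P"
  then show "D y x \<le> 0 \<or> D x y \<le> 0" using D_sym[of x y] D_refl[of x] by (cases "x = y") auto
next
  fix x y assume "x \<in> P" "y \<in> P" "D y x \<le> 0" "D x y \<le> 0"
  then show "x = y" using D_sym[of x y] by force
qed (simp_all add: finP D_refl)

lemma defect_order_transpose: "defect_order P (\<lambda>x y. D y x)"
proof
  fix x y z assume *: "x \<in> P" "y \<in> P" "z \<in> P"
  show "D z x \<le> D y x + D z y" using D_tri[of z y x] * by simp
  show "D y x + D z y \<le> D z x + 1" using D_tri'[of z y x] * by simp
next
  fix x y assume "x \<in> P" "y \<in> P" "x \<noteq> y"
  then show "D y x + D x y = 1" using D_sym[of x y] by simp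
qed (simp_all add: finP D_refl)

text \<open>The added term \<open>w x - w y\<close> is a coboundary: it cancels in the symmetric sum
  and in both triangle inequalities.\<close>

lemma defect_order_shifted: "defect_order P (shifted D w)"
proof
  fix x y z assume *: "x \<in> P" "y \<in> P" "z \<in> P"
  show "shifted D w x z \<le> shifted D w x y + shifted D w y z" using D_tri[of x y z] * unfolding shifted_def by simp
  show "shifted D w x y + shifted D w y z \<le> shifted D w x z + 1" using D_tri'[of x y z] * unfolding shifted_def by simp
next
  fix x y assume "x \<in> P" "y \<in> P" "x \<noteq> y"
  then show "shifted D w x y + shifted D w y x = 1" using D_sym[of x y] unfolding shifted_def by simp
qed (simp_all add: finP D_refl shifted_def)

end

locale pair_model = defect_order P D for P :: "'s set" and D +
  fixes w :: "'s \<Rightarrow> bool" and allowed :: "('s \<Rightarrow> bool) \<Rightarrow> ('s \<Rightarrow> bool) \<Rightarrow> bool"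
  assumes forb: "\<lbrakk>allowed a b; x \<in> P; y \<in> P; D x y = 1; \<not> w x; w y; \<not> a x; b x; a y; \<not> b y\<rbrakk> \<Longrightarrow> False"
    and closA: "\<lbrakk>allowed a b; good P (\<lambda>x y. D y x \<le> 0) (sgA P w a b) p\<rbrakk> \<Longrightarrow> allowed (a(p := False)) b"
    and closB: "\<lbrakk>allowed a b; good P (\<lambda>x y. shifted D w y x \<le> 0) (sgA P (\<lambda>x. \<not> w x) b a) p\<rbrakk> \<Longrightarrow> allowed a (b(p := False))"
begin

abbreviation leA where "leA x y \<equiv> D y x \<le> 0"
abbreviation leB where "leB x y \<equiv> shifted D w y x \<le> 0"
abbreviation "sB a b \<equiv> sgA P (\<lambda>x. \<not> w x) b a"
abbreviation "gA a b \<equiv> good P leA (sgA P w a b)"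
abbreviation "gB a b \<equiv> good P leB (sB a b)"
abbreviation "FA a b \<equiv> psum P leA (sgA P w a b)"
abbreviation "FB a b \<equiv> psum P leB (sB a b)"
abbreviation "hA a b \<equiv> height P leA (sgA P w a b)"
abbreviation "hB a b \<equiv> height P leB (sB a b)"

lemma shifted_shifted: "shifted (shifted D w) (\<lambda>x. \<not> w x) = D"
  by (intro ext) (auto simp: shifted_def)

text \<open>Exchanging the two residues is a symmetry of the model, because shifting by
  \<open>w\<close> and then by its negation restores \<open>D\<close>. The forbidden pair is the
  same one read in the opposite direction.\<close>

lemma swap: "pair_model P (shifted D w) (\<lambda>x. \<not> w x) (\<lambda>a b. allowed b a)"
proof -
  interpret S: defect_order P "shifted D w" by (rule defect_order_shifted)
  show ?thesis
  proof
    fix a b x y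
    assume H: "allowed b a" "x \<in> P" "y \<in> P" "shifted D w x y = 1" "\<not> \<not> w x" "\<not> w y" "\<not> a x" "b x" "a y" "\<not> b y"
    then have "x \<noteq> y" by auto
    then have "D y x = 1" using H D_sym[of x y] by (simp add: shifted_def)
    then show False using forb[of b a y x] H by auto
  next
    fix a b p assume "allowed b a" "good P (\<lambda>x y. shifted D w y x \<le> 0) (sgA P (\<lambda>x. \<not> w x) a b) p"
    then show "allowed b (a(p := False))" by (rule closB)
  next
    fix a b p assume "allowed b a" "good P (\<lambda>x y. shifted (shifted D w) (\<lambda>x. \<not> w x) y x \<le> 0) (sgA P (\<lambda>x. \<not> \<not> w x) b a) p"
    then show "allowed (b(p := False)) a" unfolding shifted_shifted by (intro closA) simp_all
  qed
qed

sublocale A: lin_carrier P leA by (rule lin)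
sublocale B: lin_carrier P leB by (rule defect_order.lin[OF defect_order_shifted])

lemma gA_D: assumes "gA a b p" shows "p \<in> P" "a p" "b p = (\<not> w p)"
proof -
  have "sgA P w a b p \<ge> 1" using assms by (rule A.good_sign)
  then show "p \<in> P" "a p" "b p = (\<not> w p)" unfolding sgA_def by (auto split: if_splits)
qed

lemma gB_D: assumes "gB a b p" shows "p \<in> P" "b p" "a p = w p"
proof -
  have "sB a b p \<ge> 1" using assms by (rule B.good_sign)
  then show "p \<in> P" "b p" "a p = w p" unfolding sgA_def by (auto split: if_splits)
qed

text \<open>For its own residue the sign at \<open>p\<close> goes from 1 to -1; for the other
  residue it goes from -1 to 0 or from 0 to 1, depending on \<open>w p\<close>. The changes -2 and
  +1 are the negated Cartan entries.\<close>

lemma upd_a: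
  assumes g: "gA a b p"
  shows "FA (a(p := False)) b x = FA a b x + (if leA p x then -2 else 0)"
    and "FB (a(p := False)) b x = FB a b x + (if leB p x then 1 else 0)"
    and "hB (a(p := False)) b = (if \<exists>x\<in>P. leB p x \<and> FB a b x = hB a b then hB a b + 1 else hB a b)"
proof -
  have 1: "sgA P w (a(p := False)) b = (sgA P w a b)(p := sgA P w a b p + (-2))"
    by (rule ext) (use gA_D[OF g] in \<open>auto simp: sgA_def\<close>)
  have 2: "sB (a(p := False)) b = (sB a b)(p := sB a b p + 1)"
    by (rule ext) (use gA_D[OF g] in \<open>auto simp: sgA_def\<close>)
  show "FA (a(p := False)) b x = FA a b x + (if leA p x then -2 else 0)"
    unfolding 1 by (rule A.psum_upd) (rule gA_D[OF g])
  show "FB (a(p := False)) b x = FB a b x + (if leB p x then 1 else 0)"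
    unfolding 2 by (rule B.psum_upd) (rule gA_D[OF g])
  show "hB (a(p := False)) b = (if \<exists>x\<in>P. leB p x \<and> FB a b x = hB a b then hB a b + 1 else hB a b)"
    unfolding 2 by (rule B.height_upd) (rule gA_D[OF g])
qed

lemma upd_b:
  assumes g: "gB a b p"
  shows "FB a (b(p := False)) x = FB a b x + (if leB p x then -2 else 0)"
    and "FA a (b(p := False)) x = FA a b x + (if leA p x then 1 else 0)"
    and "hA a (b(p := False)) = (if \<exists>x\<in>P. leA p x \<and> FA a b x = hA a b then hA a b + 1 else hA a b)"
proof -
  have 1: "sB a (b(p := False)) = (sB a b)(p := sB a b p + (-2))"
    by (rule ext) (use gB_D[OF g] in \<open>auto simp: sgA_def\<close>)
  have 2: "sgA P w a (b(p := False)) = (sgA P w a b)(p := sgA P w a b p + 1)"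
    by (rule ext) (use gB_D[OF g] in \<open>auto simp: sgA_def\<close>)
  show "FB a (b(p := False)) x = FB a b x + (if leB p x then -2 else 0)"
    unfolding 1 by (rule B.psum_upd) (rule gB_D[OF g])
  show "FA a (b(p := False)) x = FA a b x + (if leA p x then 1 else 0)"
    unfolding 2 by (rule A.psum_upd) (rule gB_D[OF g])
  show "hA a (b(p := False)) = (if \<exists>x\<in>P. leA p x \<and> FA a b x = hA a b then hA a b + 1 else hA a b)"
    unfolding 2 by (rule A.height_upd) (rule gB_D[OF g])
qed

text \<open>The orders differ by a shift of at most 1, so \<open>D x y\<close> at least 1 becomes
  nonpositive after the shift only in the extreme case.\<close>

lemma inconsistent:
  assumes "x \<in> P" "y \<in> P" "leA x y" "leB y x" "x \<noteq> y"
  shows "\<not> w x" "w y" "D x y = 1"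
proof -
  have "D x y \<ge> 1" using D_sym[of x y] assms by auto
  then show "\<not> w x" "w y" "D x y = 1" using assms(4) unfolding shifted_def by (auto simp: of_bool_def split: if_splits)
qed

text \<open>An unchanged height means that \<open>FB\<close> stays below its maximum from
  \<open>p\<close> on, so \<open>q\<close> precedes \<open>p\<close> in the second order. The first
  order agrees, for otherwise \<open>p\<close> and \<open>q\<close> would be a forbidden pair after
  both removals. Hence clearing \<open>b q\<close> raises the prefix sum at \<open>p\<close>, and
  \<open>p\<close> stays good.\<close>

lemma square:
  assumes allowed: "allowed a b" and p: "gA a b p" and q: "gB a b q" and h: "hB (a(p := False)) b = hB a b"
  shows "gB (a(p := False)) b q" "gA a (b(q := False)) p" "hA a (b(q := False)) = hA a b + 1"
proof -
  note pD = gA_D[OF p] and qD = gB_D[OF q]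
  have pq: "p \<noteq> q" using pD qD by auto
  have lt: "FB a b x < hB a b" if "x \<in> P" "leB p x" for x
    using h that B.psum_le_height[of x "sB a b"] unfolding upd_a(3)[OF p] by (auto split: if_splits simp: order_less_le)
  have hq: "FB a b q = hB a b" and hp: "FA a b p = hA a b" using q p B.good_height A.good_height by auto
  have npq: "\<not> leB p q" using lt[OF qD(1)] hq by auto
  have qp: "leB q p" using npq B.total pD qD by blast
  show gq: "gB (a(p := False)) b q"
  proof (rule B.goodI)
    fix y assume y: "y \<in> P"
    show "FB (a(p := False)) b y \<le> FB (a(p := False)) b q"
      using lt[OF y] npq hq B.psum_le_height[OF y, of "sB a b"] unfolding upd_a(2)[OF p] by auto
    assume "\<not> leB q y"
    moreover have "\<not> leB p y" using calculation qp B.trans[of q p y] qD pD y by auto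
    ultimately show "FB (a(p := False)) b y < FB (a(p := False)) b q"
      using npq hq B.good_before[OF q y] unfolding upd_a(2)[OF p] by auto
  qed (use qD npq q in \<open>auto simp: upd_a(2)[OF p] good_def\<close>)
  have allowed': "allowed (a(p := False)) (b(q := False))" using closB[OF closA[OF allowed p] gq] .
  have qpA: "leA q p"
  proof (rule ccontr)
    assume "\<not> leA q p"
    then have "leA p q" using A.total pD qD by blast
    from inconsistent[OF pD(1) qD(1) this qp pq]
    show False using forb[OF allowed' pD(1) qD(1)] pq pD qD by auto
  qed
  show "gA a (b(q := False)) p"
  proof (rule A.goodI)
    fix y assume y: "y \<in> P"
    show "FA a (b(q := False)) y \<le> FA a (b(q := False)) p"
      using hp A.psum_le_height[OF y, of "sgA P w a b"] qpA unfolding upd_b(2)[OF q] by auto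
    assume "\<not> leA p y"
    then show "FA a (b(q := False)) y < FA a (b(q := False)) p"
      using qpA hp A.good_before[OF p y] unfolding upd_b(2)[OF q] by auto
  qed (use pD qpA p in \<open>auto simp: upd_b(2)[OF q] good_def\<close>)
  show "hA a (b(q := False)) = hA a b + 1"
    unfolding upd_b(3)[OF q] using qpA hp pD by auto
qed

lemma first_level:
  assumes p: "gA a b p" and h: "hB (a(p := False)) b = hB a b + 1"
  shows "\<exists>q'\<in>P. leB p q' \<and> FB a b q' = hB a b \<and>
    (\<forall>y\<in>P. leB p y \<and> \<not> leB q' y \<longrightarrow> FB a b y < hB a b)"
proof -
  obtain x where x: "x \<in> P" "leB p x \<and> FB a b x = hB a b"
    using h unfolding upd_a(3)[OF p] by (auto split: if_splits)
  obtain q' where q': "q' \<in> P" "leB p q' \<and> FB a b q' = hB a b" "\<forall>y\<in>P. leB p y \<and> FB a b y = hB a b \<longrightarrow> leB q' y"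
    using B.ex_first_level[of x "\<lambda>x. leB p x \<and> FB a b x = hB a b"] x by blast
  have "FB a b y < hB a b" if "y \<in> P" "leB p y" "\<not> leB q' y" for y
    using q'(3) that B.psum_le_height[of y "sB a b"] by (auto simp: order_less_le)
  then show ?thesis using q' by blast
qed

lemma first_level_good:
  assumes p: "gA a b p" and q': "q' \<in> P" "leB p q'" "FB a b q' = hB a b"
    "\<And>y. \<lbrakk>y \<in> P; leB p y; \<not> leB q' y\<rbrakk> \<Longrightarrow> FB a b y < hB a b"
  shows "gB (a(p := False)) b q'"
proof (rule B.goodI[OF q'(1)])
  note pD = gA_D[OF p]
  show "1 \<le> FB (a(p := False)) b q'"
    using q' B.height_nonneg[of "sB a b"] unfolding upd_a(2)[OF p] by auto
  fix y assume y: "y \<in> P"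
  show "FB (a(p := False)) b y \<le> FB (a(p := False)) b q'"
    using B.psum_le_height[OF y, of "sB a b"] q' unfolding upd_a(2)[OF p] by auto
  assume "\<not> leB q' y"
  then show "FB (a(p := False)) b y < FB (a(p := False)) b q'"
    using B.psum_le_height[OF y, of "sB a b"] q'(2,3) q'(4)[OF y] unfolding upd_a(2)[OF p] by auto
qed

text \<open>From \<open>q'\<close> on the net change is -1, between \<open>p\<close> and
  \<open>q'\<close> it is +1 but the old values were below the maximum, and before \<open>p\<close>
  nothing changes. So the old maximum is again the maximum, first reached at
  \<open>q\<close>.\<close>

lemma second_good:
  assumes p: "gA a b p" and q: "gB a b q" and nqp: "\<not> leB p q" and g1: "gB (a(p := False)) b q'"
   and q': "q' \<in> P" "leB p q'" "FB a b q' = hB a b"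
    "\<And>y. \<lbrakk>y \<in> P; leB p y; \<not> leB q' y\<rbrakk> \<Longrightarrow> FB a b y < hB a b"
  shows "gB (a(p := False)) (b(q' := False)) q" "hB (a(p := False)) (b(q' := False)) = hB a b"
proof -
  note pD = gA_D[OF p] and qD = gB_D[OF q] and q'D = gB_D[OF g1]
  note U = upd_b(1)[OF g1] upd_a(2)[OF p]
  have hq: "FB a b q = hB a b" using q B.good_height by auto
  have qp: "leB q p" using nqp B.total pD qD by blast
  have n: "\<not> leB q' q" using q'(2) nqp B.trans[of p q' q] q' pD qD by auto
  show g: "gB (a(p := False)) (b(q' := False)) q"
  proof (rule B.goodI[OF qD(1)])
    show "1 \<le> FB (a(p := False)) (b(q' := False)) q" unfolding U using n nqp q by (auto simp: good_def)
    fix y assume y: "y \<in> P"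
    have "leB q' y \<Longrightarrow> leB p y" using B.trans[of p q' y] q' pD y by auto
    then show "FB (a(p := False)) (b(q' := False)) y \<le> FB (a(p := False)) (b(q' := False)) q"
      unfolding U using n nqp hq q'(4)[OF y] B.psum_le_height[OF y, of "sB a b"] by auto
    assume nq: "\<not> leB q y"
    have "\<not> leB p y" using nq qp B.trans[of q p y] qD pD y by auto
    then show "FB (a(p := False)) (b(q' := False)) y < FB (a(p := False)) (b(q' := False)) q"
      unfolding U using n nqp hq B.good_before[OF q y nq] by auto
  qed
  show "hB (a(p := False)) (b(q' := False)) = hB a b"
    using B.good_height[OF g] hq n nqp unfolding U by auto
qed

section \<open>Octagons\<close>

definition ordered_octagon :: "('s \<Rightarrow> bool) \<Rightarrow> ('s \<Rightarrow> bool) \<Rightarrow> 's \<Rightarrow> 's \<Rightarrow> 's \<Rightarrow> 's \<Rightarrow> bool" where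
  "ordered_octagon a b p q q' x \<longleftrightarrow>
     gB (a(p := False)) b q' \<and> gB (a(p := False)) (b(q' := False)) q \<and>
     gA (a(p := False)) (b(q' := False, q := False)) x \<and>
     gA a (b(q := False)) p \<and> gA (a(p := False)) (b(q := False)) x \<and>
     gB (a(p := False, x := False)) (b(q := False)) q' \<and>
     hB (a(p := False, x := False)) (b(q := False)) = hB a b \<and>
     hA (a(p := False)) (b(q' := False, q := False)) = hA a b"

text \<open>Both orders put \<open>q\<close> before \<open>p\<close>; the two paths clear p, q', q,
  x and q, p, x, q'. Here \<open>q'\<close> is the first place from \<open>p\<close> on where
  \<open>FB\<close> has its old maximum, and \<open>x\<close> the first place from \<open>q\<close>
  on where \<open>FA\<close> is one below its maximum. The substance is that \<open>x\<close>
  precedes \<open>q'\<close> in the second order.\<close>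

lemma octagon_ordered:
  assumes allowed: "allowed a b" and p: "gA a b p" and q: "gB a b q"
    and hB: "hB (a(p := False)) b = hB a b + 1"
    and npqA: "\<not> leA p q" and npqB: "\<not> leB p q"
  shows "\<exists>q' x. ordered_octagon a b p q q' x"
proof -
  note pD = gA_D[OF p] and qD = gB_D[OF q]
  have pq: "p \<noteq> q" using pD qD by auto
  have qpA: "leA q p" and qpB: "leB q p" using npqA npqB A.total B.total pD qD by blast+
  have hq: "FB a b q = hB a b" and hp: "FA a b p = hA a b" using q p B.good_height A.good_height by auto
  have hA1: "1 \<le> hA a b" and hB1: "1 \<le> hB a b" using A.good_pos[OF p] B.good_pos[OF q] by auto
  obtain q' where q': "q' \<in> P" "leB p q'" "FB a b q' = hB a b"
    and q'4': "\<forall>y\<in>P. leB p y \<and> \<not> leB q' y \<longrightarrow> FB a b y < hB a b"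
    using first_level[OF p hB] by blast
  have q'4: "FB a b y < hB a b" if "y \<in> P" "leB p y" "\<not> leB q' y" for y using q'4' that by blast
  have g1: "gB (a(p := False)) b q'" using first_level_good[OF p q' q'4] .
  note q'D = gB_D[OF g1]
  have g2: "gB (a(p := False)) (b(q' := False)) q" using second_good[OF p q npqB g1 q' q'4] by simp
  note q2D = gB_D[OF g2]
  have allowed4: "allowed (a(p := False)) (b(q' := False, q := False))"
    using closB[OF closB[OF closA[OF allowed p] g1] g2] .
  have q'q: "\<not> leB q' q" using B.trans[of p q' q] q' npqB pD qD by auto
  have q'p: "b q' \<and> a q' = w q'" if "q' \<noteq> p" using q'D that by auto
  have pq'A: "leA p q'"
  proof (rule ccontr)
    assume n: "\<not> leA p q'"
    then have "leA q' p" "q' \<noteq> p" using A.total A.refl pD q' by blast+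
    from inconsistent[OF q'(1) pD(1) this(1) q'(2) this(2)]
    show False using forb[OF allowed q'(1) pD(1)] q'p[OF \<open>q' \<noteq> p\<close>] pD by auto
  qed
  have beforep: "FA a b y \<le> hA a b - 1" if "y \<in> P" "\<not> leA p y" for y
    using A.good_before[OF p that] by simp
  \<comment> \<open>The witness is the immediate predecessor of \<open>p\<close>: its level is one
    below the maximum, and it cannot precede \<open>q\<close> since \<open>q\<close> lies before
    \<open>p\<close>.\<close>
  have "\<exists>m\<in>P. leA q m \<and> \<not> leA p m \<and> FA a b m = hA a b - 1"
    using A.pred_cases[OF pD(1), of "sgA P w a b"]
  proof
    assume "FA a b p = sgA P w a b p \<and> (\<forall>y\<in>P. leA y p \<longrightarrow> y = p)"
    then show ?thesis using pq qD qpA by auto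
  next
    assume "\<exists>m\<in>P. leA m p \<and> m \<noteq> p \<and> FA a b p = FA a b m + sgA P w a b p \<and>
        (\<forall>y\<in>P. leA y p \<and> y \<noteq> p \<longrightarrow> leA y m)"
    then obtain m where m: "m \<in> P" "leA m p" "m \<noteq> p" "FA a b p = FA a b m + sgA P w a b p"
      "\<And>y. \<lbrakk>y\<in>P; leA y p; y \<noteq> p\<rbrakk> \<Longrightarrow> leA y m" by blast
    moreover have "sgA P w a b p = 1" using pD by (simp add: sgA_def)
    moreover have "\<not> leA p m" using A.antisym[of p m] m(1,2,3) pD by blast
    moreover have "leA q m" using m(5)[of q] qD qpA pq by blast
    ultimately show ?thesis using hp by (intro bexI[of _ m]) auto
  qed
  then obtain m where m: "m \<in> P" "leA q m" "\<not> leA p m" "FA a b m = hA a b - 1" by blast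
  \<comment> \<open>Once \<open>a p\<close> and \<open>b q\<close> are cleared, places from
    \<open>q\<close> up to before \<open>p\<close> have gained 1 and those from \<open>p\<close> on
    have lost 1, so the new maximum is first reached at old level \<open>hA a b - 1\<close>.\<close>
  obtain x where x: "x \<in> P" "leA q x" "FA a b x = hA a b - 1"
     and xf: "\<And>y. \<lbrakk>y \<in> P; leA q y; FA a b y = hA a b - 1\<rbrakk> \<Longrightarrow> leA x y"
    using A.ex_first_level[of m "\<lambda>y. leA q y \<and> FA a b y = hA a b - 1"] m by blast
  have npx: "\<not> leA p x" using xf[of m] m A.trans[of p x m] pD x by blast
  have xp: "leA x p" "x \<noteq> p" using npx A.total A.refl pD x by blast+
  have beforex: "FA a b y \<le> hA a b - 2" if "y \<in> P" "leA q y" "\<not> leA x y" for y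
  proof -
    have "\<not> leA p y" using that xp A.trans[of x p y] pD x by blast
    then show ?thesis using beforep[OF that(1)] xf[OF that(1,2)] that(3) by fastforce
  qed
  have qy: "leA q y" if "y \<in> P" "leA p y" for y using A.trans[of q p y] qpA that pD qD by blast
  have qyB: "leB q y" if "y \<in> P" "leB p y" for y using B.trans[of q p y] qpB that pD qD by blast
  have pyA: "leA p y" if "y \<in> P" "leA q' y" for y using A.trans[of p q' y] pq'A that pD q' by blast
  have nq'x: "\<not> leA q' x" using npx pyA[OF x(1)] by blast
  have nxq: "leA q y" if "y \<in> P" "leA x y" for y using A.trans[of q x y] that x qD by blast
  note U4 = upd_b(2)[OF g2] upd_b(2)[OF g1] upd_a(1)[OF p]
  have v4: "FA (a(p := False)) (b(q' := False, q := False)) x = hA a b"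
    unfolding U4 using x npx nq'x by simp
  have g3: "gA (a(p := False)) (b(q' := False, q := False)) x"
  proof (rule A.goodI[OF x(1)])
    show "1 \<le> FA (a(p := False)) (b(q' := False, q := False)) x" using v4 hA1 by simp
    fix y assume y: "y \<in> P"
    show "FA (a(p := False)) (b(q' := False, q := False)) y \<le> FA (a(p := False)) (b(q' := False, q := False)) x"
      unfolding v4 unfolding U4 using beforep[OF y] pyA[OF y] A.psum_le_height[OF y, of "sgA P w a b"] by auto
    assume nxy: "\<not> leA x y"
    then have "\<not> leA p y" using xp A.trans[of x p y] pD x y by blast
    then show "FA (a(p := False)) (b(q' := False, q := False)) y < FA (a(p := False)) (b(q' := False, q := False)) x"
      unfolding v4 unfolding U4 using beforep[OF y] beforex[OF y _ nxy] pyA[OF y] by auto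
  qed
  have h3: "hA (a(p := False)) (b(q' := False, q := False)) = hA a b" using A.good_height[OF g3] v4 by simp
  note xD4 = gA_D[OF g3]
  have allowed7: "allowed (a(p := False, x := False)) (b(q' := False, q := False))" using closA[OF allowed4 g3] .
  note U2 = upd_b(2)[OF q]
  have v2: "FA a (b(q := False)) p = hA a b + 1" unfolding U2 using hp qpA by simp
  have k1: "gA a (b(q := False)) p"
  proof (rule A.goodI[OF pD(1)])
    show "1 \<le> FA a (b(q := False)) p" using v2 hA1 by simp
    fix y assume y: "y \<in> P"
    show "FA a (b(q := False)) y \<le> FA a (b(q := False)) p" 
      unfolding v2 unfolding U2 using A.psum_le_height[OF y, of "sgA P w a b"] by auto
    assume "\<not> leA p y"
    then show "FA a (b(q := False)) y < FA a (b(q := False)) p" 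
      unfolding v2 unfolding U2 using beforep[OF y] by auto
  qed
  note p2D = gA_D[OF k1]
  note U5 = upd_a(1)[OF k1] upd_b(2)[OF q]
  have v5: "FA (a(p := False)) (b(q := False)) x = hA a b"
    unfolding U5 using x npx by simp
  have k2: "gA (a(p := False)) (b(q := False)) x"
  proof (rule A.goodI[OF x(1)])
    show "1 \<le> FA (a(p := False)) (b(q := False)) x" using v5 hA1 by simp
    fix y assume y: "y \<in> P"
    show "FA (a(p := False)) (b(q := False)) y \<le> FA (a(p := False)) (b(q := False)) x"
      unfolding v5 unfolding U5 using beforep[OF y] A.psum_le_height[OF y, of "sgA P w a b"] by auto
    assume nxy: "\<not> leA x y"
    then have "\<not> leA p y" using xp A.trans[of x p y] pD x y by blast
    then show "FA (a(p := False)) (b(q := False)) y < FA (a(p := False)) (b(q := False)) x"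
      unfolding v5 unfolding U5 using beforep[OF y] beforex[OF y _ nxy] by auto
  qed
  note x5D = gA_D[OF k2]
  have ax: "a x" "b x = (\<not> w x)" if "x \<noteq> q" using x5D xp that by auto
  have qxB: "leB q x"
  proof (rule ccontr)
    assume n: "\<not> leB q x"
    then have "leB x q" "x \<noteq> q" using B.total B.refl x qD by blast+
    from inconsistent[OF qD(1) x(1) x(2) this(1)] this(2)
    show False using forb[OF allowed qD(1) x(1)] qD ax by auto
  qed
  \<comment> \<open>Otherwise the second order runs p, q', x while the first puts \<open>x\<close>
    before \<open>p\<close>. This inconsistency makes the shifted defect of (p, x) equal to 1, so
    those of (p, q') and (q', x) are both 1. According to \<open>w q'\<close>, the pair (q', p) is
    then forbidden at the start or (x, q') at the end.\<close>
  have xq'B: "leB x q'"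
  proof (rule ccontr)
    assume n: "\<not> leB x q'"
    then have q'x: "leB q' x" "x \<noteq> q'" using B.total B.refl x q' by blast+
    have px: "leB p x" using B.trans[of p q' x] q' q'x pD x by blast
    note i = inconsistent[OF x(1) pD(1) xp(1) px xp(2)]
    have q'np: "q' \<noteq> p" using q'D(2) pD i by auto
    have D1: "shifted D w x p = 0" using i by (simp add: shifted_def)
    note BD = defect_order.D_sym[OF defect_order_shifted[of w]]
    have D1: "shifted D w p x = 1" using BD[of p x] xp x pD D1 by auto
    have "shifted D w q' x \<ge> 1" using n BD[of q' x] q'x x q' by auto
    moreover have "\<not> leB q' p" using q'(1,2) q'np pD B.antisym[of q' p] by blast
    then have "shifted D w p q' \<ge> 1" by simp
    moreover have "shifted D w p q' + shifted D w q' x \<le> shifted D w p x + 1"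
      using defect_order.D_tri'[OF defect_order_shifted[of w]] x q' pD by blast
    ultimately have E: "shifted D w p q' = 1" "shifted D w q' x = 1" using D1 by auto
    show False
    proof (cases "w q'")
      case False
      have "D q' p = 1" using E(1) False i D_sym[of p q'] q'np pD q' by (auto simp: shifted_def)
      then show False using forb[OF allowed q'(1) pD(1)] False q'p[OF q'np] pD i by auto
    next
      case True
      have "D x q' = 1" using E(2) True i D_sym[of x q'] q'x(2) x q' by (auto simp: shifted_def)
      moreover have "x \<noteq> q" using xD4(3) i(1) by auto
      moreover have "\<not> (b(q' := False, q := False)) q'" by simp
      ultimately show False using forb[OF allowed7 x(1) q'(1)] True q'p[OF q'np] i q'np q'x(2) xD4 by auto
    qed
  qed
  note U6 = upd_a(2)[OF k2] upd_a(2)[OF k1] upd_b(1)[OF q]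
  have v6: "FB (a(p := False, x := False)) (b(q := False)) q' = hB a b"
    unfolding U6 using q' xq'B qyB[OF q'(1,2)] by simp
  have k3: "gB (a(p := False, x := False)) (b(q := False)) q'"
  proof (rule B.goodI[OF q'(1)])
    show "1 \<le> FB (a(p := False, x := False)) (b(q := False)) q'" using v6 hB1 by simp
    fix y assume y: "y \<in> P"
    have xy: "leB q y" if "leB x y" using B.trans[of q x y] that x y qxB qD by blast
    show "FB (a(p := False, x := False)) (b(q := False)) y \<le> FB (a(p := False, x := False)) (b(q := False)) q'"
      unfolding v6 unfolding U6 using B.psum_le_height[OF y, of "sB a b"] xy qyB[OF y] by auto
    assume "\<not> leB q' y"
    then show "FB (a(p := False, x := False)) (b(q := False)) y < FB (a(p := False, x := False)) (b(q := False)) q'"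
      unfolding v6 unfolding U6 
      using B.psum_le_height[OF y, of "sB a b"] xy qyB[OF y] q'4[OF y] B.good_before[OF q y] by auto
  qed
  have "hB (a(p := False, x := False)) (b(q := False)) = hB a b" using B.good_height[OF k3] v6 by simp
  then show ?thesis unfolding ordered_octagon_def using g1 g2 g3 k1 k2 k3 h3 by blast
qed

lemma upd_commute: "a(x := False, y := False) = a(y := False, x := False)"
  by (auto simp: fun_eq_iff)

lemma octagon:
  assumes allowed: "allowed a b" and p: "gA a b p" and q: "gB a b q"
    and hB: "hB (a(p := False)) b = hB a b + 1" and hA: "hA a (b(q := False)) = hA a b + 1"
  shows "\<exists>q1 q2 p2 p1 p3 q3.
     gB (a(p := False)) b q1 \<and> gB (a(p := False)) (b(q1 := False)) q2 \<and>
     gA (a(p := False)) (b(q1 := False, q2 := False)) p2 \<and>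
     gA a (b(q := False)) p1 \<and> gA (a(p1 := False)) (b(q := False)) p3 \<and>
     gB (a(p1 := False, p3 := False)) (b(q := False)) q3 \<and>
     a(p := False, p2 := False) = a(p1 := False, p3 := False) \<and>
     b(q1 := False, q2 := False) = b(q := False, q3 := False) \<and>
     hB (a(p1 := False, p3 := False)) (b(q := False)) = hB a b \<and>
     hA (a(p := False)) (b(q1 := False, q2 := False)) = hA a b"
proof -
  note pD = gA_D[OF p] and qD = gB_D[OF q]
  have pq: "p \<noteq> q" using pD qD by auto
  have tot: "\<not> leA p q \<and> leA q p \<or> leA p q \<and> \<not> leA q p" "\<not> leB p q \<and> leB q p \<or> leB p q \<and> \<not> leB q p"
    using A.total A.antisym B.total B.antisym pD qD pq by blast+
  interpret S: pair_model P "shifted D w" "\<lambda>x. \<not> w x" "\<lambda>a b. allowed b a" by (rule swap)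
  note S = shifted_shifted not_not
  have qS: "S.gA b a q" and pS: "S.gB b a p" and hS: "S.hB (b(q := False)) a = S.hB b a + 1"
    using p q hA unfolding S by auto
  consider (I) "\<not> leA p q" "\<not> leB p q" | (II) "\<not> leA q p" "\<not> leB q p"
    | (III) "leA p q" "\<not> leA q p" "leB q p" "\<not> leB p q" | (IV) "leA q p" "leB p q" using tot by blast
  then show ?thesis
  proof cases
    case I
    obtain q' x where H: "ordered_octagon a b p q q' x" using octagon_ordered[OF allowed p q hB I] by blast
    note H = H[unfolded ordered_octagon_def]
    show ?thesis
      by (rule exI[of _ q'], rule exI[of _ q], rule exI[of _ x], rule exI[of _ p], rule exI[of _ x], rule exI[of _ q'], intro conjI)
         (use H in blast | rule refl | rule upd_commute)+
  next
    case II
    obtain q' x where H: "S.ordered_octagon b a q p q' x"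
      using S.octagon_ordered[OF allowed qS pS hS, unfolded S, OF II(2,1)] by blast
    note H = H[unfolded S.ordered_octagon_def S]
    show ?thesis
      by (rule exI[of _ q], rule exI[of _ x], rule exI[of _ q'], rule exI[of _ q'], rule exI[of _ p], rule exI[of _ x], intro conjI)
         (use H in blast | rule refl | rule upd_commute)+
  next
    \<comment> \<open>The orders disagree on \<open>p\<close> and \<open>q\<close>. If
      \<open>q'\<close> differed from \<open>p\<close>, clearing \<open>p\<close>,
      \<open>q'\<close>, \<open>q\<close> would make (p, q) a forbidden pair; hence
      \<open>q' = p\<close>, likewise \<open>p' = q\<close>, and the octagon lives on these two
      sites.\<close>
    case III
    note i = inconsistent[OF pD(1) qD(1) III(1,3) pq]
    obtain q' where q': "q' \<in> P" "leB p q'" "FB a b q' = hB a b"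
      and q'4': "\<forall>y\<in>P. leB p y \<and> \<not> leB q' y \<longrightarrow> FB a b y < hB a b"
      using first_level[OF p hB] by blast
    have q'4: "FB a b y < hB a b" if "y \<in> P" "leB p y" "\<not> leB q' y" for y using q'4' that by blast
    have g1: "gB (a(p := False)) b q'" using first_level_good[OF p q' q'4] .
    have g2: "gB (a(p := False)) (b(q' := False)) q" using second_good[OF p q III(4) g1 q' q'4] by simp
    have allowed4: "allowed (a(p := False)) (b(q' := False, q := False))"
      using closB[OF closB[OF closA[OF allowed p] g1] g2] .
    have q'p: "q' = p"
    proof (rule ccontr)
      assume "q' \<noteq> p"
      then show False using forb[OF allowed4 pD(1) qD(1)] i pD qD pq by simp
    qed
    obtain p' where p': "p' \<in> P" "leA q p'" "FA a b p' = hA a b"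
      and p'4': "\<forall>y\<in>P. leA q y \<and> \<not> leA p' y \<longrightarrow> FA a b y < hA a b"
      using S.first_level[OF qS hS, unfolded S] by blast
    have p'4: "FA a b y < hA a b" if "y \<in> P" "leA q y" "\<not> leA p' y" for y using p'4' that by blast
    have k1: "gA a (b(q := False)) p'" using S.first_level_good[OF qS, unfolded S, OF p' p'4] .
    have k2: "gA (a(p' := False)) (b(q := False)) p" 
      using S.second_good[OF qS pS, unfolded S, OF III(2) k1 p' p'4] by simp
    have allowed4': "allowed (a(p' := False, p := False)) (b(q := False))"
      using closA[OF closA[OF closB[OF allowed q] k1] k2] .
    have p'q: "p' = q"
    proof (rule ccontr)
      assume "p' \<noteq> q"
      then show False using forb[OF allowed4' pD(1) qD(1)] i pD qD pq by simp
    qed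
    note g1 = g1[unfolded q'p] and g2 = g2[unfolded q'p] and k1 = k1[unfolded p'q] and k2 = k2[unfolded p'q]
    note q' = q'[unfolded q'p] and p' = p'[unfolded p'q]
    note q'4 = q'4[unfolded q'p] and p'4 = p'4[unfolded p'q]
    have hA1: "1 \<le> hA a b" and hB1: "1 \<le> hB a b" using A.good_pos[OF p] B.good_pos[OF q] by auto
    note U3 = upd_b(2)[OF g2] upd_b(2)[OF g1] upd_a(1)[OF p]
    have v3: "FA (a(p := False)) (b(p := False, q := False)) q = hA a b"
      unfolding U3 using p' III A.refl[OF qD(1)] by simp
    have g3: "gA (a(p := False)) (b(p := False, q := False)) q"
    proof (rule A.goodI[OF qD(1)])
      fix y assume y: "y \<in> P"
      have qp: "leA q y \<Longrightarrow> leA p y" using A.trans[of p q y] III pD qD y by blast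
      show "FA (a(p := False)) (b(p := False, q := False)) y \<le> FA (a(p := False)) (b(p := False, q := False)) q"
        unfolding v3 unfolding U3 using A.psum_le_height[OF y, of "sgA P w a b"] qp by auto
      assume "\<not> leA q y"
      then show "FA (a(p := False)) (b(p := False, q := False)) y < FA (a(p := False)) (b(p := False, q := False)) q"
        unfolding v3 unfolding U3 using A.psum_le_height[OF y, of "sgA P w a b"] A.good_before[OF p y] by auto
    qed (use v3 hA1 in simp)
    note U3' = upd_a(2)[OF k2] upd_a(2)[OF k1] upd_b(1)[OF q]
    have v3': "FB (a(q := False, p := False)) (b(q := False)) p = hB a b"
      unfolding U3' using q' III B.refl[OF pD(1)] by simp
    have k3: "gB (a(q := False, p := False)) (b(q := False)) p"
    proof (rule B.goodI[OF pD(1)])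
      fix y assume y: "y \<in> P"
      have qp: "leB p y \<Longrightarrow> leB q y" using B.trans[of q p y] III pD qD y by blast
      show "FB (a(q := False, p := False)) (b(q := False)) y \<le> FB (a(q := False, p := False)) (b(q := False)) p"
        unfolding v3' unfolding U3' using B.psum_le_height[OF y, of "sB a b"] qp by auto
      assume "\<not> leB p y"
      then show "FB (a(q := False, p := False)) (b(q := False)) y < FB (a(q := False, p := False)) (b(q := False)) p"
        unfolding v3' unfolding U3' using B.psum_le_height[OF y, of "sB a b"] B.good_before[OF q y] by auto
    qed (use v3' hB1 in simp)
    have h: "hA (a(p := False)) (b(p := False, q := False)) = hA a b" "hB (a(q := False, p := False)) (b(q := False)) = hB a b"
      using A.good_height[OF g3] B.good_height[OF k3] v3 v3' by auto
    show ?thesis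
      by (rule exI[of _ p], rule exI[of _ q], rule exI[of _ q], rule exI[of _ q], rule exI[of _ p], rule exI[of _ p], intro conjI)
         (fact g1 g2 g3 k1 k2 k3 h | rule upd_commute)+
  next
    \<comment> \<open>With the opposite disagreement, (q, p) is already forbidden in the initial
      state.\<close>
    case IV
    from inconsistent[OF qD(1) pD(1) this pq[symmetric]]
    show ?thesis using forb[OF allowed qD(1) pD(1)] pD qD by auto
  qed
qed

end

section \<open>Uniqueness of crystals with local axioms\<close>

text \<open>\<open>down\<close>, \<open>up_square\<close> and \<open>up_octagon\<close> are
  Stembridge's local axioms, stated so that the condition produced by \<open>down\<close> only
  involves elements of smaller rank and can therefore be transported along a partial
  isomorphism.\<close>

locale local_crystal =
  fixes V :: "'v set" and rk :: "'v \<Rightarrow> nat" and arr :: "nat \<Rightarrow> 'v \<Rightarrow> 'v \<Rightarrow> bool"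
    and ep ph :: "nat \<Rightarrow> 'v \<Rightarrow> int" and root :: 'v
    and adj :: "nat \<Rightarrow> nat \<Rightarrow> bool" and cart :: "nat \<Rightarrow> nat \<Rightarrow> int" and wt0 :: "nat \<Rightarrow> int"
  assumes arr_V: "arr i x y \<Longrightarrow> x \<in> V \<and> y \<in> V \<and> rk y = Suc (rk x)"
    and det_f: "\<lbrakk>arr i x y; arr i x z\<rbrakk> \<Longrightarrow> y = z"
    and det_b: "\<lbrakk>arr i y x; arr i z x\<rbrakk> \<Longrightarrow> y = z"
    and ep_nonneg: "x \<in> V \<Longrightarrow> 0 \<le> ep i x"
    and ep_pos: "\<lbrakk>x \<in> V; 0 < ep i x\<rbrakk> \<Longrightarrow> \<exists>y. arr i y x"
    and ph_pos: "\<lbrakk>x \<in> V; 0 < ph i x\<rbrakk> \<Longrightarrow> \<exists>y. arr i x y"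
    and arr_ep: "arr i x y \<Longrightarrow> ep i y = ep i x + 1"
    and arr_ph: "arr i x y \<Longrightarrow> 0 < ph i x"
    and wt: "arr k x y \<Longrightarrow> ph i y - ep i y = ph i x - ep i x - cart i k"
    and root: "root \<in> V" "rk root = 0" "ph i root - ep i root = wt0 i"
    and ex_arr: "\<lbrakk>x \<in> V; x \<noteq> root\<rbrakk> \<Longrightarrow> \<exists>i y. arr i y x"
    and down: "\<lbrakk>arr i y z; arr k v z; i \<noteq> k\<rbrakk> \<Longrightarrow>
       (\<exists>u. arr k u y \<and> arr i u v \<and> (\<not> adj i k \<or> ph i y = ph i u \<or> ph k v = ph k u)) \<or>
       (\<exists>y1 y2 u v1 v2. arr k y1 y \<and> arr k y2 y1 \<and> arr i u y2 \<and> arr i v1 v \<and> arr i v2 v1 \<and> arr k u v2 \<and>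
          ph k y2 = ph k u + 1 \<and> ph i v2 = ph i u + 1)"
    and up_square: "\<lbrakk>arr k u y; arr i u v; i \<noteq> k; \<not> adj i k \<or> ph i y = ph i u \<or> ph k v = ph k u\<rbrakk> \<Longrightarrow>
       \<exists>z. arr i y z \<and> arr k v z"
    and up_octagon: "\<lbrakk>arr i u y2; arr k u v2; i \<noteq> k; ph k y2 = ph k u + 1; ph i v2 = ph i u + 1\<rbrakk> \<Longrightarrow>
       \<exists>y1 y z v v1. arr k y2 y1 \<and> arr k y1 y \<and> arr i y z \<and> arr i v2 v1 \<and> arr i v1 v \<and> arr k v z"

text \<open>The graph of the intended isomorphism, before it is known to be a function: pairs
  reached from the two roots by the same word of arrows.\<close>

inductive linked :: "(nat \<Rightarrow> 'v \<Rightarrow> 'v \<Rightarrow> bool) \<Rightarrow> (nat \<Rightarrow> 'u \<Rightarrow> 'u \<Rightarrow> bool) \<Rightarrow> 'v \<Rightarrow> 'u \<Rightarrow> 'v \<Rightarrow> 'u \<Rightarrow> bool"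
  for arr arr' r r' where
    root: "linked arr arr' r r' r r'"
  | step: "\<lbrakk>linked arr arr' r r' x x'; arr i x y; arr' i x' y'\<rbrakk> \<Longrightarrow> linked arr arr' r r' y y'"

lemma linked_converse: "linked arr arr' r r' x x' \<Longrightarrow> linked arr' arr r' r x' x"
  by (induction rule: linked.induct) (auto intro: linked.intros)

locale crystal_pair =
  X: local_crystal V rk arr ep ph rt adj cart wt0 + Y: local_crystal V' rk' arr' ep' ph' rt' adj cart wt0
  for V :: "'v set" and rk arr ep ph rt V' and rk' :: "'u \<Rightarrow> nat" and arr' ep' ph' rt' adj cart wt0
begin

abbreviation "R \<equiv> linked arr arr' rt rt'"

lemma swap_pair: "crystal_pair V' rk' arr' ep' ph' rt' V rk arr ep ph rt adj cart wt0"
  by unfold_locales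

lemma R_swap: "linked arr' arr rt' rt x y \<longleftrightarrow> R y x"
  using linked_converse[of arr' arr rt' rt x y] linked_converse[of arr arr' rt rt' y x] by blast

lemma R_V: "R x x' \<Longrightarrow> x \<in> V \<and> x' \<in> V' \<and> rk x = rk' x' \<and> ph i x - ep i x = ph' i x' - ep' i x'"
proof (induction rule: linked.induct)
  case root then show ?case using X.root Y.root by auto
next
  case (step x x' k y y')
  then show ?case using X.arr_V[OF step(2)] Y.arr_V[OF step(3)] X.wt[OF step(2), of i] Y.wt[OF step(3), of i] by auto
qed

text \<open>The induction hypothesis of the uniqueness proof. Only \<open>ep\<close> is recorded,
  since \<open>ph - ep\<close> depends just on the word of arrows and hence agrees on linked
  vertices.\<close>

definition matched :: "nat \<Rightarrow> bool" where
  "matched N \<longleftrightarrow>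
     (\<forall>x x' i. R x x' \<and> rk x \<le> N \<longrightarrow> ep i x = ep' i x') \<and>
     (\<forall>x x1 x2. R x x1 \<and> R x x2 \<and> rk x \<le> N \<longrightarrow> x1 = x2) \<and>
     (\<forall>x x1 x2. R x1 x \<and> R x2 x \<and> rk' x \<le> N \<longrightarrow> x1 = x2) \<and>
     (\<forall>x\<in>V. rk x \<le> N \<longrightarrow> (\<exists>x'. R x x')) \<and> (\<forall>x\<in>V'. rk' x \<le> N \<longrightarrow> (\<exists>x'. R x' x))"

lemma matched_swap: 
  assumes "matched N" shows "crystal_pair.matched V' rk' arr' ep' rt' V rk arr ep rt N"
  unfolding crystal_pair.matched_def[OF swap_pair] R_swap
proof (intro conjI)
  note H = assms[unfolded matched_def]
  show "\<forall>x x' i. R x' x \<and> rk' x \<le> N \<longrightarrow> ep' i x = ep i x'"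
  proof (intro allI impI)
    fix x x' i assume a: "R x' x \<and> rk' x \<le> N"
    then have "rk x' \<le> N" using R_V[of x' x] by auto
    then show "ep' i x = ep i x'" using conjunct1[OF H] a by auto
  qed
qed (insert assms[unfolded matched_def], elim conjE, assumption)+

context
  fixes N assumes M: "matched N"
begin

lemma M_ep: "\<lbrakk>R x x'; rk x \<le> N\<rbrakk> \<Longrightarrow> ep i x = ep' i x'"
  using M unfolding matched_def by blast

lemma M_ph: "\<lbrakk>R x x'; rk x \<le> N\<rbrakk> \<Longrightarrow> ph i x = ph' i x'"
  using M_ep[of x x' i] R_V[of x x' i] by auto

lemma M_fun: "\<lbrakk>R x x1; R x x2; rk x \<le> N\<rbrakk> \<Longrightarrow> x1 = x2"
  using M unfolding matched_def by blast

lemma M_inj: "\<lbrakk>R x1 x; R x2 x; rk' x \<le> N\<rbrakk> \<Longrightarrow> x1 = x2"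
  using M unfolding matched_def by blast

lemma M_ex: "\<lbrakk>x \<in> V; rk x \<le> N\<rbrakk> \<Longrightarrow> \<exists>x'. R x x'"
  using M unfolding matched_def by blast

lemma M_step: 
  assumes "R x x'" "arr i x y" "rk x \<le> N" shows "\<exists>y'. arr' i x' y' \<and> R y y'"
proof -
  have "0 < ph' i x'" using X.arr_ph[OF assms(2)] M_ph[OF assms(1,3)] by simp
  then obtain y' where "arr' i x' y'" using Y.ph_pos R_V[OF assms(1)] by blast
  then show ?thesis using assms linked.step[OF assms(1,2)] by blast
qed

lemma M_arr: 
  assumes "arr i x y" "R x x'" "R y y'" "rk y \<le> N" shows "arr' i x' y'"
proof -
  have "rk x \<le> N" using X.arr_V[OF assms(1)] assms(4) by simp
  then show ?thesis using M_step[OF assms(2,1)] M_fun[OF assms(3) _ assms(4)] by blast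
qed

text \<open>By \<open>down\<close>, \<open>y\<close> and \<open>v\<close> lie above a common
  \<open>u\<close> in a square or octagon of elements of rank at most \<open>N\<close>. These have
  partners with the same \<open>ph\<close>, so the upward axiom closes the figure in the second
  crystal, and determinism of arrows identifies its top with \<open>z'\<close>.\<close>

lemma confluence:
  assumes z: "arr i y z" "arr k v z" and R: "R y y'" "R v v'" and z': "arr' i y' z'" and r: "rk z = Suc N"
  shows "arr' k v' z'"
proof (cases "i = k")
  case True
  have "y = v" using X.det_b z True by auto
  moreover have "rk y \<le> N" using X.arr_V[OF z(1)] r by simp
  ultimately have "y' = v'" using M_fun R by blast
  then show ?thesis using z' True by simp
next
  case False
  have ry: "rk y = N" "rk v = N" using X.arr_V[OF z(1)] X.arr_V[OF z(2)] r by auto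
  consider u where "arr k u y" "arr i u v" "\<not> adj i k \<or> ph i y = ph i u \<or> ph k v = ph k u"
    | y1 y2 u v1 v2 where "arr k y1 y" "arr k y2 y1" "arr i u y2" "arr i v1 v" "arr i v2 v1" "arr k u v2"
          "ph k y2 = ph k u + 1" "ph i v2 = ph i u + 1"
    using X.down[OF z False] by metis
  then show ?thesis
  proof cases
    case 1
    have ru: "rk u \<le> N" "u \<in> V" using X.arr_V[OF 1(1)] ry by auto
    then obtain u' where u': "R u u'" using M_ex by blast
    have a: "arr' k u' y'" "arr' i u' v'" using M_arr[OF 1(1) u' R(1)] M_arr[OF 1(2) u' R(2)] ry by auto
    have "\<not> adj i k \<or> ph' i y' = ph' i u' \<or> ph' k v' = ph' k u'"
      using 1(3) M_ph[OF u' ru(1)] M_ph[OF R(1)] M_ph[OF R(2)] ry by auto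
    from Y.up_square[OF a False this] show ?thesis using z' Y.det_f by blast
  next
    case 2
    have "Suc (rk y1) = N" "Suc (rk y2) = rk y1" "Suc (rk v1) = N" "Suc (rk v2) = rk v1" "Suc (rk u) = rk y2"
      "u \<in> V" "y1 \<in> V" "y2 \<in> V" "v1 \<in> V" "v2 \<in> V"
      using 2(1-6)[THEN X.arr_V] ry by auto
    then have rk: "rk y1 \<le> N" "rk y2 \<le> N" "rk v1 \<le> N" "rk v2 \<le> N" "rk u \<le> N" "rk y \<le> N" "rk v \<le> N"
      and V: "u \<in> V" "y1 \<in> V" "y2 \<in> V" "v1 \<in> V" "v2 \<in> V" using ry by auto
    obtain y1' y2' v1' v2' u' where R': "R y1 y1'" "R y2 y2'" "R v1 v1'" "R v2 v2'" "R u u'"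
      using M_ex V rk by meson
    have a: "arr' k y1' y'" "arr' k y2' y1'" "arr' i u' y2'" "arr' i v1' v'" "arr' i v2' v1'" "arr' k u' v2'"
      using M_arr[OF 2(1) R'(1) R(1)] M_arr[OF 2(2) R'(2,1)] M_arr[OF 2(3) R'(5,2)]
        M_arr[OF 2(4) R'(3) R(2)] M_arr[OF 2(5) R'(4,3)] M_arr[OF 2(6) R'(5,4)] rk by auto
    have "ph' k y2' = ph' k u' + 1" "ph' i v2' = ph' i u' + 1"
      using 2(7,8) M_ph[OF R'(2) rk(2)] M_ph[OF R'(4) rk(4)] M_ph[OF R'(5) rk(5)] by auto
    from Y.up_octagon[OF a(3,6) False this] obtain s1 s t q q1 where
      s: "arr' k y2' s1" "arr' k s1 s" "arr' i s t" "arr' i v2' q1" "arr' i q1 q" "arr' k q t" by blast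
    have "s1 = y1'" "q1 = v1'" using s a Y.det_f by blast+
    then have "s = y'" "q = v'" using s a Y.det_f by blast+
    then have "t = z'" using s z' Y.det_f by blast
    then show ?thesis using s \<open>q = v'\<close> by simp
  qed
qed

lemma M_cases:
  assumes "R z z'" "rk z = Suc N"
  obtains i y y' where "R y y'" "arr i y z" "arr' i y' z'"
  using assms(1)
proof (cases rule: linked.cases)
  case root then show ?thesis using assms X.root by simp
next
  case (step x x' i) then show ?thesis using that by blast
qed

lemma next_fun: "\<lbrakk>R z z1; R z z2; rk z = Suc N\<rbrakk> \<Longrightarrow> z1 = z2"
proof -
  assume A: "R z z1" "R z z2" "rk z = Suc N"
  obtain i y y' where 1: "R y y'" "arr i y z" "arr' i y' z1" using M_cases[OF A(1,3)] .
  obtain k v v' where 2: "R v v'" "arr k v z" "arr' k v' z2" using M_cases[OF A(2,3)] .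
  have "arr' k v' z1" using confluence[OF 1(2) 2(2) 1(1) 2(1) 1(3) A(3)] .
  then show ?thesis using 2 Y.det_f by blast
qed

lemma next_ex: "\<lbrakk>z \<in> V; rk z = Suc N\<rbrakk> \<Longrightarrow> \<exists>z'. R z z'"
proof -
  assume A: "z \<in> V" "rk z = Suc N"
  then obtain i y where y: "arr i y z" using X.ex_arr X.root by fastforce
  then have "y \<in> V" "rk y \<le> N" using X.arr_V A by fastforce+
  then show ?thesis using M_ex M_step y by blast
qed

text \<open>Positivity provides the incoming arrow on which the argument rests; vanishing values are
  settled by using the lemma for the exchanged pair as well.\<close>

lemma next_ep: 
  assumes "R z z'" "rk z = Suc N" "0 < ep i z" shows "ep' i z' = ep i z"
proof -
  obtain k y y' where 1: "R y y'" "arr k y z" "arr' k y' z'" using M_cases[OF assms(1,2)] .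
  obtain v where v: "arr i v z" using X.ep_pos assms R_V by blast
  then have rv: "v \<in> V" "rk v \<le> N" using X.arr_V[OF v] assms(2) by auto
  then obtain v' where v': "R v v'" using M_ex by blast
  have "arr' i v' z'" using confluence[OF 1(2) v 1(1) v' 1(3) assms(2)] .
  then have "ep' i z' = ep' i v' + 1" by (rule Y.arr_ep)
  also have "ep' i v' = ep i v" using M_ep[OF v' rv(2)] by simp
  finally show ?thesis using X.arr_ep[OF v] by simp
qed

end

lemma matched_all: "matched N"
proof (induction N)
  case 0
  have X0: "x = rt" if "x \<in> V" "rk x = 0" for x
    using X.ex_arr[OF that(1)] that(2) X.arr_V by (metis nat.distinct(1))
  have Y0: "x = rt'" if "x \<in> V'" "rk' x = 0" for x
    using Y.ex_arr[OF that(1)] that(2) Y.arr_V by (metis nat.distinct(1))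
  have R0: "x = rt \<and> x' = rt'" if "R x x'" "rk x = 0 \<or> rk' x' = 0" for x x'
    using R_V[OF that(1)] that(2) X0 Y0 by auto
  have e: "ep i rt = 0" for i
    using X.ep_pos[OF X.root(1), of i] X.ep_nonneg[OF X.root(1), of i] X.arr_V X.root(2)
    by (metis nat.distinct(1) order_less_le)
  have e': "ep' i rt' = 0" for i
    using Y.ep_pos[OF Y.root(1), of i] Y.ep_nonneg[OF Y.root(1), of i] Y.arr_V Y.root(2)
    by (metis nat.distinct(1) order_less_le)
  have rr: "R rt rt'" by (rule linked.root)
  show ?case unfolding matched_def le_zero_eq
  proof (intro conjI)
    show "\<forall>x x' i. R x x' \<and> rk x = 0 \<longrightarrow> ep i x = ep' i x'" using R0 e e' by force
    show "\<forall>x x1 x2. R x x1 \<and> R x x2 \<and> rk x = 0 \<longrightarrow> x1 = x2" using R0 by blast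
    show "\<forall>x x1 x2. R x1 x \<and> R x2 x \<and> rk' x = 0 \<longrightarrow> x1 = x2" using R0 by blast
    show "\<forall>x\<in>V. rk x = 0 \<longrightarrow> (\<exists>x'. R x x')" using X0 rr by blast
    show "\<forall>x\<in>V'. rk' x = 0 \<longrightarrow> (\<exists>x'. R x' x)" using Y0 rr by blast
  qed
next
  case (Suc N)
  interpret S: crystal_pair V' rk' arr' ep' ph' rt' V rk arr ep ph rt adj cart wt0 by (rule swap_pair)
  note M' = matched_swap[OF Suc]
  have n1: "ep i x = ep' i x'" if "R x x'" "rk x = Suc N" for i x x'
  proof -
    have "rk' x' = Suc N" "x \<in> V" "x' \<in> V'" using R_V[OF that(1)] that by auto
    then show ?thesis using next_ep[OF Suc that, of i] S.next_ep[OF M', of x' x i] that(1) R_swap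
       X.ep_nonneg[of x i] Y.ep_nonneg[of x' i] by force
  qed
  have n2: "x1 = x2" if "R x1 x" "R x2 x" "rk' x = Suc N" for x x1 x2
    using S.next_fun[OF M', of x x1 x2] that R_swap by auto
  have n3: "\<exists>x'. R x' x" if "x \<in> V'" "rk' x = Suc N" for x
    using S.next_ex[OF M' that] R_swap by auto
  show ?case unfolding matched_def le_Suc_eq
  proof (intro conjI)
    show "\<forall>x x' i. R x x' \<and> (rk x \<le> N \<or> rk x = Suc N) \<longrightarrow> ep i x = ep' i x'" 
      using n1 M_ep[OF Suc] by auto
    show "\<forall>x x1 x2. R x x1 \<and> R x x2 \<and> (rk x \<le> N \<or> rk x = Suc N) \<longrightarrow> x1 = x2"
      using next_fun[OF Suc] M_fun[OF Suc] by metis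
    show "\<forall>x x1 x2. R x1 x \<and> R x2 x \<and> (rk' x \<le> N \<or> rk' x = Suc N) \<longrightarrow> x1 = x2"
      using n2 M_inj[OF Suc] by metis
    show "\<forall>x\<in>V. rk x \<le> N \<or> rk x = Suc N \<longrightarrow> (\<exists>x'. R x x')" using next_ex[OF Suc] M_ex[OF Suc] by auto
    show "\<forall>x\<in>V'. rk' x \<le> N \<or> rk' x = Suc N \<longrightarrow> (\<exists>x'. R x' x)" using n3 S.M_ex[OF M'] R_swap by auto
  qed
qed

theorem iso:
  "\<exists>\<phi>. bij_betw \<phi> V V' \<and> (\<forall>x\<in>V. rk' (\<phi> x) = rk x) \<and>
     (\<forall>x\<in>V. \<forall>y\<in>V. \<forall>i. arr i x y \<longleftrightarrow> arr' i (\<phi> x) (\<phi> y))"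
proof -
  interpret S: crystal_pair V' rk' arr' ep' ph' rt' V rk arr ep ph rt adj cart wt0 by (rule swap_pair)
  have f: "x1 = x2" if "R x x1" "R x x2" for x x1 x2 using M_fun[OF matched_all that order_refl] .
  have g: "x1 = x2" if "R x1 x" "R x2 x" for x x1 x2 using M_inj[OF matched_all that order_refl] .
  have ex: "\<exists>x'. R x x'" if "x \<in> V" for x using M_ex[OF matched_all that order_refl] .
  have ex': "\<exists>x'. R x' x" if "x \<in> V'" for x using S.M_ex[OF S.matched_all that order_refl] R_swap by auto
  define \<phi> where "\<phi> x = (THE x'. R x x')" for x
  have R: "R x (\<phi> x)" if "x \<in> V" for x
    unfolding \<phi>_def using ex[OF that] f by (metis theI)
  have "bij_betw \<phi> V V'"
  proof (rule bij_betw_imageI)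
    show "inj_on \<phi> V" by (rule inj_onI) (metis R g)
    show "\<phi> ` V = V'"
    proof
      show "\<phi> ` V \<subseteq> V'" using R R_V by blast
      show "V' \<subseteq> \<phi> ` V"
      proof
        fix x assume "x \<in> V'"
        then obtain u where u: "R u x" using ex' by blast
        then have "u \<in> V" using R_V by blast
        then have "x = \<phi> u" using f u R by blast
        then show "x \<in> \<phi> ` V" using \<open>u \<in> V\<close> by blast
      qed
    qed
  qed
  moreover have "rk' (\<phi> x) = rk x" if "x \<in> V" for x using R_V R that by metis
  moreover have "arr i x y \<longleftrightarrow> arr' i (\<phi> x) (\<phi> y)" if "x \<in> V" "y \<in> V" for i x y
    using M_arr[OF matched_all, of i x y "\<phi> x" "\<phi> y" "rk y"] S.M_arr[OF S.matched_all, of i "\<phi> x" "\<phi> y" x y "rk' (\<phi> y)"] 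
      R[OF that(1)] R[OF that(2)] R_swap by auto
  ultimately show ?thesis by blast
qed

end

section \<open>Profiles of partitions\<close>

definition content :: "node \<Rightarrow> int" where "content x = int (snd x) - int (fst x)"

text \<open>The profile is the diagonal length, shifted by \<open>max 0 y\<close> so that it counts
  the gaps below \<open>y\<close> in the abacus of the partition: the step from \<open>y\<close> to
  \<open>y + 1\<close> is flat at a bead and rises at a gap. Adding a node of content
  \<open>y\<close> raises the single value at \<open>y\<close>, and the column of an addable or
  removable node of content \<open>y\<close> is one more than the value at \<open>y -
  1\<close>.\<close>

definition prof :: "node set \<Rightarrow> int \<Rightarrow> int" where
  "prof Y y = max 0 y + int (card {x\<in>Y. content x = y})"

definition node_at :: "(int \<Rightarrow> int) \<Rightarrow> int \<Rightarrow> node" where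
  "node_at h y = (nat (h (y - 1) + 1 - y), nat (h (y - 1) + 1))"

definition incr :: "(int \<Rightarrow> int) \<Rightarrow> bool" where
  "incr h \<longleftrightarrow> (\<forall>y. h y \<le> h (y + 1) \<and> h (y + 1) \<le> h y + 1)"

lemma initial_nat_set:
  assumes "finite S" "\<And>k. k \<in> S \<Longrightarrow> 1 \<le> k \<and> (1 < k \<longrightarrow> k - 1 \<in> S)"
  shows "S = {1..card S}"
proof (cases "S = {}")
  case False
  let ?m = "Max S"
  have m: "?m \<in> S" using assms(1) False by simp
  have "k \<in> S" if "1 \<le> k" "k \<le> ?m" for k
    using that(2,1)
  proof (induction rule: inc_induct)
    case base show ?case using m .
  next
    case (step n) then show ?case using assms(2)[of "Suc n"] by auto
  qed
  moreover have "1 \<le> k \<and> k \<le> ?m" if "k \<in> S" for k using assms(2)[OF that] assms(1) that by auto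
  ultimately have "S = {1..?m}" unfolding atLeastAtMost_def atLeast_def atMost_def by blast
  then have "card S = ?m" by (metis card_atLeastAtMost diff_Suc_1)
  then show ?thesis using \<open>S = {1..?m}\<close> by simp
qed auto

lemma young_down:
  assumes "young Y" "(r, c) \<in> Y" "1 \<le> r'" "r' \<le> r" "1 \<le> c'" "c' \<le> c"
  shows "(r', c') \<in> Y"
proof -
  have Y: "(r > 1 \<longrightarrow> (r - 1, c) \<in> Y) \<and> (c > 1 \<longrightarrow> (r, c - 1) \<in> Y)" if "(r, c) \<in> Y" for r c
    using assms(1) that unfolding young_def by fast
  have "(r', c) \<in> Y" using assms(4,3)
  proof (induction rule: inc_induct)
    case (step n) then show ?case using Y[of "Suc n" c] by auto
  qed (rule assms)
  show ?thesis using assms(6,5)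
  proof (induction rule: inc_induct)
    case base show ?case using \<open>(r', c) \<in> Y\<close> .
  next
    case (step n) then show ?case using Y[of r' "Suc n"] by auto
  qed
qed

lemma young_pos: "\<lbrakk>young Y; (r, c) \<in> Y\<rbrakk> \<Longrightarrow> 1 \<le> r \<and> 1 \<le> c"
  unfolding young_def by fast

lemma young_fin: "young Y \<Longrightarrow> finite Y"
  unfolding young_def by simp

text \<open>A diagonal meets the diagram in an initial segment of its nodes, indexed by
  \<open>min r c\<close>. The column is this index plus the positive part of the content, which
  explains the summand \<open>max 0 y\<close> of \<open>prof\<close>.\<close>

lemma mem_prof:
  assumes Y: "young Y" and rc: "1 \<le> r" "1 \<le> c"
  shows "(r, c) \<in> Y \<longleftrightarrow> int c \<le> prof Y (int c - int r)"
proof -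
  define y where "y = int c - int r"
  define n where "n k = (k + nat (- y), k + nat y)" for k :: nat
  let ?S = "{k. 1 \<le> k \<and> n k \<in> Y}"
  have inj: "inj n" unfolding n_def by (rule injI) simp
  have img: "n ` ?S = {x\<in>Y. content x = y}"
  proof
    show "n ` ?S \<subseteq> {x\<in>Y. content x = y}" unfolding n_def content_def by auto
    show "{x\<in>Y. content x = y} \<subseteq> n ` ?S"
    proof
      fix x assume x: "x \<in> {x\<in>Y. content x = y}"
      have "x = n (min (fst x) (snd x))" using x unfolding n_def content_def by (auto simp: prod_eq_iff)
      moreover have "1 \<le> min (fst x) (snd x)" using x young_pos[OF Y, of "fst x" "snd x"] by auto
      ultimately show "x \<in> n ` ?S" using x by (intro image_eqI[of _ _ "min (fst x) (snd x)"]) auto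
    qed
  qed
  have "finite (n ` ?S)" unfolding img using young_fin[OF Y] by simp
  then have fin: "finite ?S" using inj by (meson finite_imageD inj_on_subset subset_UNIV)
  have "?S = {1..card ?S}"
  proof (rule initial_nat_set[OF fin])
    fix k assume k: "k \<in> ?S"
    show "1 \<le> k \<and> (1 < k \<longrightarrow> k - 1 \<in> ?S)"
      using k young_down[OF Y, of "k + nat (- y)" "k + nat y" "k - 1 + nat (- y)" "k - 1 + nat y"] unfolding n_def by auto
  qed
  moreover have "card ?S = card {x\<in>Y. content x = y}"
    using card_image[OF inj_on_subset[OF inj], of ?S] img by simp
  ultimately have S: "?S = {1..card {x\<in>Y. content x = y}}" by simp
  have "(r, c) = n (min r c)" unfolding n_def y_def by auto
  then have "(r, c) \<in> Y \<longleftrightarrow> min r c \<in> ?S" using rc by auto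
  also have "\<dots> \<longleftrightarrow> min r c \<le> card {x\<in>Y. content x = y}" unfolding S using rc by auto
  also have "\<dots> \<longleftrightarrow> int c \<le> prof Y y" unfolding prof_def y_def by auto
  finally show ?thesis unfolding y_def .
qed

lemma mem_prof':
  assumes "young Y" "int c - int r = y" "1 \<le> r" "1 \<le> c"
  shows "(r, c) \<in> Y \<longleftrightarrow> int c \<le> prof Y y"
  using mem_prof[OF assms(1,3,4)] assms(2) by simp

lemma prof_ge: "max 0 y \<le> prof Y y" unfolding prof_def by simp

lemma prof_mem:
  assumes Y: "young Y" and c: "max 0 y < c" "c \<le> prof Y y"
  shows "(nat (c - y), nat c) \<in> Y"
  using mem_prof[OF Y, of "nat (c - y)" "nat c"] c by auto

lemma prof_incr:
  assumes Y: "young Y" shows "incr (prof Y)"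
  unfolding incr_def
proof (intro allI conjI)
  fix y
  show "prof Y y \<le> prof Y (y + 1)"
  proof (cases "max 0 y < prof Y y \<and> y + 1 < prof Y y")
    case True
    define c where "c = prof Y y"
    have m: "(nat (c - y), nat c) \<in> Y" using prof_mem[OF Y, of y c] True c_def by auto
    have "(nat (c - y) - 1, nat c) \<in> Y" using young_down[OF Y m] True c_def by auto
    moreover have "int (nat c) - int (nat (c - y) - 1) = y + 1" using True c_def by auto
    ultimately have "int (nat c) \<le> prof Y (y + 1)"
      using mem_prof[OF Y, of "nat (c - y) - 1" "nat c"] True c_def by auto
    then show ?thesis using c_def True by simp
  next
    case False
    then show ?thesis using prof_ge[of y Y] prof_ge[of "y + 1" Y] by auto
  qed
  show "prof Y (y + 1) \<le> prof Y y + 1"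
  proof (cases "max 0 (y + 1) < prof Y (y + 1) \<and> 1 < prof Y (y + 1)")
    case True
    define c where "c = prof Y (y + 1)"
    have m: "(nat (c - (y + 1)), nat c) \<in> Y" using prof_mem[OF Y, of "y + 1" c] True c_def by auto
    have "(nat (c - (y + 1)), nat c - 1) \<in> Y" using young_down[OF Y m] True c_def by auto
    moreover have "int (nat c - 1) - int (nat (c - (y + 1))) = y" using True c_def by auto
    ultimately have "int (nat c - 1) \<le> prof Y y"
      using mem_prof[OF Y, of "nat (c - (y + 1))" "nat c - 1"] True c_def by auto
    then show ?thesis using c_def True by simp
  next
    case False
    then show ?thesis using prof_ge[of y Y] prof_ge[of "y + 1" Y] by auto
  qed
qed

lemma prof_inj:
  assumes "young Y" "young Z" "prof Y = prof Z" shows "Y = Z"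
proof -
  have "(r, c) \<in> Y \<longleftrightarrow> (r, c) \<in> Z" for r c
  proof (cases "1 \<le> r \<and> 1 \<le> c")
    case True
    then show ?thesis unfolding mem_prof[OF assms(1) conjunct1[OF True] conjunct2[OF True]]
       mem_prof[OF assms(2) conjunct1[OF True] conjunct2[OF True]] assms(3) by simp
  next
    case False
    then show ?thesis using young_pos assms by blast
  qed
  then show ?thesis by (intro set_eqI) (metis surj_pair)
qed

lemma prof_far:
  assumes "young Y" shows "\<exists>n\<ge>0. \<forall>y. n \<le> \<bar>y\<bar> \<longrightarrow> prof Y y = max 0 y"
proof -
  have f: "finite ((\<lambda>x. \<bar>content x\<bar>) ` Y)" using young_fin[OF assms] by simp
  define n where "n = Max (insert 0 ((\<lambda>x. \<bar>content x\<bar>) ` Y)) + 1"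
  have n: "\<bar>content x\<bar> < n" if "x \<in> Y" for x
  proof -
    have "\<bar>content x\<bar> \<le> Max (insert 0 ((\<lambda>x. \<bar>content x\<bar>) ` Y))" using f that by (intro Max_ge) auto
    then show ?thesis unfolding n_def by simp
  qed
  have "0 \<le> Max (insert 0 ((\<lambda>x. \<bar>content x\<bar>) ` Y))" using f by (intro Max_ge) auto
  then have "0 \<le> n" unfolding n_def by simp
  moreover have "prof Y y = max 0 y" if "n \<le> \<bar>y\<bar>" for y
  proof -
    have "{x\<in>Y. content x = y} = {}" using n that by force
    then show ?thesis unfolding prof_def by (simp only: card.empty)
  qed
  ultimately show ?thesis by blast
qed

lemma prof_insert:
  assumes "finite Y" "x \<notin> Y" shows "prof (insert x Y) = (prof Y)(content x := prof Y (content x) + 1)"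
proof
  fix y
  have "{z \<in> insert x Y. content z = y} = (if content x = y then insert x {z\<in>Y. content z = y} else {z\<in>Y. content z = y})" by auto
  then show "prof (insert x Y) y = ((prof Y)(content x := prof Y (content x) + 1)) y"
    unfolding prof_def using assms by auto
qed

text \<open>On the abacus: a bead at \<open>y - 1\<close> and a gap at \<open>y\<close>, so that a
  node of content \<open>y\<close> can be added. The reverse configuration is
  \<open>outer_at\<close>.\<close>

definition inner_at :: "(int \<Rightarrow> int) \<Rightarrow> int \<Rightarrow> bool" where
  "inner_at h y \<longleftrightarrow> h (y - 1) = h y \<and> h (y + 1) = h y + 1"

definition outer_at :: "(int \<Rightarrow> int) \<Rightarrow> int \<Rightarrow> bool" where
  "outer_at h y \<longleftrightarrow> h (y - 1) = h y - 1 \<and> h (y + 1) = h y"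

lemma content_node_at:
  assumes "inner_at h y \<or> outer_at h y" "max 0 y \<le> h y" "max 0 (y - 1) \<le> h (y - 1)" "max 0 (y + 1) \<le> h (y + 1)"
  shows "content (node_at h y) = y" "1 \<le> fst (node_at h y)" "1 \<le> snd (node_at h y)"
  using assms unfolding content_def node_at_def inner_at_def outer_at_def by auto

lemma addable_iff:
  assumes Y: "young Y"
  shows "addable Y x \<longleftrightarrow> inner_at (prof Y) (content x) \<and> x = node_at (prof Y) (content x)"
proof -
  obtain r c where x: "x = (r, c)" by force
  let ?h = "prof Y" and ?y = "content x"
  have inc: "?h y \<le> ?h (y + 1)" "?h (y + 1) \<le> ?h y + 1" for y using prof_incr[OF Y] unfolding incr_def by auto
  note inc' = inc[of ?y] inc[of "?y - 1", simplified]
  note ge = prof_ge[of ?y Y] prof_ge[of "?y - 1" Y] prof_ge[of "?y + 1" Y]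
  have y: "?y = int c - int r" unfolding content_def x by simp
  show ?thesis
  proof
    assume a: "addable Y x"
    then have n: "(r, c) \<notin> Y" and rc: "1 \<le> r" "1 \<le> c" and up: "r > 1 \<Longrightarrow> (r - 1, c) \<in> Y" and lf: "c > 1 \<Longrightarrow> (r, c - 1) \<in> Y"
      unfolding addable_def young_def x by auto
    have "int c > ?h ?y" using mem_prof'[OF Y y[symmetric] rc] n by simp
    moreover have "int c \<le> ?h (?y + 1)"
    proof (cases "r > 1")
      case True
      have "int c - int (r - 1) = ?y + 1" using True y by auto
      from mem_prof'[OF Y this] show ?thesis using up rc True by simp
    qed (use rc ge y in auto)
    moreover have "int c - 1 \<le> ?h (?y - 1)"
    proof (cases "c > 1")
      case True
      have "int (c - 1) - int r = ?y - 1" using True y by auto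
      from mem_prof'[OF Y this] show ?thesis using lf rc True by simp
    qed (use rc ge y in auto)
    ultimately show "inner_at ?h ?y \<and> x = node_at ?h ?y" using inc' y unfolding inner_at_def node_at_def x by auto
  next
    assume "inner_at ?h ?y \<and> x = node_at ?h ?y"
    then have p: "?h (?y - 1) = ?h ?y" "?h (?y + 1) = ?h ?y + 1" and xn: "(r, c) = node_at ?h ?y" unfolding inner_at_def x by auto
    have c: "int c = ?h ?y + 1" and rc: "1 \<le> r" "1 \<le> c" using xn p ge unfolding node_at_def by auto
    have "(r, c) \<notin> Y" using mem_prof'[OF Y y[symmetric] rc] p c by simp
    moreover have "(r - 1, c) \<in> Y" if "r > 1"
    proof -
      have "int c - int (r - 1) = ?y + 1" using that y by auto
      from mem_prof'[OF Y this] show ?thesis using p c rc that by simp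
    qed
    moreover have "(r, c - 1) \<in> Y" if "c > 1"
    proof -
      have "int (c - 1) - int r = ?y - 1" using that y by auto
      from mem_prof'[OF Y this] show ?thesis using p c rc that by simp
    qed
    ultimately show "addable Y x" using Y rc unfolding addable_def young_def x by auto
  qed
qed

lemma removable_iff:
  assumes Y: "young Y"
  shows "removable Y x \<longleftrightarrow> outer_at (prof Y) (content x) \<and> x = node_at (prof Y) (content x)"
proof -
  obtain r c where x: "x = (r, c)" by force
  let ?h = "prof Y" and ?y = "content x"
  have inc: "?h y \<le> ?h (y + 1)" "?h (y + 1) \<le> ?h y + 1" for y using prof_incr[OF Y] unfolding incr_def by auto
  note inc' = inc[of ?y] inc[of "?y - 1", simplified]
  note ge = prof_ge[of ?y Y] prof_ge[of "?y - 1" Y] prof_ge[of "?y + 1" Y]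
  have y: "?y = int c - int r" unfolding content_def x by simp
  show ?thesis
  proof
    assume a: "removable Y x"
    then have m: "(r, c) \<in> Y" and yo: "young (Y - {(r, c)})" unfolding removable_def x by auto
    have rc: "1 \<le> r" "1 \<le> c" using young_pos[OF Y m] by auto
    have "(Suc r, c) \<notin> Y" using young_down[OF yo, of "Suc r" c r c] rc by auto
    moreover have "(r, Suc c) \<notin> Y" using young_down[OF yo, of r "Suc c" r c] rc by auto
    moreover have e: "int c - int (Suc r) = ?y - 1" "int (Suc c) - int r = ?y + 1" using y by auto
    ultimately have "int c \<le> ?h ?y" "\<not> int c \<le> ?h (?y - 1)" "\<not> int c + 1 \<le> ?h (?y + 1)"
      using mem_prof'[OF Y y[symmetric] rc] mem_prof'[OF Y e(1)] mem_prof'[OF Y e(2)] rc m by simp_all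
    then show "outer_at ?h ?y \<and> x = node_at ?h ?y" using inc' y unfolding outer_at_def node_at_def x by auto
  next
    assume "outer_at ?h ?y \<and> x = node_at ?h ?y"
    then have p: "?h (?y - 1) = ?h ?y - 1" "?h (?y + 1) = ?h ?y" and xn: "(r, c) = node_at ?h ?y" unfolding outer_at_def x by auto
    have c: "int c = ?h ?y" and rc: "1 \<le> r" "1 \<le> c" using xn p ge unfolding node_at_def by auto
    have "(r, c) \<in> Y" using mem_prof'[OF Y y[symmetric] rc] p c by simp
    moreover have e: "int c - int (Suc r) = ?y - 1" "int (Suc c) - int r = ?y + 1" using y by auto
    have "(Suc r, c) \<notin> Y" "(r, Suc c) \<notin> Y"
      using mem_prof'[OF Y e(1)] mem_prof'[OF Y e(2)] p c rc by simp_all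
    ultimately show "removable Y x" using Y unfolding removable_def young_def x by force
  qed
qed

section \<open>Rows as beads, columns as gaps\<close>

lemma row_len_mem:
  assumes Y: "young Y" and r: "1 \<le> r" "1 \<le> c" shows "(r, c) \<in> Y \<longleftrightarrow> c \<le> row_len Y r"
proof -
  have "finite (snd ` Y)" using young_fin[OF Y] by simp
  then have "finite {c. (r, c) \<in> Y}" by (rule rev_finite_subset) force
  then have "{c. (r, c) \<in> Y} = {1..card {c. (r, c) \<in> Y}}"
  proof (rule initial_nat_set)
    fix k assume k: "k \<in> {c. (r, c) \<in> Y}"
    then show "1 \<le> k \<and> (1 < k \<longrightarrow> k - 1 \<in> {c. (r, c) \<in> Y})"
      using young_pos[OF Y, of r k] young_down[OF Y, of r k r "k - 1"] by simp
  qed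
  then have "c \<in> {c. (r, c) \<in> Y} \<longleftrightarrow> c \<in> {1..card {c. (r, c) \<in> Y}}" by (rule arg_cong)
  then show ?thesis using r unfolding row_len_def by simp
qed

lemma col_len_mem:
  assumes Y: "young Y" and r: "1 \<le> r" "1 \<le> c" shows "(r, c) \<in> Y \<longleftrightarrow> r \<le> col_len Y c"
proof -
  have "finite (fst ` Y)" using young_fin[OF Y] by simp
  then have "finite {r. (r, c) \<in> Y}" by (rule rev_finite_subset) force
  then have "{r. (r, c) \<in> Y} = {1..card {r. (r, c) \<in> Y}}"
  proof (rule initial_nat_set)
    fix k assume k: "k \<in> {r. (r, c) \<in> Y}"
    then show "1 \<le> k \<and> (1 < k \<longrightarrow> k - 1 \<in> {r. (r, c) \<in> Y})"
      using young_pos[OF Y, of k c] young_down[OF Y, of k c "k - 1" c] by simp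
  qed
  then have "r \<in> {r. (r, c) \<in> Y} \<longleftrightarrow> r \<in> {1..card {r. (r, c) \<in> Y}}" by (rule arg_cong)
  then show ?thesis using r unfolding col_len_def by simp
qed

text \<open>The boundary leaves row \<open>r\<close> along a flat step, the bead at position
  \<open>n - r\<close>; dually, in \<open>col_end\<close>, it leaves column \<open>c\<close> along a
  rising step, the gap at position \<open>c - 1 - n\<close>.\<close>

lemma row_end:
  assumes Y: "young Y" and r: "1 \<le> r"
  shows "row_len Y r = n \<longleftrightarrow> prof Y (int n - int r) = int n \<and> prof Y (int n - int r + 1) = int n"
proof -
  have inc: "prof Y y \<le> prof Y (y + 1)" "prof Y (y + 1) \<le> prof Y y + 1" for y 
    using prof_incr[OF Y] unfolding incr_def by auto
  have a: "n \<le> row_len Y r \<longleftrightarrow> int n \<le> prof Y (int n - int r)" for n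
    using row_len_mem[OF Y r, of n] mem_prof[OF Y r, of n] prof_ge[of "int n - int r" Y] by (cases "n = 0") auto
  have b: "Suc n \<le> row_len Y r \<longleftrightarrow> int n + 1 \<le> prof Y (int n - int r + 1)" for n
    using a[of "Suc n"] by (simp add: algebra_simps)
  have "row_len Y r = n \<longleftrightarrow> n \<le> row_len Y r \<and> \<not> Suc n \<le> row_len Y r" by auto
  also have "\<dots> \<longleftrightarrow> int n \<le> prof Y (int n - int r) \<and> prof Y (int n - int r + 1) \<le> int n"
    unfolding b not_le zle_add1_eq_le unfolding a by (rule refl)
  finally show ?thesis using inc[of "int n - int r"] by auto
qed

lemma col_end:
  assumes Y: "young Y" and c: "1 \<le> c"
  shows "col_len Y c = n \<longleftrightarrow> prof Y (int c - 1 - int n) = int c - 1 \<and> prof Y (int c - int n) = int c"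
proof -
  have inc: "prof Y y \<le> prof Y (y + 1)" "prof Y (y + 1) \<le> prof Y y + 1" for y 
    using prof_incr[OF Y] unfolding incr_def by auto
  have a: "n \<le> col_len Y c \<longleftrightarrow> int c \<le> prof Y (int c - int n)" for n
    using col_len_mem[OF Y _ c, of n] mem_prof[OF Y _ c, of n] prof_ge[of "int c - int n" Y] by (cases "n = 0") auto
  have b: "Suc n \<le> col_len Y c \<longleftrightarrow> int c \<le> prof Y (int c - 1 - int n)" for n
    using a[of "Suc n"] by (simp add: algebra_simps)
  have "col_len Y c = n \<longleftrightarrow> n \<le> col_len Y c \<and> \<not> Suc n \<le> col_len Y c" by auto
  also have "\<dots> \<longleftrightarrow> int c \<le> prof Y (int c - int n) \<and> prof Y (int c - 1 - int n) < int c"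
    unfolding b not_le unfolding a by (rule refl)
  finally show ?thesis using inc[of "int c - 1 - int n"] by (auto simp: algebra_simps)
qed

text \<open>A hook is a bead \<open>x\<close> above a gap \<open>y\<close>; its length is \<open>x -
  y\<close> and its arm length is the number of gaps strictly between.\<close>

definition regular :: "nat \<Rightarrow> (nat \<Rightarrow> int) \<Rightarrow> (int \<Rightarrow> int) \<Rightarrow> bool" where
  "regular e A h \<longleftrightarrow> \<not> (\<exists>x y t. 1 \<le> t \<and> x - y = int e * int t \<and> h (x + 1) = h x \<and> h (y + 1) = h y + 1 \<and> h x - h y = A t + 1)"

lemma A_regular_iff:
  assumes A: "arm_seq e A"
  shows "A_regular e A Y \<longleftrightarrow> young Y \<and> regular e A (prof Y)"
proof (cases "young Y")
  case Y: True
  let ?h = "prof Y"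
  have "(\<exists>x\<in>Y. \<exists>t\<ge>1. hook_len Y x = int e * int t \<and> arm_len Y x = A t) \<longleftrightarrow>
    (\<exists>x y t. 1 \<le> t \<and> x - y = int e * int t \<and> ?h (x + 1) = ?h x \<and> ?h (y + 1) = ?h y + 1 \<and> ?h x - ?h y = A t + 1)"
    (is "?L \<longleftrightarrow> ?R")
  proof
    assume ?L
    then obtain r c t where rc: "(r, c) \<in> Y" and t: "t \<ge> 1" "hook_len Y (r, c) = int e * int t" "arm_len Y (r, c) = A t"
      by auto
    note p = young_pos[OF Y rc]
    define x where "x = int (row_len Y r) - int r"
    define y where "y = int c - 1 - int (col_len Y c)"
    have "?h x = row_len Y r" "?h (x + 1) = row_len Y r" "?h y = int c - 1" "?h (y + 1) = int c"
      using row_end[OF Y, of r "row_len Y r"] col_end[OF Y, of c "col_len Y c"] p unfolding x_def y_def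
      by (auto simp: algebra_simps)
    then show ?R using t by (intro exI[of _ x] exI[of _ y] exI[of _ t]) (auto simp: hook_len_def arm_len_def x_def y_def)
  next
    assume ?R
    then obtain x y t where t: "1 \<le> t" "x - y = int e * int t" and h: "?h (x + 1) = ?h x" "?h (y + 1) = ?h y + 1" "?h x - ?h y = A t + 1"
      by blast
    note ge = prof_ge[of x Y] prof_ge[of "x + 1" Y] prof_ge[of y Y]
    define r where "r = nat (?h x - x)"
    define c where "c = nat (?h y + 1)"
    have r: "1 \<le> r" "int r = ?h x - x" and c: "1 \<le> c" "int c = ?h y + 1" using ge h unfolding r_def c_def by auto
    have e: "?h x - int r = x" "int (nat (?h x)) = ?h x"
      "int c - 1 - int (nat (?h y - y)) = y" "int c - int (nat (?h y - y)) = y + 1" using r c ge by auto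
    have row: "row_len Y r = nat (?h x)" using row_end[OF Y r(1), of "nat (?h x)"] h unfolding e by simp
    have col: "col_len Y c = nat (?h y - y)" using col_end[OF Y c(1), of "nat (?h y - y)"] c h unfolding e by simp
    \<comment> \<open>The node recovered from bead and gap lies in the diagram because its arm
      length would be \<open>A t\<close>, which this bound makes nonnegative.\<close>
    have "A t \<ge> int t - 1" using A t(1) unfolding arm_seq_def by blast
    then have "c \<le> row_len Y r" using row c h t by auto
    then have "(r, c) \<in> Y" using row_len_mem[OF Y r(1) c(1)] by simp
    moreover have "hook_len Y (r, c) = int e * int t" "arm_len Y (r, c) = A t"
      using row col r c h t ge unfolding hook_len_def arm_len_def by auto
    ultimately show ?L using t by blast
  qed
  then show ?thesis using Y unfolding A_regular_def regular_def by blast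
qed (simp add: A_regular_def)

section \<open>The operator \<open>f_op\<close> in terms of profiles\<close>

lemma psum_cong:
  assumes "\<And>x. x \<in> N \<Longrightarrow> s x = s' x" "\<And>x y. \<lbrakk>x \<in> N; y \<in> N\<rbrakk> \<Longrightarrow> le x y = le' x y" "x \<in> N"
  shows "psum N le s x = psum N le' s' x"
proof -
  have "{y\<in>N. le y x} = {y\<in>N. le' y x}" using assms by auto
  then show ?thesis unfolding psum_def using assms by (auto intro: sum.cong)
qed

lemma good_cong:
  assumes "\<And>x. x \<in> N \<Longrightarrow> s x = s' x" "\<And>x y. \<lbrakk>x \<in> N; y \<in> N\<rbrakk> \<Longrightarrow> le x y = le' x y"
  shows "good N le s p = good N le' s' p" "height N le s = height N le' s'"
proof -
  have E: "psum N le s x = psum N le' s' x" if "x \<in> N" for x using psum_cong[of N s s' le le' x] assms that by blast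
  show "good N le s p = good N le' s' p" unfolding good_def using E assms(2) by (metis (no_types, lifting))
  show "height N le s = height N le' s'" unfolding height_def using E by (simp cong: image_cong)
qed

lemma good_image:
  assumes "inj_on f N" 
  shows "p \<in> N \<Longrightarrow> good (f ` N) le s (f p) \<longleftrightarrow> good N (\<lambda>a b. le (f a) (f b)) (\<lambda>a. s (f a)) p"
    and "height (f ` N) le s = height N (\<lambda>a b. le (f a) (f b)) (\<lambda>a. s (f a))"
proof -
  have E: "psum (f ` N) le s (f x) = psum N (\<lambda>a b. le (f a) (f b)) (\<lambda>a. s (f a)) x" for x
  proof -
    have "{y \<in> f ` N. le y (f x)} = f ` {y\<in>N. le (f y) (f x)}" by auto
    moreover have "inj_on f {y\<in>N. le (f y) (f x)}" using assms by (rule inj_on_subset) auto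
    ultimately show ?thesis unfolding psum_def by (simp add: sum.reindex)
  qed
  show "p \<in> N \<Longrightarrow> good (f ` N) le s (f p) \<longleftrightarrow> good N (\<lambda>a b. le (f a) (f b)) (\<lambda>a. s (f a)) p"
    unfolding good_def using assms by (auto simp: E dest: inj_onD)
  show "height (f ` N) le s = height N (\<lambda>a b. le (f a) (f b)) (\<lambda>a. s (f a))"
    unfolding height_def by (simp add: image_image E)
qed

lemma (in lin_carrier) ex_sorted: "\<exists>xs. distinct xs \<and> set xs = N \<and> sorted_wrt le xs"
proof -
  have "\<exists>xs. distinct xs \<and> set xs = M \<and> sorted_wrt le xs" if "finite M" "M \<subseteq> N" for M
    using that
  proof (induction M rule: finite_psubset_induct)
    case (psubset M)
    show ?case
    proof (cases "M = {}")
      case False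
      then obtain m where m: "m \<in> M" "\<forall>y\<in>M. le m y" using ex_first[of M] psubset by blast
      then obtain xs where xs: "distinct xs" "set xs = M - {m}" "sorted_wrt le xs"
        using psubset.IH[of "M - {m}"] psubset.prems by blast
      then have "distinct (m # xs) \<and> set (m # xs) = M \<and> sorted_wrt le (m # xs)" using m by auto
      then show ?thesis by blast
    qed auto
  qed
  then show ?thesis using fin by blast
qed

text \<open>Invariant for putting a letter in front: the reduced word is a block of minuses followed
  by pluses, the number of pluses is the largest sum over a final segment (0 for the empty one), and
  the first plus starts the shortest segment attaining it. A new plus cancels the first surviving
  minus, if any.\<close>

lemma reduce_word_good:
  assumes "distinct xs" "sorted_wrt le xs" "lin_carrier (set xs) le"
    and "\<And>x. x \<in> set xs \<Longrightarrow> s x = (if sg x then 1 else -1 :: int)"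
  shows "\<exists>ms ps. reduce_word (map (\<lambda>x. (sg x, x)) xs) = map (Pair False) ms @ map (Pair True) ps \<and>
     sum s (set xs) = int (length ps) - int (length ms) \<and>
     (\<forall>x\<in>set xs. psum (set xs) (\<lambda>a b. le b a) s x \<le> int (length ps)) \<and>
     (ps \<noteq> [] \<longrightarrow> good (set xs) (\<lambda>a b. le b a) s (hd ps) \<and> psum (set xs) (\<lambda>a b. le b a) s (hd ps) = int (length ps))"
  using assms
proof (induction xs)
  case (Cons a w)
  interpret L: lin_carrier "set (a # w)" le by fact
  have "lin_carrier (set w) le" by (rule L.sub_carrier) auto
  have pre: "distinct w" "sorted_wrt le w" "\<And>x. x \<in> set w \<Longrightarrow> s x = (if sg x then 1 else -1)" using Cons.prems by simp_all
  obtain ms ps where IH: "reduce_word (map (\<lambda>x. (sg x, x)) w) = map (Pair False) ms @ map (Pair True) ps"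
     "sum s (set w) = int (length ps) - int (length ms)"
     "\<And>x. x\<in>set w \<Longrightarrow> psum (set w) (\<lambda>a b. le b a) s x \<le> int (length ps)"
     "ps \<noteq> [] \<Longrightarrow> good (set w) (\<lambda>a b. le b a) s (hd ps) \<and> psum (set w) (\<lambda>a b. le b a) s (hd ps) = int (length ps)"
    using Cons.IH[OF pre(1,2) \<open>lin_carrier (set w) le\<close> pre(3)] by blast
  have aw: "a \<notin> set w" and al: "\<And>x. x \<in> set w \<Longrightarrow> le a x" using Cons.prems by auto
  have nal: "\<not> le x a" if "x \<in> set w" for x using that aw al[OF that] L.antisym[of a x] by auto
  have P: "psum (set (a # w)) (\<lambda>a b. le b a) s x = psum (set w) (\<lambda>a b. le b a) s x" if "x \<in> set w" for x
  proof -
    have "{y \<in> set (a # w). le x y} = {y \<in> set w. le x y}" using nal[OF that] by auto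
    then show ?thesis unfolding psum_def by simp
  qed
  have T: "sum s (set (a # w)) = s a + sum s (set w)" using aw by simp
  have "{y \<in> set (a # w). le a y} = set (a # w)" using al L.refl by auto
  then have Pa: "psum (set (a # w)) (\<lambda>a b. le b a) s a = s a + sum s (set w)" unfolding psum_def using T by simp
  have sa: "s a = (if sg a then 1 else -1)" using Cons.prems by simp
  have keep: "(\<forall>x\<in>set (a # w). psum (set (a # w)) (\<lambda>a b. le b a) s x \<le> int (length ps)) \<and>
     (ps \<noteq> [] \<longrightarrow> good (set (a # w)) (\<lambda>a b. le b a) s (hd ps) \<and> psum (set (a # w)) (\<lambda>a b. le b a) s (hd ps) = int (length ps))"
    if le: "s a + sum s (set w) \<le> int (length ps)"
  proof (intro conjI impI ballI)
    fix x assume "x \<in> set (a # w)"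
    then show "psum (set (a # w)) (\<lambda>a b. le b a) s x \<le> int (length ps)"
      using IH(3)[of x] P[of x] Pa le by auto
  next
    assume ne: "ps \<noteq> []"
    note g = IH(4)[OF ne]
    have h: "hd ps \<in> set w" using g unfolding good_def by simp
    show hp: "psum (set (a # w)) (\<lambda>a b. le b a) s (hd ps) = int (length ps)" using g P[OF h] by simp
    show "good (set (a # w)) (\<lambda>a b. le b a) s (hd ps)"
      unfolding good_def hp
    proof (intro conjI ballI impI)
      show "hd ps \<in> set (a # w)" using h by simp
      show "1 \<le> int (length ps)" using ne by (cases ps) auto
      fix y assume y: "y \<in> set (a # w)"
      show "psum (set (a # w)) (\<lambda>a b. le b a) s y \<le> int (length ps)"
        using y IH(3)[of y] P[of y] Pa le by auto
      assume b: "le (hd ps) y \<and> y \<noteq> hd ps"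
      then have "y \<in> set w" using y nal[OF h] by auto
      then show "psum (set (a # w)) (\<lambda>a b. le b a) s y < int (length ps)"
        using P g b unfolding good_def by auto
    qed
  qed
  show ?case
  proof (cases "sg a")
    case True
    show ?thesis
    proof (cases ms)
      case Nil
      have r: "reduce_word (map (\<lambda>x. (sg x, x)) (a # w)) = map (Pair False) [] @ map (Pair True) (a # ps)"
        using IH(1) Nil True by (cases ps) auto
      have tot: "s a + sum s (set w) = int (length (a # ps))" using sa True IH(2) Nil by simp
      have b: "psum (set (a # w)) (\<lambda>a b. le b a) s x < int (length (a # ps))" if "x \<in> set w" for x
        using IH(3)[OF that] P[OF that] by simp
      have Ga: "psum (set (a # w)) (\<lambda>a b. le b a) s a = int (length (a # ps))" using Pa tot by simp
      have b': "psum (set (a # w)) (\<lambda>a b. le b a) s x \<le> int (length (a # ps))" if "x \<in> set (a # w)" for x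
        using b[of x] Ga that by (cases "x = a") auto
      have g: "good (set (a # w)) (\<lambda>a b. le b a) s a"
        unfolding good_def Ga
      proof (intro conjI ballI impI)
        fix y assume y: "y \<in> set (a # w)"
        then show "psum (set (a # w)) (\<lambda>a b. le b a) s y \<le> int (length (a # ps))" by (rule b')
        assume "le a y \<and> y \<noteq> a"
        then show "psum (set (a # w)) (\<lambda>a b. le b a) s y < int (length (a # ps))" using b[of y] y by auto
      qed auto
      have tot': "sum s (set (a # w)) = int (length (a # ps)) - int (length [])" using T tot by simp
      show ?thesis
        by (rule exI[of _ "[]"], rule exI[of _ "a # ps"], intro conjI impI)
          (rule r | rule tot' | rule ballI, erule b' | simp only: list.sel, rule g | simp only: list.sel, rule Ga)+
    next
      case (Cons m ms')
      have r: "reduce_word (map (\<lambda>x. (sg x, x)) (a # w)) = map (Pair False) ms' @ map (Pair True) ps"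
        using IH(1) Cons True by auto
      have "s a + sum s (set w) \<le> int (length ps)" using sa True IH(2) Cons by simp
      note k = keep[OF this]
      have "sum s (set (a # w)) = int (length ps) - int (length ms')" using T sa True IH(2) Cons by simp
      then show ?thesis using r k by blast
    qed
  next
    case False
    have r: "reduce_word (map (\<lambda>x. (sg x, x)) (a # w)) = map (Pair False) (a # ms) @ map (Pair True) ps"
      using IH(1) False by (cases ms; cases ps) auto
    have "s a + sum s (set w) \<le> int (length ps)" using sa False IH(2) by simp
    note k = keep[OF this]
    have "sum s (set (a # w)) = int (length ps) - int (length (a # ms))" using T sa False IH(2) by simp
    then show ?thesis using r k by blast
  qed
qed simp

lemma reduce_word_first:
  assumes "distinct xs" "sorted_wrt le xs" "lin_carrier (set xs) le"
    and "\<And>x. x \<in> set xs \<Longrightarrow> s x = (if sg x then 1 else -1 :: int)"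
  shows "(case filter fst (reduce_word (map (\<lambda>x. (sg x, x)) xs)) of [] \<Rightarrow> None | q # _ \<Rightarrow> Some (snd q)) = Some p
     \<longleftrightarrow> good (set xs) (\<lambda>a b. le b a) s p"
proof -
  interpret L: lin_carrier "set xs" le by fact
  interpret D: lin_carrier "set xs" "\<lambda>a b. le b a" by (rule L.dual)
  obtain ms ps where r: "reduce_word (map (\<lambda>x. (sg x, x)) xs) = map (Pair False) ms @ map (Pair True) ps"
     "\<And>x. x\<in>set xs \<Longrightarrow> psum (set xs) (\<lambda>a b. le b a) s x \<le> int (length ps)"
     "ps \<noteq> [] \<Longrightarrow> good (set xs) (\<lambda>a b. le b a) s (hd ps)"
    using reduce_word_good[of xs le s sg, OF assms] by blast
  have f: "filter fst (map (Pair False) ms @ map (Pair True) ps) = map (Pair True) ps"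
    by (simp add: filter_map o_def)
  show ?thesis
  proof (cases ps)
    case Nil
    then have "\<not> good (set xs) (\<lambda>a b. le b a) s p" using r(2)[of p] unfolding good_def by fastforce
    then show ?thesis unfolding r(1) f using Nil by simp
  next
    case (Cons q qs)
    then have "good (set xs) (\<lambda>a b. le b a) s q" using r(3) by simp
    then show ?thesis unfolding r(1) f using Cons D.good_unique[of s q p] by auto
  qed
qed

text \<open>Extension to negative arguments for which \<open>Abar (t + u) - Abar t - Abar u \<in>
  {0, 1}\<close> holds for all integers.\<close>

definition Abar :: "(nat \<Rightarrow> int) \<Rightarrow> int \<Rightarrow> int" where
  "Abar A t = (if t = 0 then 0 else if t > 0 then A (nat t) else - A (nat (- t)) - 1)"

lemma Abar_minus: "t \<noteq> 0 \<Longrightarrow> Abar A (- t) = - Abar A t - 1"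
  unfolding Abar_def by auto

lemma Abar_add_pos:
  assumes "arm_seq e A" "0 < t" "0 < u"
  shows "Abar A (t + u) = Abar A t + Abar A u \<or> Abar A (t + u) = Abar A t + Abar A u + 1"
proof -
  have "A (nat t + nat u) = A (nat t) + A (nat u) \<or> A (nat t + nat u) = A (nat t) + A (nat u) + 1"
    using assms unfolding arm_seq_def by auto
  then show ?thesis using assms unfolding Abar_def by (simp add: nat_add_distrib)
qed

text \<open>The reflection \<open>- A - 1\<close> lets a term cross the equation without changing
  its 0/1 ambiguity, so every sign pattern apart from those involving 0 reduces to one instance with
  positive arguments.\<close>

lemma Abar_add:
  assumes A: "arm_seq e A"
  shows "Abar A t + Abar A u \<le> Abar A (t + u)" "Abar A (t + u) \<le> Abar A t + Abar A u + 1"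
proof -
  note p = Abar_add_pos[OF A]
  have "Abar A (t + u) = Abar A t + Abar A u \<or> Abar A (t + u) = Abar A t + Abar A u + 1"
  proof -
    consider "t = 0" | "u = 0" | "t + u = 0" "t \<noteq> 0" | "0 < t" "0 < u" | "t < 0" "u < 0"
      | "0 < t" "u < 0" "0 < t + u" | "0 < t" "u < 0" "t + u < 0" | "t < 0" "0 < u" "0 < t + u" | "t < 0" "0 < u" "t + u < 0"
      by linarith
    then show ?thesis
    proof cases
      case 1 then show ?thesis by (simp add: Abar_def)
    next
      case 2 then show ?thesis by (simp add: Abar_def)
    next
      case 3
      then have u: "u = - t" by simp
      show ?thesis unfolding u Abar_minus[OF 3(2)] by (simp add: Abar_def)
    next
      case 4 then show ?thesis using p by blast
    next
      case 5
      then show ?thesis using p[of "-t" "-u"] Abar_minus[of t A] Abar_minus[of u A] Abar_minus[of "t + u" A] by auto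
    next
      case 6 then show ?thesis using p[of "t + u" "-u"] Abar_minus[of u A] by auto
    next
      case 7 then show ?thesis using p[of "-(t + u)" t] Abar_minus[of u A] Abar_minus[of "t + u" A] by auto
    next
      case 8 then show ?thesis using p[of "t + u" "-t"] Abar_minus[of t A] by auto
    next
      case 9 then show ?thesis using p[of "-(t + u)" u] Abar_minus[of t A] Abar_minus[of "t + u" A] by auto
    qed
  qed
  then show "Abar A t + Abar A u \<le> Abar A (t + u)" "Abar A (t + u) \<le> Abar A t + Abar A u + 1" by auto
qed

text \<open>With \<open>u y = h (y - 1)\<close>, one less than the column of the node of content
  \<open>y\<close>, the value is nonpositive exactly when the node at \<open>x\<close> is below the
  node at \<open>y\<close> in the prescribed order.\<close>

definition defect :: "nat \<Rightarrow> (nat \<Rightarrow> int) \<Rightarrow> (int \<Rightarrow> int) \<Rightarrow> int \<Rightarrow> int \<Rightarrow> int" where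
  "defect e A u x y = u x - u y - Abar A ((x - y) div int e)"

lemma div_diff_add:
  fixes x y z :: int assumes "x mod m = y mod m" "y mod m = z mod m"
  shows "(x - z) div m = (x - y) div m + (y - z) div m"
proof -
  have "m dvd x - y" using assms(1) by (simp only: mod_eq_dvd_iff)
  then have "((x - y) + (y - z)) div m = (x - y) div m + (y - z) div m" by (rule div_plus_div_distrib_dvd_left)
  then show ?thesis by simp
qed

text \<open>The \<open>u\<close> terms telescope, so only the 0/1 additivity of \<open>Abar\<close>
  remains; a common residue makes the quotients exact and hence additive.\<close>

lemma defect_order_defect:
  assumes A: "arm_seq e A" and "0 < e" "finite P" "\<And>x. x \<in> P \<Longrightarrow> x mod int e = i"
  shows "defect_order P (defect e A u)"
proof
  fix x y assume "x \<in> P" "y \<in> P" "x \<noteq> y"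
  then have "x mod int e = y mod int e" using assms(4) by simp
  then have "int e dvd x - y" by (simp only: mod_eq_dvd_iff)
  then obtain t where t: "x - y = int e * t" by blast
  have t': "y - x = int e * (- t)" using t by simp
  have "(x - y) div int e = t" "(y - x) div int e = - t"
    unfolding t' unfolding t using assms(2) by (simp_all add: nonzero_mult_div_cancel_left del: mult_minus_right)
  moreover have "t \<noteq> 0" using t \<open>x \<noteq> y\<close> by auto
  ultimately show "defect e A u x y + defect e A u y x = 1" unfolding defect_def using Abar_minus[of t A] by simp
next
  fix x y z assume *: "x \<in> P" "y \<in> P" "z \<in> P"
  have d: "(x - z) div int e = (x - y) div int e + (y - z) div int e"
    using * assms by (intro div_diff_add) auto
  show "defect e A u x z \<le> defect e A u x y + defect e A u y z"
    unfolding defect_def d using Abar_add(1)[OF A, of "(x - y) div int e" "(y - z) div int e"] by simp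
  show "defect e A u x y + defect e A u y z \<le> defect e A u x z + 1"
    unfolding defect_def d using Abar_add(2)[OF A, of "(x - y) div int e" "(y - z) div int e"] by simp
next
  fix x show "defect e A u x x = 0" unfolding defect_def by (simp add: Abar_def)
qed fact

text \<open>Contents of the addable and removable nodes of residue \<open>i\<close>: exactly one of
  the two steps next to \<open>y\<close> rises. The sign \<open>sgn_at\<close> is -1 at an addable,
  1 at a removable and 0 at any other content.\<close>

definition conts :: "nat \<Rightarrow> nat \<Rightarrow> (int \<Rightarrow> int) \<Rightarrow> int set" where
  "conts e i h = {y. y mod int e = int i \<and> h (y + 1) = h (y - 1) + 1}"

definition sgn_at :: "(int \<Rightarrow> int) \<Rightarrow> int \<Rightarrow> int" where
  "sgn_at h y = (if h (y + 1) = h (y - 1) + 1 then (if h y = h (y - 1) then -1 else 1) else 0)"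

abbreviation "dfct e A h \<equiv> defect e A (\<lambda>y. h (y - 1))"

definition far :: "(int \<Rightarrow> int) \<Rightarrow> bool" where
  "far h \<longleftrightarrow> (\<exists>n\<ge>0. \<forall>y. n \<le> \<bar>y\<bar> \<longrightarrow> h y = max 0 y)"

lemma conts_finite: assumes "far h" shows "finite (conts e i h)"
proof -
  obtain n where n: "0 \<le> n" "\<And>y. n \<le> \<bar>y\<bar> \<Longrightarrow> h y = max 0 y" using assms unfolding far_def by blast
  have "conts e i h \<subseteq> {-n-1..n+1}"
  proof
    fix y assume y: "y \<in> conts e i h"
    show "y \<in> {-n-1..n+1}"
    proof (rule ccontr)
      assume "\<not> ?thesis"
      then have "h (y + 1) = max 0 (y + 1)" "h (y - 1) = max 0 (y - 1)" "y > 1 \<or> y < -1" using n by auto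
      then show False using y unfolding conts_def by auto
    qed
  qed
  then show ?thesis by (rule finite_subset) simp
qed

definition f_good where "f_good e A i h p \<longleftrightarrow> good (conts e i h) (\<lambda>x y. dfct e A h x y \<le> 0) (\<lambda>x. - sgn_at h x) p"

text \<open>Taking contents is injective on the nodes of residue \<open>i\<close> and turns
  \<open>prec\<close> into nonpositivity of the defect. The bracket rule on the sorted word then
  becomes a first maximum of prefix sums, free of lists.\<close>

lemma f_op_iff:
  assumes A: "arm_seq e A" and e: "0 < e" and Y: "young Y"
  shows "f_op e A i Y = Some Z \<longleftrightarrow> (\<exists>p. f_good e A i (prof Y) p \<and> Z = insert (node_at (prof Y) p) Y)"
proof -
  let ?h = "prof Y" and ?I = "i_nodes e Y i"
  have inc: "?h y \<le> ?h (y + 1)" "?h (y + 1) \<le> ?h y + 1" for y using prof_incr[OF Y] unfolding incr_def by auto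
  have alt: "inner_at ?h y \<or> outer_at ?h y \<longleftrightarrow> ?h (y + 1) = ?h (y - 1) + 1" for y
    using inc[of y] inc[of "y - 1"] unfolding inner_at_def outer_at_def by auto
  have res: "residue e x = i \<longleftrightarrow> content x mod int e = int i" for x
    unfolding residue_def content_def using e by (auto simp: nat_eq_iff)
  have I: "x \<in> ?I \<longleftrightarrow> content x \<in> conts e i ?h \<and> x = node_at ?h (content x)" for x
    unfolding i_nodes_def conts_def mem_Collect_eq addable_iff[OF Y] removable_iff[OF Y] res alt[symmetric] by blast
  have inj: "inj_on content ?I" by (rule inj_onI) (metis I)
  have cn: "content (node_at ?h y) = y" if "y \<in> conts e i ?h" for y
    using that alt[of y] prof_ge[of y Y] prof_ge[of "y - 1" Y] prof_ge[of "y + 1" Y]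
    by (intro content_node_at) (simp_all add: conts_def)
  have img: "content ` ?I = conts e i ?h"
  proof
    show "content ` ?I \<subseteq> conts e i ?h" using I by auto
    show "conts e i ?h \<subseteq> content ` ?I"
    proof
      fix y assume y: "y \<in> conts e i ?h"
      then have "node_at ?h y \<in> ?I" using I cn by simp
      then show "y \<in> content ` ?I" using cn[OF y] by force
    qed
  qed
  have finc: "finite (conts e i ?h)" by (rule conts_finite) (use prof_far[OF Y] in \<open>simp add: far_def\<close>)
  interpret D: defect_order "conts e i ?h" "dfct e A ?h"
    by (rule defect_order_defect[OF A e finc, of "int i"]) (simp add: conts_def)
  have snd: "int (snd x) = ?h (content x - 1) + 1" if "x \<in> ?I" for x
    using that I prof_ge[of "content x - 1" Y] by (metis (no_types, lifting) add_increasing2 max.bounded_iff nat_eq_iff2 node_at_def snd_conv zero_le_one)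
  have prec: "prec e A x y \<longleftrightarrow> dfct e A ?h (content x) (content y) \<le> 0" if xy: "x \<in> ?I" "y \<in> ?I" for x y
  proof -
    have k: "int (fst y) - int (fst x) + int (snd x) - int (snd y) = content x - content y" unfolding content_def by simp
    have "content x mod int e = content y mod int e" using xy I unfolding conts_def by auto
    then have "int e dvd content x - content y" by (simp only: mod_eq_dvd_iff)
    then obtain t where t: "content x - content y = int e * t" by blast
    have t': "- (content x - content y) = int e * (- t)" using t by simp
    have d: "(content x - content y) div int e = t" "(- (content x - content y)) div int e = - t"
      unfolding t' unfolding t using e by (simp_all add: nonzero_mult_div_cancel_left del: mult_minus_right)
    have s: "int (snd x) - int (snd y) = ?h (content x - 1) - ?h (content y - 1)" "int (snd y) - int (snd x) = ?h (content y - 1) - ?h (content x - 1)"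
      using snd xy by auto
    have nn: "0 \<le> content x - content y \<longleftrightarrow> 0 \<le> t" unfolding t using e by (simp add: zero_le_mult_iff)
    show ?thesis unfolding prec_def Let_def k d s nn defect_def
      by (cases "t = 0"; cases "0 < t") (auto simp: Aval_def Abar_def)
  qed
  have lin: "lin_carrier ?I (\<lambda>x y. prec e A y x)"
  proof
    show "finite ?I" using finc inj img by (metis finite_imageD)
  next
    fix x y z assume a: "x \<in> ?I" "y \<in> ?I" "z \<in> ?I" "prec e A y x" "prec e A z y"
    then show "prec e A z x" using lin_carrier.trans[OF D.lin, of "content x" "content y" "content z"] I prec by blast
  next
    fix x y assume a: "x \<in> ?I" "y \<in> ?I"
    then show "prec e A y x \<or> prec e A x y" using lin_carrier.total[OF D.lin, of "content x" "content y"] I prec by blast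
  next
    fix x y assume a: "x \<in> ?I" "y \<in> ?I" "prec e A y x" "prec e A x y"
    then have "content x = content y" using lin_carrier.antisym[OF D.lin, of "content x" "content y"] I prec by blast
    then show "x = y" using inj a by (metis inj_onD)
  next
    fix x assume a: "x \<in> ?I"
    then show "prec e A x x" using lin_carrier.refl[OF D.lin, of "content x"] I prec by blast
  qed
  define xs where "xs = sorted_i_nodes e A Y i"
  \<comment> \<open>The choice operator returns a genuinely sorted list, because \<open>prec\<close>
    is linear on these nodes.\<close>
  have xs: "distinct xs" "set xs = ?I" "sorted_wrt (\<lambda>x y. prec e A y x) xs"
    unfolding xs_def sorted_i_nodes_def using someI_ex[OF lin_carrier.ex_sorted[OF lin]] by auto
  have s: "- sgn_at ?h (content x) = (if addable Y x then 1 else -1)" if "x \<in> ?I" for x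
    using that I[of x] inc[of "content x - 1"] unfolding addable_iff[OF Y] sgn_at_def conts_def inner_at_def by auto
  have lin': "lin_carrier (set xs) (\<lambda>x y. prec e A y x)" using lin xs by simp
  have key: "(case filter fst (reduce_word (map (\<lambda>x. (addable Y x, x)) xs)) of [] \<Rightarrow> None | q # _ \<Rightarrow> Some (snd q)) = Some q
     \<longleftrightarrow> good ?I (\<lambda>x y. prec e A x y) (\<lambda>x. - sgn_at ?h (content x)) q" for q
    using reduce_word_first[OF xs(1,3) lin', of "\<lambda>x. - sgn_at ?h (content x)" "addable Y" q] s xs(2) by auto
  have tr: "good ?I (\<lambda>x y. prec e A x y) (\<lambda>x. - sgn_at ?h (content x)) q \<longleftrightarrow> q \<in> ?I \<and> f_good e A i ?h (content q)" for q
  proof -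
    have "good ?I (\<lambda>x y. prec e A x y) (\<lambda>x. - sgn_at ?h (content x)) q \<longleftrightarrow> 
      good ?I (\<lambda>x y. dfct e A ?h (content x) (content y) \<le> 0) (\<lambda>x. - sgn_at ?h (content x)) q"
      by (rule good_cong) (simp_all add: prec)
    moreover have "q \<in> ?I" if "good ?I (\<lambda>x y. prec e A x y) (\<lambda>x. - sgn_at ?h (content x)) q" using that unfolding good_def by simp
    ultimately show ?thesis unfolding f_good_def img[symmetric] 
      using good_image(1)[OF inj, of q "\<lambda>x y. dfct e A ?h x y \<le> 0" "\<lambda>x. - sgn_at ?h x"] by blast
  qed
  have "f_op e A i Y = Some Z \<longleftrightarrow> (\<exists>q. (case filter fst (reduce_word (map (\<lambda>x. (addable Y x, x)) xs)) of [] \<Rightarrow> None | q # _ \<Rightarrow> Some (snd q)) = Some q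
      \<and> Z = insert q Y)"
    unfolding f_op_def i_word_def xs_def[symmetric] by (auto split: list.splits)
  also have "\<dots> \<longleftrightarrow> (\<exists>q. q \<in> ?I \<and> f_good e A i ?h (content q) \<and> Z = insert q Y)" unfolding key tr by blast
  also have "\<dots> \<longleftrightarrow> (\<exists>p. f_good e A i ?h p \<and> Z = insert (node_at ?h p) Y)"
  proof
    assume "\<exists>q. q \<in> ?I \<and> f_good e A i ?h (content q) \<and> Z = insert q Y"
    then show "\<exists>p. f_good e A i ?h p \<and> Z = insert (node_at ?h p) Y" using I by metis
  next
    assume "\<exists>p. f_good e A i ?h p \<and> Z = insert (node_at ?h p) Y"
    then obtain p where p: "f_good e A i ?h p" "Z = insert (node_at ?h p) Y" by blast
    then have "p \<in> conts e i ?h" unfolding f_good_def good_def by blast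
    then show "\<exists>q. q \<in> ?I \<and> f_good e A i ?h (content q) \<and> Z = insert q Y"
      using p cn I by (intro exI[of _ "node_at ?h p"]) auto
  qed
  finally show ?thesis .
qed

section \<open>Regular profiles\<close>

text \<open>The polarity \<open>pl\<close> is true for removing nodes and false for adding
  them.\<close>

definition dpol :: "bool \<Rightarrow> ('a \<Rightarrow> 'a \<Rightarrow> int) \<Rightarrow> 'a \<Rightarrow> 'a \<Rightarrow> int" where
  "dpol pl D x y = (if pl then D x y else D y x)"

definition sgp :: "bool \<Rightarrow> int" where "sgp pl = (if pl then 1 else -1)"

definition good_node :: "bool \<Rightarrow> nat \<Rightarrow> (nat \<Rightarrow> int) \<Rightarrow> nat \<Rightarrow> (int \<Rightarrow> int) \<Rightarrow> int \<Rightarrow> bool" where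
  "good_node pl e A i h p \<longleftrightarrow> good (conts e i h) (\<lambda>x y. dpol pl (dfct e A h) y x \<le> 0) (\<lambda>x. sgp pl * sgn_at h x) p"

definition slen :: "bool \<Rightarrow> nat \<Rightarrow> (nat \<Rightarrow> int) \<Rightarrow> nat \<Rightarrow> (int \<Rightarrow> int) \<Rightarrow> int" where
  "slen pl e A i h = height (conts e i h) (\<lambda>x y. dpol pl (dfct e A h) y x \<le> 0) (\<lambda>x. sgp pl * sgn_at h x)"

definition toggle :: "bool \<Rightarrow> (int \<Rightarrow> int) \<Rightarrow> int \<Rightarrow> int \<Rightarrow> int" where
  "toggle pl h p = h(p := h p - sgp pl)"

lemma f_good_good_node: "f_good e A i h p \<longleftrightarrow> good_node False e A i h p"
  unfolding f_good_def good_node_def dpol_def sgp_def by simp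

lemma defect_order_dpol: "defect_order P D \<Longrightarrow> defect_order P (dpol pl D)"
  using defect_order.defect_order_transpose[of P D] unfolding dpol_def by (cases pl) auto

text \<open>The difference \<open>h x - h y\<close> counts the gaps from \<open>y\<close> up to
  \<open>x\<close>, with \<open>y\<close> itself included; thus arm length \<open>A t\<close>
  corresponds to the value 1 and not 0.\<close>

lemma regular_defect:
  assumes "regular e A h" "0 < e" "x mod int e = y mod int e" "y < x" "h (x + 1) = h x" "h (y + 1) = h y + 1"
  shows "h x - h y - Abar A ((x - y) div int e) \<noteq> 1"
proof
  assume a: "h x - h y - Abar A ((x - y) div int e) = 1"
  have "int e dvd x - y" using assms(3) by (simp only: mod_eq_dvd_iff)
  then obtain t where t: "x - y = int e * t" by blast
  then have d: "(x - y) div int e = t" using assms(2) by simp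
  have "0 < int e * t" using t assms(4) by simp
  then have "0 < t" using assms(2) by (simp add: zero_less_mult_iff)
  then have "1 \<le> nat t" "x - y = int e * int (nat t)" "h x - h y = A (nat t) + 1" using t a d unfolding Abar_def by auto
  then show False using assms(1,5,6) unfolding regular_def by blast
qed

lemma regularI:
  assumes "0 < e" "\<And>x y. \<lbrakk>x mod int e = y mod int e; y < x; h (x + 1) = h x; h (y + 1) = h y + 1;
     h x - h y - Abar A ((x - y) div int e) = 1\<rbrakk> \<Longrightarrow> False"
  shows "regular e A h"
  unfolding regular_def
proof
  assume "\<exists>x y t. 1 \<le> t \<and> x - y = int e * int t \<and> h (x + 1) = h x \<and> h (y + 1) = h y + 1 \<and> h x - h y = A t + 1"
  then obtain x y t where *: "1 \<le> t" "x - y = int e * int t" "h (x + 1) = h x" "h (y + 1) = h y + 1" "h x - h y = A t + 1"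
    by blast
  have "int e dvd x - y" using *(2) by simp
  then have "x mod int e = y mod int e" by (simp only: mod_eq_dvd_iff)
  moreover have "(x - y) div int e = int t" using *(2) assms(1) by simp
  then have "h x - h y - Abar A ((x - y) div int e) = 1" using * unfolding Abar_def by simp
  moreover have "0 < int e * int t" using *(1) assms(1) by simp
  then have "y < x" using *(2) by linarith
  ultimately show False using assms(2) *(3,4) by blast
qed

locale arm =
  fixes e :: nat and A :: "nat \<Rightarrow> int"
  assumes e3: "3 \<le> e" and arm: "arm_seq e A"
begin

abbreviation "cn \<equiv> conts e"
abbreviation "df \<equiv> dfct e A"

definition proper :: "(int \<Rightarrow> int) \<Rightarrow> bool" where
  "proper h \<longleftrightarrow> incr h \<and> far h \<and> regular e A h"

lemma e_pos: "0 < e" using e3 by simp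

lemma proper_incr: "proper h \<Longrightarrow> h y \<le> h (y + 1) \<and> h (y + 1) \<le> h y + 1" unfolding proper_def incr_def by blast

lemma conts_cases: 
  assumes "proper h" "y \<in> cn i h"
  shows "h (y + 1) = h (y - 1) + 1" "y mod int e = int i"
    "sgn_at h y = -1 \<and> h y = h (y - 1) \<or> sgn_at h y = 1 \<and> h y = h (y - 1) + 1"
  using assms(2) proper_incr[OF assms(1), of y] proper_incr[OF assms(1), of "y - 1"] unfolding conts_def sgn_at_def by auto

lemma order: "proper h \<Longrightarrow> defect_order (cn i h) (df h)"
  by (rule defect_order_defect[OF arm e_pos conts_finite, where i = "int i"]) (auto simp: proper_def conts_def)

lemma lin_conts: "proper h \<Longrightarrow> lin_carrier (cn i h) (\<lambda>x y. dpol pl (df h) y x \<le> 0)"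
  using defect_order.lin[OF defect_order_dpol[OF order]] .

lemma mod_far:
  assumes "(x::int) mod int e = y mod int e" "x < y" shows "x + 3 \<le> y"
proof -
  have "int e dvd y - x" using assms(1)[symmetric] by (simp only: mod_eq_dvd_iff)
  then have "int e \<le> y - x" using assms(2) by (intro zdvd_imp_le) auto
  then show ?thesis using e3 by linarith
qed

lemma mod_shift: "x mod int e = y mod int e \<Longrightarrow> (x + c) mod int e = (y + c) mod int e"
  by (rule mod_add_cong) auto

text \<open>Hence an addable node cancelling a removable one has defect at least 2: a defect of 1 is
  a forbidden hook, on the abacus positions \<open>x - 1\<close>, \<open>z - 1\<close> if \<open>z <
  x\<close> and on \<open>z\<close>, \<open>x\<close> otherwise.\<close>

lemma defect_not_one:
  assumes h: "proper h" and x: "x \<in> cn i h" "sgn_at h x = -1" and z: "z \<in> cn i h" "sgn_at h z = 1"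
  shows "df h x z \<noteq> 1"
proof
  assume d: "df h x z = 1"
  interpret defect_order "cn i h" "df h" by (rule order[OF h])
  have xz: "x \<noteq> z" using x z by auto
  have m: "x mod int e = z mod int e" using conts_cases(2)[OF h] x z by auto
  have x': "h x = h (x - 1)" "h (x + 1) = h x + 1" using conts_cases[OF h x(1)] x by auto
  have z': "h z = h (z - 1) + 1" "h (z + 1) = h z" using conts_cases[OF h z(1)] z by auto
  have r: "regular e A h" using h unfolding proper_def by simp
  show False
  proof (cases "z < x")
    case True
    then show False using regular_defect[OF r e_pos, of "x - 1" "z - 1"] mod_shift[OF m, of "-1"] x' z' d
      unfolding defect_def by simp
  next
    case False
    have "df h z x = 0" using d D_sym[OF x(1) z(1) xz] by simp
    then show False using regular_defect[OF r e_pos m[symmetric]] False xz x' z' unfolding defect_def by auto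
  qed
qed

text \<open>A removable \<open>z\<close> lies strictly between \<open>b\<close> and
  \<open>x\<close>. Near-additivity bounds the sum of the two positive defects by 2, so the addable
  \<open>x\<close> and the removable \<open>z\<close> have defect 1, which is excluded.\<close>

lemma no_unit_f:
  assumes h: "proper h" and b: "good_node False e A i h b" and x: "x \<in> cn i h" "sgn_at h x = -1" and d: "df h x b = 1"
  shows False
proof -
  interpret defect_order "cn i h" "df h" by (rule order[OF h])
  interpret L: lin_carrier "cn i h" "\<lambda>x y. dpol False (df h) y x \<le> 0" by (rule lin_conts[OF h])
  note b' = b[unfolded good_node_def]
  have bc: "b \<in> cn i h" using b' unfolding good_def by simp
  obtain z where z: "z \<in> cn i h" "df h z b \<ge> 1" "df h x z \<ge> 1" "sgn_at h z > 0"
    using L.between[OF b' x(1)] d x unfolding dpol_def sgp_def by force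
  then have "df h x z = 1" using D_tri'[OF x(1) z(1) bc] d by simp
  moreover have "sgn_at h z = 1" using conts_cases(3)[OF h z(1)] z(4) by auto
  ultimately show False using defect_not_one[OF h x z(1)] by simp
qed

lemma no_unit_e:
  assumes h: "proper h" and b: "good_node True e A i h b" and x: "x \<in> cn i h" "sgn_at h x = 1" and d: "df h b x = 1"
  shows False
proof -
  interpret defect_order "cn i h" "df h" by (rule order[OF h])
  interpret L: lin_carrier "cn i h" "\<lambda>x y. dpol True (df h) y x \<le> 0" by (rule lin_conts[OF h])
  note b' = b[unfolded good_node_def]
  have bc: "b \<in> cn i h" using b' unfolding good_def by simp
  obtain z where z: "z \<in> cn i h" "df h b z \<ge> 1" "df h z x \<ge> 1" "sgn_at h z < 0"
    using L.between[OF b' x(1)] d x unfolding dpol_def sgp_def by force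
  then have "df h z x = 1" using D_tri'[OF bc z(1) x(1)] d by simp
  moreover have "sgn_at h z = -1" using conts_cases(3)[OF h z(1)] z(4) by auto
  ultimately show False using defect_not_one[OF h z(1) _ x] by simp
qed

lemma good_node_D:
  assumes h: "proper h" and b: "good_node pl e A i h b"
  shows "b \<in> cn i h" "sgn_at h b = sgp pl"
proof -
  show bc: "b \<in> cn i h" using b unfolding good_node_def good_def by simp
  show "sgn_at h b = sgp pl"
    using lin_carrier.good_sign[OF lin_conts[OF h] b[unfolded good_node_def]] conts_cases(3)[OF h bc] unfolding sgp_def by auto
qed

section \<open>Regular profiles are closed under the operators\<close>

lemma far_upd: "far h \<Longrightarrow> far (h(b := c))"
proof -
  assume "far h"
  then obtain n where n: "0 \<le> n" "\<forall>y. n \<le> \<bar>y\<bar> \<longrightarrow> h y = max 0 y" unfolding far_def by blast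
  then have "0 \<le> max n (\<bar>b\<bar> + 1)" "\<forall>y. max n (\<bar>b\<bar> + 1) \<le> \<bar>y\<bar> \<longrightarrow> (h(b := c)) y = max 0 y" by auto
  then show ?thesis unfolding far_def by blast
qed

lemma incr_upd:
  assumes "incr h" "h (b - 1) \<le> c" "c \<le> h (b - 1) + 1" "c \<le> h (b + 1)" "h (b + 1) \<le> c + 1"
  shows "incr (h(b := c))"
  unfolding incr_def
proof
  fix y
  have "h y \<le> h (y + 1)" "h (y + 1) \<le> h y + 1" using assms(1) unfolding incr_def by auto
  then show "(h(b := c)) y \<le> (h(b := c)) (y + 1) \<and> (h(b := c)) (y + 1) \<le> (h(b := c)) y + 1"
    using assms by (cases "y = b"; cases "y + 1 = b") auto
qed

text \<open>The bead moves from \<open>b - 1\<close> to \<open>b\<close>, so a new forbidden hook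
  has its bead at \<open>b\<close> or its gap at \<open>b - 1\<close>. Inspecting the position next
  to its other end, either the hook shifted by one was already forbidden in \<open>h\<close>, or an
  addable node has defect 1 relative to \<open>b\<close>.\<close>

lemma closed_f:
  assumes h: "proper h" and b: "good_node False e A i h b" shows "proper (h(b := h b + 1))"
proof -
  let ?h = "h(b := h b + 1)"
  have bc: "b \<in> cn i h" "sgn_at h b = -1" using good_node_D[OF h b] by (auto simp: sgp_def)
  have hb: "h b = h (b - 1)" "h (b + 1) = h b + 1" using conts_cases[OF h bc(1)] bc by auto
  have bm: "b mod int e = int i" using conts_cases(2)[OF h bc(1)] .
  have r: "regular e A h" using h unfolding proper_def by simp
  interpret defect_order "cn i h" "df h" by (rule order[OF h])
  have "regular e A ?h"
  proof (rule regularI[OF e_pos])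
    fix x y assume m: "x mod int e = y mod int e" and yx: "y < x" and bead: "?h (x + 1) = ?h x" and gap: "?h (y + 1) = ?h y + 1"
      and d: "?h x - ?h y - Abar A ((x - y) div int e) = 1"
    note f = mod_far[OF m[symmetric] yx]
    have yb: "y \<noteq> b" and xb: "x \<noteq> b - 1" using gap bead hb by (auto split: if_splits)
    note incy = proper_incr[OF h, of "y - 1"] and incx = proper_incr[OF h, of "x + 1"]
    consider "x = b" | "y = b - 1" | "x \<noteq> b" "y \<noteq> b - 1" by blast
    then show False
    proof cases
      case 1
      have y: "h (y + 1) = h y + 1" "h b - h y = Abar A ((b - y) div int e)" using 1 f gap d by auto
      show False
      proof (cases "h (y - 1) = h y")
        case True
        have yc: "y \<in> cn i h" "sgn_at h y = -1" using True y m bm 1 unfolding conts_def sgn_at_def by auto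
        have "df h b y = 0" using True hb y unfolding defect_def by simp
        then have "df h y b = 1" using D_sym[OF bc(1) yc(1)] f 1 by simp
        then show False using no_unit_f[OF h b yc] by simp
      next
        case False
        then show False using regular_defect[OF r e_pos, of "b - 1" "y - 1"] incy mod_shift[OF m, of "-1"] 1 yx hb y by auto
      qed
    next
      case 2
      have x: "h (x + 1) = h x" "h x - h (b - 1) - Abar A ((x - (b - 1)) div int e) = 1" using 2 f bead d by auto
      have m': "(x + 1) mod int e = b mod int e" using mod_shift[OF m, of 1] 2 by simp
      show False
      proof (cases "h (x + 1 + 1) = h (x + 1)")
        case True
        then show False using regular_defect[OF r e_pos m'] 2 yx x hb by (simp add: algebra_simps)
      next
        case False
        then have xc: "x + 1 \<in> cn i h" "sgn_at h (x + 1) = -1" 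
          using incx x m' bm unfolding conts_def sgn_at_def by (auto simp: algebra_simps)
        have "df h (x + 1) b = 1" using x unfolding defect_def by (simp add: algebra_simps)
        then show False using no_unit_f[OF h b xc] by simp
      qed
    next
      case 3
      then show False using regular_defect[OF r e_pos m yx] yb xb bead gap d by (auto split: if_splits)
    qed
  qed
  then show ?thesis using h far_upd incr_upd[of h b "h b + 1"] hb unfolding proper_def by auto
qed

text \<open>Mirror image of \<open>closed_f\<close>: a new hook has its bead at \<open>b - 1\<close>
  or its gap at \<open>b\<close>, and the competing node is removable.\<close>

lemma closed_e:
  assumes h: "proper h" and b: "good_node True e A i h b" shows "proper (h(b := h b - 1))"
proof -
  let ?h = "h(b := h b - 1)"
  have bc: "b \<in> cn i h" "sgn_at h b = 1" using good_node_D[OF h b] by (auto simp: sgp_def)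
  have hb: "h b = h (b - 1) + 1" "h (b + 1) = h b" using conts_cases[OF h bc(1)] bc by auto
  have bm: "b mod int e = int i" using conts_cases(2)[OF h bc(1)] .
  have r: "regular e A h" using h unfolding proper_def by simp
  interpret defect_order "cn i h" "df h" by (rule order[OF h])
  have "regular e A ?h"
  proof (rule regularI[OF e_pos])
    fix x y assume m: "x mod int e = y mod int e" and yx: "y < x" and bead: "?h (x + 1) = ?h x" and gap: "?h (y + 1) = ?h y + 1"
      and d: "?h x - ?h y - Abar A ((x - y) div int e) = 1"
    note f = mod_far[OF m[symmetric] yx]
    have yb: "y \<noteq> b - 1" and xb: "x \<noteq> b" using gap bead hb by (auto split: if_splits)
    note incy = proper_incr[OF h, of "y + 1"] and incx = proper_incr[OF h, of "x - 1"]
    consider "x = b - 1" | "y = b" | "x \<noteq> b - 1" "y \<noteq> b" by blast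
    then show False
    proof cases
      case 1
      have y: "h (y + 1) = h y + 1" "h (b - 1) - h y - Abar A ((b - 1 - y) div int e) = 1" using 1 f gap d by auto
      have m': "b mod int e = (y + 1) mod int e" using mod_shift[OF m, of 1] 1 by simp
      show False
      proof (cases "h (y + 1 + 1) = h (y + 1)")
        case True
        have yc: "y + 1 \<in> cn i h" "sgn_at h (y + 1) = 1" using True y m' bm unfolding conts_def sgn_at_def by auto
        have "df h b (y + 1) = 1" using y unfolding defect_def by (simp add: algebra_simps)
        then show False using no_unit_e[OF h b yc] by simp
      next
        case False
        then show False using regular_defect[OF r e_pos m'] incy 1 yx hb y by (simp add: algebra_simps)
      qed
    next
      case 2
      have x: "h (x + 1) = h x" "h x - h b = Abar A ((x - b) div int e)" using 2 f bead d by auto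
      show False
      proof (cases "h (x - 1) = h x")
        case True
        then show False using regular_defect[OF r e_pos, of "x - 1" "b - 1"] mod_shift[OF m, of "-1"] 2 yx x hb by auto
      next
        case False
        then have xc: "x \<in> cn i h" "sgn_at h x = 1" 
          using incx x m bm 2 unfolding conts_def sgn_at_def by auto
        have "df h x b = 0" using False incx x hb unfolding defect_def by simp
        then have "df h b x = 1" using D_sym[OF bc(1) xc(1)] f 2 by simp
        then show False using no_unit_e[OF h b xc] by simp
      qed
    next
      case 3
      then show False using regular_defect[OF r e_pos m yx] yb xb bead gap d by (auto split: if_splits)
    qed
  qed
  then show ?thesis using h far_upd incr_upd[of h b "h b - 1"] hb unfolding proper_def by auto
qed

lemma proper_toggle: "\<lbrakk>proper h; good_node pl e A i h p\<rbrakk> \<Longrightarrow> proper (toggle pl h p)"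
  using closed_e closed_f by (cases pl) (auto simp: toggle_def sgp_def)

text \<open>The Cartan pattern position by position: the sign at \<open>p\<close> is reversed, each
  neighbour moves by one, and all other positions are unaffected.\<close>

lemma sgn_toggle:
  assumes h: "proper h" and p: "good_node pl e A i h p"
  shows "sgn_at (toggle pl h p) y = sgn_at h y + sgp pl * (if y = p then -2 else if y = p + 1 \<or> y = p - 1 then 1 else 0)"
proof -
  note pc = good_node_D[OF h p] and hp = conts_cases[OF h good_node_D(1)[OF h p]]
  note i = proper_incr[OF h, of "p + 1"] proper_incr[OF h, of "p - 2"]
  have c: "p + 1 + 1 = p + 2" "p - 2 + 1 = p - 1" "p - 1 - 1 = p - 2" by simp_all
  consider "y = p" | "y = p + 1" | "y = p - 1" | "y \<noteq> p" "y \<noteq> p + 1" "y \<noteq> p - 1" by blast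
  then show ?thesis
  proof cases
    case 1
    then show ?thesis using pc hp by (cases pl) (auto simp: sgn_at_def toggle_def sgp_def)
  next
    case 2
    then show ?thesis using pc hp i(1) by (cases pl) (auto simp: sgn_at_def toggle_def sgp_def c)
  next
    case 3
    then show ?thesis using pc hp i(2) unfolding c by (cases pl) (auto simp: sgn_at_def toggle_def sgp_def c)
  next
    case 4
    then show ?thesis by (auto simp: sgn_at_def toggle_def)
  qed
qed

lemma conts_sgn: "proper h \<Longrightarrow> y \<in> cn i h \<longleftrightarrow> y mod int e = int i \<and> sgn_at h y \<noteq> 0"
  unfolding conts_def sgn_at_def by auto

end

definition adjE :: "nat \<Rightarrow> nat \<Rightarrow> nat \<Rightarrow> bool" where
  "adjE e i k \<longleftrightarrow> i < e \<and> k < e \<and> (k = (i + 1) mod e \<or> i = (k + 1) mod e)"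

definition cartE :: "nat \<Rightarrow> nat \<Rightarrow> nat \<Rightarrow> int" where
  "cartE e i k = (if i = k then 2 else if adjE e i k then -1 else 0)"

lemma ex_maximal:
  fixes f :: "'a \<Rightarrow> 'b :: linorder"
  assumes "finite arrow" "arrow \<noteq> {}" shows "\<exists>x\<in>arrow. \<forall>y\<in>arrow. f y \<le> f x"
proof -
  have "Max (f ` arrow) \<in> f ` arrow" using assms by (intro Max_in) auto
  then obtain x where "x \<in> arrow" "f x = Max (f ` arrow)" by auto
  then show ?thesis using assms by (intro bexI[of _ x]) auto
qed

section \<open>Vertices, ranks and the unique source\<close>

context arm
begin

definition V :: "(int \<Rightarrow> int) set" where "V = prof ` {Y. A_regular e A Y}"
definition rk :: "(int \<Rightarrow> int) \<Rightarrow> nat" where "rk h = card (inv_into {Y. A_regular e A Y} prof h)"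

lemma A_reg_proper: "A_regular e A Y \<longleftrightarrow> young Y \<and> proper (prof Y)"
  unfolding A_regular_iff[OF arm] proper_def using prof_incr prof_far by (auto simp: far_def)

lemma V_proper: "h \<in> V \<Longrightarrow> proper h" unfolding V_def using A_reg_proper by auto

lemma prof_inj_on: "inj_on prof {Y. A_regular e A Y}"
  by (rule inj_onI) (use A_reg_proper prof_inj in auto)

lemma rk_prof: "A_regular e A Y \<Longrightarrow> rk (prof Y) = card Y"
  unfolding rk_def using prof_inj_on by (simp add: inv_into_f_f)

lemma inner_outer:
  assumes "proper h" "good_node pl e A i h p" shows "if pl then outer_at h p else inner_at h p"
  using good_node_D[OF assms] conts_cases[OF assms(1) good_node_D(1)[OF assms]] unfolding inner_at_def outer_at_def sgp_def by auto

lemma up_Y: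
  assumes Y: "A_regular e A Y" and p: "good_node False e A i (prof Y) p"
  shows "node_at (prof Y) p \<notin> Y" "A_regular e A (insert (node_at (prof Y) p) Y)"
    "prof (insert (node_at (prof Y) p) Y) = toggle False (prof Y) p"
proof -
  have y: "young Y" and proper: "proper (prof Y)" using Y A_reg_proper by auto
  have c: "inner_at (prof Y) p" using inner_outer[OF proper p] by simp
  have content: "content (node_at (prof Y) p) = p" using c by (intro content_node_at) (simp_all add: prof_ge del: max.bounded_iff)
  have a: "addable Y (node_at (prof Y) p)" using addable_iff[OF y, of "node_at (prof Y) p"] c content by simp
  then show n: "node_at (prof Y) p \<notin> Y" unfolding addable_def by simp
  show pr: "prof (insert (node_at (prof Y) p) Y) = toggle False (prof Y) p"
    using prof_insert[OF young_fin[OF y] n] content by (simp add: toggle_def sgp_def)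
  show "A_regular e A (insert (node_at (prof Y) p) Y)"
    using a proper_toggle[OF proper p] unfolding A_reg_proper pr addable_def by simp
qed

lemma down_Y:
  assumes Y: "A_regular e A Y" and p: "good_node True e A i (prof Y) p"
  shows "node_at (prof Y) p \<in> Y" "A_regular e A (Y - {node_at (prof Y) p})"
    "prof (Y - {node_at (prof Y) p}) = toggle True (prof Y) p"
proof -
  have y: "young Y" and proper: "proper (prof Y)" using Y A_reg_proper by auto
  have c: "outer_at (prof Y) p" using inner_outer[OF proper p] by simp
  have content: "content (node_at (prof Y) p) = p" using c by (intro content_node_at) (simp_all add: prof_ge del: max.bounded_iff)
  let ?Z = "Y - {node_at (prof Y) p}"
  have a: "removable Y (node_at (prof Y) p)" using removable_iff[OF y, of "node_at (prof Y) p"] c content by simp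
  then show n: "node_at (prof Y) p \<in> Y" unfolding removable_def by simp
  have z: "young ?Z" using a unfolding removable_def by simp
  have "prof Y = (prof ?Z)(p := prof ?Z p + 1)"
    using prof_insert[OF young_fin[OF z], of "node_at (prof Y) p"] n content by (simp add: insert_absorb)
  then show pr: "prof ?Z = toggle True (prof Y) p" unfolding toggle_def sgp_def by (metis add_diff_cancel_right' fun_upd_same fun_upd_triv fun_upd_upd)
  show "A_regular e A ?Z"
    using z proper_toggle[OF proper p] unfolding A_reg_proper pr by simp
qed

lemma V_toggle:
  assumes h: "h \<in> V" and p: "good_node pl e A i h p"
  shows "toggle pl h p \<in> V" "if pl then rk h = Suc (rk (toggle pl h p)) else rk (toggle pl h p) = Suc (rk h)"
proof -
  obtain Y where Y: "A_regular e A Y" "h = prof Y" using h unfolding V_def by auto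
  have f: "finite Y" using Y(1) A_reg_proper young_fin by blast
  have "toggle pl h p \<in> V \<and> (if pl then rk h = Suc (rk (toggle pl h p)) else rk (toggle pl h p) = Suc (rk h))"
  proof (cases pl)
    case True
    then have pT: "good_node True e A i (prof Y) p" using p Y(2) by simp
    note d = down_Y[OF Y(1) pT]
    have "rk h = card Y" "rk (toggle True h p) = card (Y - {node_at (prof Y) p})"
      using rk_prof[OF Y(1)] rk_prof[OF d(2)] d(3) Y(2) by auto
    then show ?thesis using imageI[of "Y - {node_at (prof Y) p}" "{Y. A_regular e A Y}" prof] d True Y(2) card_Suc_Diff1[OF f d(1)]
      unfolding V_def by simp
  next
    case False
    then have pF: "good_node False e A i (prof Y) p" using p Y(2) by simp
    note d = up_Y[OF Y(1) pF]
    have "rk h = card Y" "rk (toggle False h p) = card (insert (node_at (prof Y) p) Y)"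
      using rk_prof[OF Y(1)] rk_prof[OF d(2)] d(3) Y(2) by auto
    then show ?thesis using imageI[of "insert (node_at (prof Y) p) Y" "{Y. A_regular e A Y}" prof] d f False Y(2)
      unfolding V_def by simp
  qed
  then show "toggle pl h p \<in> V" "if pl then rk h = Suc (rk (toggle pl h p)) else rk (toggle pl h p) = Suc (rk h)" by auto
qed

lemma proper_empty: "proper (prof {})"
proof -
  have P: "prof {} = (\<lambda>y. max 0 y)" unfolding prof_def by (rule ext) simp
  have "regular e A (prof {})"
  proof (rule regularI[OF e_pos])
    fix x y assume "y < x" "prof {} (x + 1) = prof {} x" "prof {} (y + 1) = prof {} y + 1"
    then show False unfolding P by auto
  qed
  then show ?thesis unfolding proper_def incr_def far_def P by (auto intro: exI[of _ 0])
qed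

text \<open>The number \<alpha> is the supremum of \<open>A t / t\<close>. Estimating
  \<open>A (t * u)\<close> from below by blocks of length \<open>t\<close> and from above by blocks
  of length \<open>u\<close> gives \<open>A t / t \<le> (A u + 1) / u\<close>, so \<alpha> is also
  below every right-hand side. Negative arguments restate that \<alpha> is an upper bound.\<close>

lemma slope: "\<exists>\<alpha>::real. 0 < \<alpha> \<and> \<alpha> < real e \<and> (\<forall>t. \<alpha> * real_of_int t \<le> real_of_int (Abar A t + 1))"
proof -
  have A1: "int t - 1 \<le> A t" "A t \<le> (int e - 1) * int t" if "1 \<le> t" for t using arm that unfolding arm_seq_def by auto
  have Aadd: "A (t + u) = A t + A u \<or> A (t + u) = A t + A u + 1" if "1 \<le> t" "1 \<le> u" for t u
    using arm that unfolding arm_seq_def by blast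
  have lo: "int u * A t \<le> A (u * t)" if "1 \<le> t" "1 \<le> u" for t u
    using that(2)
  proof (induction rule: dec_induct)
    case (step n)
    have "1 \<le> n * t" using step that by simp
    then have "A t + A (n * t) \<le> A (t + n * t)" using Aadd[of t "n * t"] that by auto
    then show ?case using step by (simp add: algebra_simps)
  qed simp
  have hi: "A (u * t) + 1 \<le> int u * (A t + 1)" if "1 \<le> t" "1 \<le> u" for t u
    using that(2)
  proof (induction rule: dec_induct)
    case (step n)
    have "1 \<le> n * t" using step that by simp
    then have "A (t + n * t) \<le> A t + A (n * t) + 1" using Aadd[of t "n * t"] that by auto
    then show ?case using step by (simp add: algebra_simps)
  qed simp
  define f where "f t = real_of_int (A t) / real t" for t
  have cross: "f t \<le> real_of_int (A u + 1) / real u" if "1 \<le> t" "1 \<le> u" for t u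
  proof -
    have "int u * A t \<le> int t * (A u + 1)" using lo[OF that] hi[OF that(2,1)] by (simp add: mult.commute)
    then have "real_of_int (int u * A t) \<le> real_of_int (int t * (A u + 1))" by (simp only: of_int_le_iff)
    then show ?thesis using that unfolding f_def by (simp add: field_simps)
  qed
  define \<alpha> where "\<alpha> = Sup (f ` {1..})"
  have bdd: "bdd_above (f ` {1..})" using cross[of _ 1] by (intro bdd_aboveI[of _ "real_of_int (A 1 + 1)"]) auto
  have up: "\<alpha> \<le> real_of_int (A u + 1) / real u" if "1 \<le> u" for u
    unfolding \<alpha>_def using cross that by (intro cSup_least) auto
  have low: "f t \<le> \<alpha>" if "1 \<le> t" for t
    unfolding \<alpha>_def using bdd that by (intro cSup_upper) auto
  show ?thesis
  proof (intro exI[of _ \<alpha>] conjI allI)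
    \<comment> \<open>At \<open>t = 1\<close> the lower bound only gives 0; positivity of \<alpha>
      comes from \<open>A 2 \<ge> 1\<close>.\<close>
    have "1 / 2 \<le> f 2" using A1(1)[of 2] unfolding f_def by auto
    then show "0 < \<alpha>" using low[of 2] by auto
    have "f t \<le> real e - 1" if "1 \<le> t" for t
    proof -
      have "real_of_int (A t) \<le> real_of_int ((int e - 1) * int t)" using A1(2)[OF that] by (simp only: of_int_le_iff)
      then show ?thesis using that unfolding f_def by (simp add: field_simps)
    qed
    then have "\<alpha> \<le> real e - 1" unfolding \<alpha>_def by (intro cSup_least) auto
    then show "\<alpha> < real e" by simp
    fix t :: int
    consider "t = 0" | "0 < t" | "t < 0" by linarith
    then show "\<alpha> * real_of_int t \<le> real_of_int (Abar A t + 1)"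
    proof cases
      case 1 then show ?thesis by (simp add: Abar_def)
    next
      case 2
      then show ?thesis using up[of "nat t"] by (simp add: Abar_def field_simps)
    next
      case 3
      then show ?thesis using low[of "nat (- t)"] by (simp add: Abar_def f_def field_simps)
    qed
  qed
qed

text \<open>Follow the rising run from the gap at \<open>x\<close> to the right up to the first
  bead; \<open>h\<close> grows by 1 at every step.\<close>

lemma first_outer:
  assumes h: "proper h" and x: "h (x + 1) = h x + 1" and z: "h (z + 1) = h z" "x < z"
  shows "\<exists>w. h (w - 1) = h w - 1 \<and> h (w + 1) = h w \<and> x < w \<and> h w = h x + (w - x)"
proof -
  define Q where "Q n \<longleftrightarrow> h (x + 1 + int n + 1) = h (x + 1 + int n)" for n
  define n where "n = (LEAST n. Q n)"
  have ex: "Q (nat (z - x - 1))" unfolding Q_def using z by simp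
  have n: "h (x + 1 + int n + 1) = h (x + 1 + int n)" using LeastI[of Q, OF ex, folded n_def] unfolding Q_def .
  have l: "h (x + 1 + int m + 1) = h (x + 1 + int m) + 1" if "m < n" for m
    using not_less_Least[of m Q] that[unfolded n_def] proper_incr[OF h, of "x + 1 + int m"] unfolding Q_def by auto
  have g: "m \<le> n \<Longrightarrow> h (x + 1 + int m) = h x + 1 + int m" for m
  proof (induction m)
    case (Suc m)
    then show ?case using l[of m] by (simp add: algebra_simps)
  qed (use x in simp)
  have "h (x + 1 + int n - 1) = h (x + 1 + int n) - 1"
  proof (cases n)
    case 0 then show ?thesis using x by simp
  next
    case (Suc m) then show ?thesis using g[of m] g[of n] by (simp add: algebra_simps)
  qed
  then show ?thesis using n g[of n] by (intro exI[of _ "x + 1 + int n"]) auto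
qed

text \<open>Follow the flat run from the bead at \<open>x - 1\<close> to the left down to the first
  gap met; \<open>h\<close> is constant on the way.\<close>

lemma last_outer:
  assumes h: "proper h" and x: "h (x - 1) = h x" and z: "h (z - 1) = h z - 1" "z < x"
  shows "\<exists>w. h (w - 1) = h w - 1 \<and> h (w + 1) = h w \<and> w < x \<and> h w = h x"
proof -
  define Q where "Q n \<longleftrightarrow> h (x - 1 - int n - 1) = h (x - 1 - int n) - 1" for n
  define n where "n = (LEAST n. Q n)"
  have ex: "Q (nat (x - z - 1))" unfolding Q_def using z by simp
  have n: "h (x - 1 - int n - 1) = h (x - 1 - int n) - 1" using LeastI[of Q, OF ex, folded n_def] unfolding Q_def .
  have l: "h (x - 1 - int m - 1) = h (x - 1 - int m)" if "m < n" for m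
  proof -
    have "\<not> h (x - 1 - int m - 1) = h (x - 1 - int m) - 1"
      using not_less_Least[of m Q] that[unfolded n_def] unfolding Q_def by blast
    then show ?thesis using proper_incr[OF h, of "x - 1 - int m - 1", unfolded diff_add_cancel] by linarith
  qed
  have g: "m \<le> n \<Longrightarrow> h (x - 1 - int m) = h x" for m
  proof (induction m)
    case (Suc m)
    then show ?case using l[of m] by (simp add: algebra_simps)
  qed (use x in simp)
  have "h (x - 1 - int n + 1) = h (x - 1 - int n)"
  proof (cases n)
    case 0 then show ?thesis using x by simp
  next
    case (Suc m) then show ?thesis using g[of m] g[of n] by (simp add: algebra_simps)
  qed
  then show ?thesis using n g[of n] by (intro exI[of _ "x - 1 - int n"]) auto
qed

lemma ex_outer:
  assumes Y: "young Y" "Y \<noteq> {}" shows "\<exists>y. outer_at (prof Y) y"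
proof -
  have f: "finite Y" using young_fin[OF Y(1)] .
  obtain x where xY: "x \<in> Y" and xm: "\<And>z. z \<in> Y \<Longrightarrow> fst z + snd z \<le> fst x + snd x"
    using ex_maximal[OF f Y(2), of "\<lambda>x. fst x + snd x"] by auto
  obtain r c where rc: "x = (r, c)" by force
  have p: "1 \<le> r" "1 \<le> c" using young_pos[OF Y(1)] xY rc by auto
  have n: "(Suc r, c) \<notin> Y" "(r, Suc c) \<notin> Y" using xm[of "(Suc r, c)"] xm[of "(r, Suc c)"] rc by auto
  define y where "y = int c - int r"
  have e: "int c - int r = y" "int c - int (Suc r) = y - 1" "int (Suc c) - int r = y + 1" unfolding y_def by auto
  have "int c \<le> prof Y y" "\<not> int c \<le> prof Y (y - 1)" "\<not> int (Suc c) \<le> prof Y (y + 1)"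
    using mem_prof'[OF Y(1) e(1) p] mem_prof'[OF Y(1) e(2) _ p(2)] mem_prof'[OF Y(1) e(3) p(1)] xY rc n by auto
  moreover have "prof Y (y - 1) \<le> prof Y y" "prof Y y \<le> prof Y (y - 1) + 1" "prof Y y \<le> prof Y (y + 1)"
    using prof_incr[OF Y(1)] unfolding incr_def by (metis diff_add_cancel)+
  ultimately have "outer_at (prof Y) y" unfolding outer_at_def by auto
  then show ?thesis ..
qed

text \<open>With \<open>\<alpha>\<close> the slope of the arm sequence, a removable node maximising
  \<open>h y - \<alpha> y / e\<close> cannot be cancelled: an addable node cancelling it would lie at least as high,
  and climbing from there in the direction of the removable node meets a higher one.\<close>

lemma source:
  assumes h: "h \<in> V" "h \<noteq> prof {}"
  shows "\<exists>i p. i < e \<and> good_node True e A i h p"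
proof (rule ccontr)
  assume none: "\<not> ?thesis"
  obtain Y where Y: "A_regular e A Y" "h = prof Y" using h unfolding V_def by auto
  have proper: "proper h" using V_proper h by simp
  obtain \<alpha> :: real where \<alpha>: "0 < \<alpha>" "\<alpha> < real e" "\<And>t. \<alpha> * real_of_int t \<le> real_of_int (Abar A t + 1)" using slope by blast
  define v where "v y = real_of_int (h y) - \<alpha> * real_of_int y / real e" for y
  let ?O = "{y. outer_at h y}"
  have yY: "young Y" "Y \<noteq> {}" using Y A_reg_proper h by auto
  have ne: "?O \<noteq> {}" using ex_outer[OF yY] Y by auto
  have "finite ?O"
  proof -
    have "?O \<subseteq> (\<Union>i<e. cn i h)"
    proof
      fix y assume "y \<in> ?O"
      then have "y \<in> cn (nat (y mod int e)) h" "nat (y mod int e) < e" using e_pos unfolding conts_def outer_at_def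
        by (auto simp: nat_less_iff)
      then show "y \<in> (\<Union>i<e. cn i h)" by blast
    qed
    moreover have "finite (\<Union>i<e. cn i h)" using conts_finite proper unfolding proper_def by auto
    ultimately show ?thesis by (rule finite_subset)
  qed
  then obtain z where z: "outer_at h z" "\<And>y. outer_at h y \<Longrightarrow> v y \<le> v z"
    using ex_maximal[OF _ ne, of v] by auto
  define i where "i = nat (z mod int e)"
  have ie: "i < e" "z mod int e = int i" using e_pos unfolding i_def by (auto simp: nat_less_iff)
  have zc: "z \<in> cn i h" "sgn_at h z = 1" using z(1) ie unfolding conts_def outer_at_def sgn_at_def by auto
  interpret L: lin_carrier "cn i h" "\<lambda>x y. dpol True (df h) y x \<le> 0" by (rule lin_conts[OF proper])
  let ?s = "\<lambda>x. sgp True * sgn_at h x"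
  let ?le = "\<lambda>x y. dpol True (df h) y x \<le> 0"
  \<comment> \<open>Without a good node the prefix sum at \<open>z\<close> is at most 0 although
    \<open>z\<close> contributes 1, so some earlier sign is negative.\<close>
  have "height (cn i h) ?le ?s = 0"
    using L.ex_good[of ?s] none ie(1) L.height_nonneg[of ?s] unfolding good_node_def by force
  then have "psum (cn i h) ?le ?s z \<le> 0" using L.psum_le_height[OF zc(1), of ?s] by simp
  then have "(\<Sum>y\<in>{y\<in>cn i h. ?le y z \<and> y \<noteq> z}. ?s y) < 0" using L.psum_split[OF zc(1), of ?s] zc(2) by (simp add: sgp_def)
  then obtain x where x: "x \<in> cn i h" "?le x z" "x \<noteq> z" "?s x < 0"
    by (smt (verit, ccfv_SIG) mem_Collect_eq sum_nonneg)
  then have xs: "sgn_at h x = -1" using conts_cases(3)[OF proper x(1)] by (auto simp: sgp_def)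
  interpret D: defect_order "cn i h" "df h" by (rule order[OF proper])
  have "df h x z \<ge> 1" using x(2,3) D.D_sym[OF x(1) zc(1)] unfolding dpol_def by simp
  \<comment> \<open>Excluding the value 1 improves \<open>Abar A t\<close> to
    \<open>Abar A t + 1\<close> in the estimate below, exactly what \<open>slope\<close> compares
    with.\<close>
  then have d2: "df h x z \<ge> 2" using defect_not_one[OF proper x(1) xs zc] by simp
  have xh: "h (x - 1) = h x" "h (x + 1) = h x + 1" using conts_cases[OF proper x(1)] xs by auto
  have zh: "h (z - 1) = h z - 1" "h (z + 1) = h z" using z(1) unfolding outer_at_def by auto
  define t where "t = (x - z) div int e"
  have "int e dvd x - z" using conts_cases(2)[OF proper x(1)] ie(2) by (simp only: mod_eq_dvd_iff[symmetric])
  then have t: "x - z = int e * t" unfolding t_def by simp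
  have "h x - h z \<ge> Abar A t + 1" using d2 xh zh unfolding defect_def t_def by simp
  then have "real_of_int (h x - h z) \<ge> real_of_int (Abar A t + 1)" by (simp only: of_int_le_iff)
  then have "real_of_int (h x) - real_of_int (h z) \<ge> \<alpha> * real_of_int t" using \<alpha>(3)[of t] by simp
  moreover have "real_of_int x - real_of_int z = real e * real_of_int t"
    using t by (metis of_int_diff of_int_mult of_int_of_nat_eq)
  then have "\<alpha> * real_of_int x / real e - \<alpha> * real_of_int z / real e = \<alpha> * real_of_int t"
    using e_pos by (simp add: field_simps)
  ultimately have vx: "v z \<le> v x" unfolding v_def by linarith
  show False
  proof (cases "x < z")
    case True
    obtain w where w: "outer_at h w" "x < w" "h w = h x + (w - x)"
      using first_outer[OF proper xh(2) zh(2) True] unfolding outer_at_def by blast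
    have "v w - v x = (real_of_int w - real_of_int x) * (1 - \<alpha> / real e)" unfolding v_def w(3) by (simp add: algebra_simps diff_divide_distrib)
    moreover have "0 < (real_of_int w - real_of_int x) * (1 - \<alpha> / real e)"
      using w(2) \<alpha> e_pos by (intro mult_pos_pos) auto
    ultimately show False using z(2)[OF w(1)] vx by simp
  next
    case False
    then have "z < x" using x(3) by simp
    then obtain w where w: "outer_at h w" "w < x" "h w = h x"
      using last_outer[OF proper xh(1) zh(1)] unfolding outer_at_def by blast
    have "v w - v x = (real_of_int x - real_of_int w) * (\<alpha> / real e)" unfolding v_def w(3) by (simp add: algebra_simps diff_divide_distrib)
    moreover have "0 < (real_of_int x - real_of_int w) * (\<alpha> / real e)"
      using w(2) \<alpha> e_pos by (intro mult_pos_pos) auto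
    ultimately show False using z(2)[OF w(1)] vx by simp
  qed
qed

end

section \<open>Arrows and weights\<close>

context arm
begin

lemma mod_neq: "\<lbrakk>x \<noteq> y; \<bar>x - y\<bar> < 3\<rbrakk> \<Longrightarrow> x mod int e \<noteq> y mod int e"
  using mod_far[of x y] mod_far[of y x] by force

lemma good_node_unchanged:
  assumes h: "proper h" "proper h'" and "\<And>y. y mod int e = int k \<Longrightarrow> h (y - 1) = h' (y - 1) \<and> sgn_at h y = sgn_at h' y"
  shows "good_node pl e A k h p = good_node pl e A k h' p" "slen pl e A k h = slen pl e A k h'" "cn k h = cn k h'"
proof -
  show c: "cn k h = cn k h'" using conts_sgn[OF h(1)] conts_sgn[OF h(2)] assms(3) by auto
  have m: "y mod int e = int k" if "y \<in> cn k h'" for y using that unfolding conts_def by simp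
  have s: "sgp pl * sgn_at h x = sgp pl * sgn_at h' x" if "x \<in> cn k h'" for x
    using assms(3)[OF m[OF that]] by simp
  have l: "(dpol pl (df h) y x \<le> 0) = (dpol pl (df h') y x \<le> 0)" if "x \<in> cn k h'" "y \<in> cn k h'" for x y
    using assms(3)[OF m[OF that(1)]] assms(3)[OF m[OF that(2)]] unfolding dpol_def defect_def by simp
  show "good_node pl e A k h p = good_node pl e A k h' p" unfolding good_node_def c by (rule good_cong(1)) (fact s l)+
  show "slen pl e A k h = slen pl e A k h'" unfolding slen_def c by (rule good_cong(2)) (fact s l)+
qed

lemma slen_nonneg: "proper h \<Longrightarrow> 0 \<le> slen pl e A i h"
  unfolding slen_def by (rule lin_carrier.height_nonneg[OF lin_conts])

lemma slen_pos: "\<lbrakk>proper h; 0 < slen pl e A i h\<rbrakk> \<Longrightarrow> \<exists>p. good_node pl e A i h p"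
  unfolding slen_def good_node_def by (rule lin_carrier.ex_good[OF lin_conts])

lemma good_node_pos: "\<lbrakk>proper h; good_node pl e A i h p\<rbrakk> \<Longrightarrow> 0 < slen pl e A i h"
  unfolding slen_def good_node_def by (rule lin_carrier.good_pos[OF lin_conts])

lemma good_node_unique: "\<lbrakk>proper h; good_node pl e A i h p; good_node pl e A i h q\<rbrakk> \<Longrightarrow> p = q"
  unfolding good_node_def by (rule lin_carrier.good_unique[OF lin_conts])

text \<open>Other positions of the residue of \<open>p\<close> are at least 3 away, so within this
  residue only the sign at \<open>p\<close> flips and the order is unchanged; the rest is
  \<open>good_flip\<close> and \<open>height_flip\<close>.\<close>

lemma good_node_toggle:
  assumes h: "proper h" and p: "good_node pl e A i h p"
  shows "good_node (\<not> pl) e A i (toggle pl h p) p" "slen pl e A i (toggle pl h p) = slen pl e A i h - 1"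
proof -
  interpret L: lin_carrier "cn i h" "\<lambda>x y. dpol pl (df h) y x \<le> 0" by (rule lin_conts[OF h])
  let ?s = "\<lambda>x. sgp pl * sgn_at h x" and ?h = "toggle pl h p"
  have proper': "proper ?h" by (rule proper_toggle[OF h p])
  have pc: "p \<in> cn i h" "sgn_at h p = sgp pl" using good_node_D[OF h p] by auto
  have sp: "?s p = 1" using pc by (cases pl) (auto simp: sgp_def)
  have m: "y mod int e = p mod int e" if "y \<in> cn i h" for y using that pc unfolding conts_def by auto
  have n: "y \<noteq> p + 1" "y \<noteq> p - 1" if "y mod int e = int i" for y
    using mod_neq[of y p] that pc(1) unfolding conts_def by auto
  have sg: "sgn_at ?h y = (if y = p then - sgn_at h p else sgn_at h y)" if "y mod int e = int i" for y
    using sgn_toggle[OF h p, of y] n[OF that] pc(2) by auto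
  have c: "cn i ?h = cn i h" using conts_sgn[OF h] conts_sgn[OF proper'] sg pc(2)
    by (auto simp: sgp_def split: if_splits)
  have hh: "?h (y - 1) = h (y - 1)" if "y \<in> cn i h" for y
    using n[of y] that unfolding conts_def toggle_def by auto
  have d: "df ?h x y = df h x y" if "x \<in> cn i h" "y \<in> cn i h" for x y using hh that unfolding defect_def by simp
  have si: "y mod int e = int i" if "y \<in> cn i h" for y using that unfolding conts_def by simp
  have "good (cn i h) (\<lambda>x y. dpol pl (df h) x y \<le> 0) (\<lambda>x. - (?s(p := -1)) x) p"
    by (rule L.good_flip[OF p[unfolded good_node_def] sp])
  then show "good_node (\<not> pl) e A i ?h p" unfolding good_node_def c
    by (rule back_subst[where P = "\<lambda>x. x"], intro good_cong)
       (use sg[OF si] d sp pc(2) in \<open>auto simp: dpol_def sgp_def\<close>)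
  have "slen pl e A i ?h = height (cn i h) (\<lambda>x y. dpol pl (df h) y x \<le> 0) (?s(p := -1))"
    unfolding slen_def c by (rule good_cong) (use sg[OF si] d sp pc(2) in \<open>auto simp: dpol_def sgp_def\<close>)
  then show "slen pl e A i ?h = slen pl e A i h - 1"
    using L.height_flip[OF p[unfolded good_node_def] sp] unfolding slen_def by simp
qed

lemma toggle_toggle: "toggle (\<not> pl) (toggle pl h p) p = h"
  unfolding toggle_def sgp_def by auto

definition wsum :: "nat \<Rightarrow> (int \<Rightarrow> int) \<Rightarrow> int" where "wsum i h = sum (sgn_at h) (cn i h)"

lemma slen_diff: "proper h \<Longrightarrow> slen False e A i h = slen True e A i h - wsum i h"
  using lin_carrier.height_dual[OF lin_conts[of h i True], of "sgn_at h"]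
  unfolding slen_def wsum_def dpol_def sgp_def by simp

lemma wsum_window:
  assumes "proper h" "finite W" "cn i h \<subseteq> W" "\<And>y. y \<in> W \<Longrightarrow> y mod int e = int i"
  shows "wsum i h = sum (sgn_at h) W"
  unfolding wsum_def by (rule sum.mono_neutral_left) (use assms conts_sgn[OF assms(1)] in auto)

text \<open>The changes at \<open>p - 1\<close>, \<open>p\<close>, \<open>p + 1\<close> fall into
  three different residue classes; summed over class \<open>i\<close> they give an entry of the
  cyclic Cartan matrix.\<close>

lemma wsum_toggle:
  assumes h: "proper h" and p: "good_node pl e A k h p" and k: "k < e"
  shows "wsum i (toggle pl h p) = wsum i h - sgp pl * cartE e i k"
proof -
  let ?h = "toggle pl h p"
  have proper': "proper ?h" by (rule proper_toggle[OF h p])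
  have pm: "p mod int e = int k" using good_node_D[OF h p] unfolding conts_def by simp
  let ?E = "{y\<in>{p - 1, p, p + 1}. y mod int e = int i}"
  \<comment> \<open>A common summation range for both signatures that also contains the changed
    positions of residue \<open>i\<close>; the extra positions have sign 0.\<close>
  define W where "W = cn i h \<union> cn i ?h \<union> ?E"
  have fW: "finite W" unfolding W_def using h proper' conts_finite unfolding proper_def by auto
  have mW: "y mod int e = int i" if "y \<in> W" for y using that unfolding W_def conts_def by auto
  let ?c = "\<lambda>y. if y = p then -2 else if y = p + 1 \<or> y = p - 1 then 1 else 0 :: int"
  have "wsum i ?h = sum (sgn_at ?h) W" by (rule wsum_window[OF proper' fW]) (auto simp: W_def conts_def)
  also have "\<dots> = (\<Sum>y\<in>W. sgn_at h y + sgp pl * ?c y)" by (rule sum.cong) (use sgn_toggle[OF h p] in auto)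
  also have "\<dots> = sum (sgn_at h) W + sgp pl * sum ?c W" by (simp only: sum.distrib sum_distrib_left)
  also have "sum (sgn_at h) W = wsum i h" by (rule wsum_window[OF h fW, symmetric]) (auto simp: W_def conts_def)
  also have "sum ?c W = sum ?c ?E" by (rule sum.mono_neutral_right[OF fW]) (use mW in \<open>auto simp: W_def\<close>)
  also have "sum ?c ?E = (\<Sum>y\<in>{p - 1, p, p + 1}. if y mod int e = int i then ?c y else 0)"
    by (rule sum.inter_filter) simp
  also have "\<dots> = (if (p - 1) mod int e = int i then 1 else 0) + (if p mod int e = int i then -2 else 0)
       + (if (p + 1) mod int e = int i then 1 else 0)"
    by simp
  also have "\<dots> = - cartE e i k"
  proof -
    have s: "p mod int e = int i \<longleftrightarrow> i = k" using pm by auto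
    have u: "(p + 1) mod int e = int i \<longleftrightarrow> i < e \<and> i = (k + 1) mod e"
    proof -
      have "(p + 1) mod int e = int ((k + 1) mod e)" using pm by (metis mod_add_left_eq of_nat_1 of_nat_add of_nat_mod)
      then show ?thesis using e_pos by auto
    qed
    have d: "(p - 1) mod int e = int i \<longleftrightarrow> i < e \<and> k = (i + 1) mod e"
    proof
      assume a: "(p - 1) mod int e = int i"
      then have "int k = int ((i + 1) mod e)" using pm by (metis diff_add_cancel mod_add_left_eq of_nat_1 of_nat_add of_nat_mod)
      moreover have "int i < int e" using a e_pos by (metis of_nat_0_less_iff pos_mod_bound)
      ultimately show "i < e \<and> k = (i + 1) mod e" by simp
    next
      assume a: "i < e \<and> k = (i + 1) mod e"
      then have "p mod int e = (int i + 1) mod int e" using pm by (simp add: zmod_int add.commute)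
      then have "(p - 1) mod int e = (int i + 1 - 1) mod int e" by (rule mod_diff_cong) simp
      then show "(p - 1) mod int e = int i" using a by simp
    qed
    have n1: "(p + 1) mod int e \<noteq> p mod int e" "(p - 1) mod int e \<noteq> p mod int e" "(p + 1) mod int e \<noteq> (p - 1) mod int e"
      using mod_neq[of "p + 1" p] mod_neq[of "p - 1" p] mod_neq[of "p + 1" "p - 1"] by auto
    show ?thesis unfolding cartE_def adjE_def using s u d n1 k by auto
  qed
  finally show ?thesis by simp
qed

section \<open>Arrows, and commutation for non-adjacent residues\<close>

definition arrow :: "bool \<Rightarrow> nat \<Rightarrow> (int \<Rightarrow> int) \<Rightarrow> (int \<Rightarrow> int) \<Rightarrow> bool" where
  "arrow pl i h h' \<longleftrightarrow> h \<in> V \<and> i < e \<and> (\<exists>p. good_node pl e A i h p \<and> h' = toggle pl h p)"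

lemma arrow_V: "arrow pl i h h' \<Longrightarrow> h \<in> V \<and> h' \<in> V \<and> i < e"
  unfolding arrow_def using V_toggle by blast

lemma arrow_inverse: "arrow pl i h h' \<longleftrightarrow> arrow (\<not> pl) i h' h"
proof -
  have "arrow (\<not> pl) i h' h" if "arrow pl i h h'" for pl h h'
  proof -
    obtain p where p: "h \<in> V" "i < e" "good_node pl e A i h p" "h' = toggle pl h p" using \<open>arrow pl i h h'\<close> unfolding arrow_def by blast
    then show ?thesis unfolding arrow_def using V_toggle(1)[OF p(1,3)] good_node_toggle(1)[OF V_proper[OF p(1)] p(3)] toggle_toggle[of pl h p] by metis
  qed
  from this[of pl h h'] this[of "\<not> pl" h' h] show ?thesis by auto
qed

lemma arrow_det: "\<lbrakk>arrow pl i h h1; arrow pl i h h2\<rbrakk> \<Longrightarrow> h1 = h2"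
  unfolding arrow_def using good_node_unique V_proper by blast

lemma arrow_slen: "arrow pl i h h' \<Longrightarrow> slen pl e A i h' = slen pl e A i h - 1"
  unfolding arrow_def using good_node_toggle(2) V_proper by blast

lemma arrow_ex: "\<lbrakk>h \<in> V; i < e; 0 < slen pl e A i h\<rbrakk> \<Longrightarrow> \<exists>h'. arrow pl i h h'"
  unfolding arrow_def using slen_pos V_proper by blast

lemma arrow_pos: "arrow pl i h h' \<Longrightarrow> 0 < slen pl e A i h"
  unfolding arrow_def using good_node_pos V_proper by blast

lemma arrow_wsum: "arrow pl k h h' \<Longrightarrow> wsum i h' = wsum i h - sgp pl * cartE e i k"
  unfolding arrow_def using wsum_toggle V_proper by blast

text \<open>The words i k k i and k i i k of arrows starting at \<open>z\<close> meet in
  \<open>u\<close>. The two length equations are what the conversion to the axiom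
  \<open>down\<close> consumes.\<close>

definition octagon_at :: "bool \<Rightarrow> nat \<Rightarrow> nat \<Rightarrow> (int \<Rightarrow> int) \<Rightarrow> (int \<Rightarrow> int) \<Rightarrow> (int \<Rightarrow> int) \<Rightarrow> bool" where
  "octagon_at pl i k z y v \<longleftrightarrow> (\<exists>y1 y2 u v1 v2.
     arrow pl k y y1 \<and> arrow pl k y1 y2 \<and> arrow pl i y2 u \<and> arrow pl i v v1 \<and> arrow pl i v1 v2 \<and> arrow pl k v2 u \<and>
     slen pl e A k v2 = slen pl e A k z \<and> slen pl e A i y2 = slen pl e A i z)"

lemma octagon_at_swap: "octagon_at pl i k z y v = octagon_at pl k i z v y"
  unfolding octagon_at_def by blast

text \<open>A toggle at \<open>p\<close> changes the profile at \<open>p\<close> and signs at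
  \<open>p\<close> and its neighbours only. Signs at \<open>y\<close> and columns, read at
  \<open>y - 1\<close>, of a residue not adjacent to that of \<open>p\<close> are untouched.\<close>

lemma nonadjacent:
  assumes ik: "i \<noteq> k" "\<not> adjE e i k" and z: "arrow pl i z y" "arrow pl k z v"
  shows "\<exists>u. arrow pl k y u \<and> arrow pl i v u" "slen pl e A k y = slen pl e A k z"
proof -
  obtain p where p: "z \<in> V" "i < e" "good_node pl e A i z p" "y = toggle pl z p" using z(1) unfolding arrow_def by blast
  obtain q where q: "k < e" "good_node pl e A k z q" "v = toggle pl z q" using z(2) unfolding arrow_def by blast
  have proper: "proper z" "proper y" "proper v" using V_proper arrow_V[OF z(1)] arrow_V[OF z(2)] by auto
  have pm: "p mod int e = int i" and qm: "q mod int e = int k" 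
    using good_node_D[OF proper(1) p(3)] good_node_D[OF proper(1) q(2)] unfolding conts_def by auto
  have nx: "(x + 1) mod int e \<noteq> y mod int e"
    if "x mod int e = int i \<and> y mod int e = int k \<or> x mod int e = int k \<and> y mod int e = int i" for x y
  proof
    assume a: "(x + 1) mod int e = y mod int e"
    have "(x + 1) mod int e = (x mod int e + 1) mod int e" by (simp add: mod_simps)
    then have "int k = int ((i + 1) mod e) \<or> int i = int ((k + 1) mod e)" using that a by (auto simp: of_nat_mod add.commute)
    then show False using ik p(2) q(1) unfolding adjE_def by auto
  qed
  have un: "h (y - 1) = toggle pl h r (y - 1) \<and> sgn_at h y = sgn_at (toggle pl h r) y"
    if "proper h" "good_node pl e A j h r" "j = i \<and> l = k \<or> j = k \<and> l = i" "y mod int e = int l" for h j r l y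
  proof -
    have rm: "r mod int e = int j" using good_node_D[OF that(1,2)] unfolding conts_def by auto
    have "y \<noteq> r" using rm that(3,4) ik by auto
    moreover have "y \<noteq> r + 1" using nx[of r y] rm that(3,4) by auto
    moreover have "y \<noteq> r - 1" using nx[of y r] rm that(3,4) by auto
    ultimately show ?thesis using sgn_toggle[OF that(1,2), of y] unfolding toggle_def by auto
  qed
  have gy: "good_node pl e A k y q" "slen pl e A k y = slen pl e A k z"
    using good_node_unchanged[OF proper(1,2), of k] un[OF proper(1) p(3)] q(2) unfolding p(4) by metis+
  have gv: "good_node pl e A i v p" using good_node_unchanged(1)[OF proper(1,3), of i] un[OF proper(1) q(2)] p(3) unfolding q(3) by metis
  have pq: "p \<noteq> q" using pm qm ik by auto
  have "toggle pl y q = toggle pl v p" unfolding p(4) q(3) toggle_def using pq by auto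
  then have "arrow pl k y (toggle pl y q) \<and> arrow pl i v (toggle pl y q)" unfolding arrow_def using gy gv p q arrow_V[OF z(1)] arrow_V[OF z(2)] by auto
  then show "\<exists>u. arrow pl k y u \<and> arrow pl i v u" by blast
  show "slen pl e A k y = slen pl e A k z" by fact
qed

end

section \<open>Local axioms\<close>

text \<open>The residues other than \<open>i\<close>, \<open>j\<close> are frozen to the profile
  \<open>z\<close>, so both the sites and their order are fixed.\<close>

locale two_residues = arm +
  fixes i j :: nat and pl :: bool and z :: "int \<Rightarrow> int"
  assumes ie: "i < e" and j_def: "j = (i + 1) mod e" and zV: "z \<in> V"
begin

definition agree :: "(int \<Rightarrow> int) \<Rightarrow> bool" where
  "agree h \<longleftrightarrow> h \<in> V \<and> (\<forall>y. y mod int e \<noteq> int i \<and> y mod int e \<noteq> int j \<longrightarrow> h y = z y)"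

text \<open>Windows of the positions \<open>y - 1\<close>, \<open>y\<close>, \<open>y + 1\<close>
  with one or two beads; windows with none or three admit no node of either residue.\<close>

definition sites :: "int set" where
  "sites = {y. y mod int e = int i \<and> (z (y + 2) = z (y - 1) + 1 \<or> z (y + 2) = z (y - 1) + 2)}"

text \<open>For removal, at a site, \<open>cA\<close> says that \<open>y - 1\<close> is a gap and
  \<open>cB\<close> that \<open>y + 1\<close> is a bead, and removing a node clears the bit. For
  adding, the conditions are negated and \<open>Dp\<close> is transposed, so that an operator again
  clears a bit.\<close>

definition wd :: "int \<Rightarrow> bool" where "wd y \<longleftrightarrow> (z (y + 2) = z (y - 1) + 2) = pl"
definition cA :: "(int \<Rightarrow> int) \<Rightarrow> int \<Rightarrow> bool" where "cA h y \<longleftrightarrow> y \<in> sites \<and> (h y \<noteq> h (y - 1)) = pl"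
definition cB :: "(int \<Rightarrow> int) \<Rightarrow> int \<Rightarrow> bool" where "cB h y \<longleftrightarrow> y \<in> sites \<and> (h (y + 1) = h (y + 2)) = pl"
definition Dp :: "int \<Rightarrow> int \<Rightarrow> int" where "Dp = dpol pl (df z)"
definition allowed :: "(int \<Rightarrow> bool) \<Rightarrow> (int \<Rightarrow> bool) \<Rightarrow> bool" where "allowed a b \<longleftrightarrow> (\<exists>h. agree h \<and> a = cA h \<and> b = cB h)"

lemma j_less: "j < e" unfolding j_def using e_pos by simp

lemma succ_mod: "y mod int e = int i \<Longrightarrow> (y + 1) mod int e = int j"
proof -
  assume a: "y mod int e = int i"
  have "(y + 1) mod int e = (y mod int e + 1) mod int e" by (simp add: mod_simps)
  then show ?thesis unfolding a j_def by (simp add: zmod_int add.commute)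
qed

lemma pred_mod: "y mod int e = int j \<Longrightarrow> (y - 1) mod int e = int i"
proof -
  assume a: "y mod int e = int j"
  have "int i mod int e = int i" using ie by simp
  then have "(int i + 1) mod int e = int j" using succ_mod by blast
  then have "(y - 1) mod int e = (int i + 1 - 1) mod int e" using a by (intro mod_diff_cong) auto
  then show ?thesis using ie by simp
qed

lemma mods:
  assumes "y mod int e = int i"
  shows "(y - 1) mod int e \<noteq> int i" "(y - 1) mod int e \<noteq> int j" "(y + 2) mod int e \<noteq> int i" "(y + 2) mod int e \<noteq> int j"
    "(y + 1) mod int e \<noteq> int i" "y mod int e \<noteq> int j"
  using mod_neq[of "y - 1" y] mod_neq[of "y - 1" "y + 1"] mod_neq[of "y + 2" y] mod_neq[of "y + 2" "y + 1"] mod_neq[of "y + 1" y]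
    succ_mod[OF assms] assms by auto

lemma agree_V: "agree h \<Longrightarrow> h \<in> V" unfolding agree_def by simp
lemma agree_proper: "agree h \<Longrightarrow> proper h" using agree_V V_proper by blast

lemma agree_eq:
  assumes "agree h" "y mod int e = int i" shows "h (y - 1) = z (y - 1)" "h (y + 2) = z (y + 2)"
  using assms mods[OF assms(2)] unfolding agree_def by auto

lemma steps:
  assumes "proper h"
  shows "h (y - 1) \<le> h y" "h y \<le> h (y - 1) + 1" "h y \<le> h (y + 1)" "h (y + 1) \<le> h y + 1"
     "h (y + 1) \<le> h (y + 2)" "h (y + 2) \<le> h (y + 1) + 1"
  using proper_incr[OF assms, of "y - 1"] proper_incr[OF assms, of y] proper_incr[OF assms, of "y + 1"] by (simp_all add: add.assoc)

lemma site_mod: "y \<in> sites \<Longrightarrow> y mod int e = int i" unfolding sites_def by simp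

lemma finite_sites: "finite sites"
proof -
  have "far z" using V_proper[OF zV] unfolding proper_def by simp
  then obtain n where n: "0 \<le> n" "\<And>y. n \<le> \<bar>y\<bar> \<Longrightarrow> z y = max 0 y" unfolding far_def by blast
  have "sites \<subseteq> {-n-2..n+1}"
  proof
    fix y assume y: "y \<in> sites"
    show "y \<in> {-n-2..n+1}"
    proof (rule ccontr)
      assume "\<not> ?thesis"
      then have "z (y + 2) = max 0 (y + 2)" "z (y - 1) = max 0 (y - 1)" "y > 1 \<or> y < -2" using n by auto
      then show False using y unfolding sites_def by auto
    qed
  qed
  then show ?thesis by (rule finite_subset) simp
qed

lemma order_sites: "defect_order sites Dp"
  unfolding Dp_def
  by (rule defect_order_dpol, rule defect_order_defect[OF arm e_pos finite_sites, where i = "int i"]) (rule site_mod)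

lemma site_arith:
  fixes m u v n :: int
  assumes "m \<le> u" "u \<le> m + 1" "u \<le> v" "v \<le> u + 1" "v \<le> n" "n \<le> v + 1" "n = m + 1 \<or> n = m + 2"
  shows "((v = n) \<noteq> (n = m + 2)) = (v = m + 1)" "((u \<noteq> m) = (n = m + 2)) = (n = u + 1)"
    "n = u + 1 \<Longrightarrow> (v = n) = (v \<noteq> u)"
  using assms by presburger+

lemma site_values:
  assumes h: "agree h" and y: "y \<in> sites"
  shows "((h (y + 1) = h (y + 2)) \<noteq> (z (y + 2) = z (y - 1) + 2)) = (h (y + 1) = h (y - 1) + 1)"
    "((h y \<noteq> h (y - 1)) = (z (y + 2) = z (y - 1) + 2)) = (h (y + 2) = h y + 1)"
    "h (y + 2) = h y + 1 \<Longrightarrow> (h (y + 1) = h (y + 2)) = (h (y + 1) \<noteq> h y)"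
proof -
  note e = agree_eq[OF h site_mod[OF y]]
  have "h (y + 2) = h (y - 1) + 1 \<or> h (y + 2) = h (y - 1) + 2" using y unfolding e sites_def by simp
  note site_arith[OF steps[OF agree_proper[OF h], of y] this]
  then show "((h (y + 1) = h (y + 2)) \<noteq> (z (y + 2) = z (y - 1) + 2)) = (h (y + 1) = h (y - 1) + 1)"
    "((h y \<noteq> h (y - 1)) = (z (y + 2) = z (y - 1) + 2)) = (h (y + 2) = h y + 1)"
    "h (y + 2) = h y + 1 \<Longrightarrow> (h (y + 1) = h (y + 2)) = (h (y + 1) \<noteq> h y)"
    unfolding e by blast+
qed

lemma sgA_eq:
  assumes h: "agree h" and y: "y \<in> sites"
  shows "sgA sites wd (cA h) (cB h) y = sgp pl * sgn_at h y"
proof -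
  have "(cB h y \<noteq> wd y) = (h (y + 1) = h (y - 1) + 1)"
    using y unfolding cB_def wd_def site_values(1)[OF h y, symmetric] by blast
  then show ?thesis using y unfolding sgA_def cA_def sgn_at_def sgp_def by simp
qed

lemma sgB_eq:
  assumes h: "agree h" and y: "y \<in> sites"
  shows "sgA sites (\<lambda>y. \<not> wd y) (cB h) (cA h) y = sgp pl * sgn_at h (y + 1)"
proof -
  have c: "(cA h y \<noteq> (\<not> wd y)) = (h (y + 2) = h y + 1)"
    using y unfolding cA_def wd_def site_values(2)[OF h y, symmetric] by blast
  have a: "y + 1 + 1 = y + 2" "y + 1 - 1 = y" by simp_all
  show ?thesis using y site_values(3)[OF h y] unfolding sgA_def c cB_def sgn_at_def sgp_def a by simp
qed

lemma node_site:
  assumes h: "agree h" and m: "y mod int e = int i" and c: "h (y + 1) = h (y - 1) + 1 \<or> h (y + 2) = h y + 1"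
  shows "y \<in> sites"
proof -
  note e = agree_eq[OF h m]
  have "h (y + 2) = h (y - 1) + 1 \<or> h (y + 2) = h (y - 1) + 2" using steps[OF agree_proper[OF h], of y] c by linarith
  then show ?thesis unfolding sites_def mem_Collect_eq e using m by blast
qed

lemma conts_A: "agree h \<Longrightarrow> cn i h \<subseteq> sites"
  using node_site unfolding conts_def by blast

lemma conts_B:
  assumes h: "agree h" shows "cn j h = (\<lambda>y. y + 1) ` {y\<in>sites. y + 1 \<in> cn j h}"
proof
  show "cn j h \<subseteq> (\<lambda>y. y + 1) ` {y\<in>sites. y + 1 \<in> cn j h}"
  proof
    fix x assume x: "x \<in> cn j h"
    define y where "y = x - 1"
    have a: "x = y + 1" "y + 1 + 1 = y + 2" "y + 1 - 1 = y" unfolding y_def by simp_all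
    have m: "y mod int e = int i" using pred_mod x unfolding conts_def y_def by auto
    have "h (y + 2) = h y + 1" using x unfolding conts_def mem_Collect_eq a by blast
    then have "y \<in> sites" using node_site[OF h m] by blast
    then show "x \<in> (\<lambda>y. y + 1) ` {y\<in>sites. y + 1 \<in> cn j h}" using x a(1) by blast
  qed
qed blast

lemma df_A: "\<lbrakk>agree h; x mod int e = int i; y mod int e = int i\<rbrakk> \<Longrightarrow> df h x y = df z x y"
  unfolding defect_def using agree_eq by simp

lemma df_B:
  assumes h: "agree h" and x: "x \<in> sites" "x + 1 \<in> cn j h" and y: "y \<in> sites" "y + 1 \<in> cn j h"
  shows "shifted Dp wd x y = dpol pl (df h) (x + 1) (y + 1)"
proof -
  have u: "h u = z (u - 1) + of_bool (z (u + 2) = z (u - 1) + 2)" if "u \<in> sites" "u + 1 \<in> cn j h" for u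
  proof -
    have a: "u + 1 + 1 = u + 2" "u + 1 - 1 = u" by simp_all
    have "h (u + 2) = h u + 1" using that(2) unfolding conts_def mem_Collect_eq a by blast
    moreover have "z (u + 2) = z (u - 1) + 1 \<or> z (u + 2) = z (u - 1) + 2" using that(1) unfolding sites_def by blast
    ultimately show ?thesis unfolding agree_eq(2)[OF h site_mod[OF that(1)]] by (elim disjE) simp_all
  qed
  show ?thesis using u[OF x] u[OF y] unfolding shifted_def Dp_def dpol_def defect_def wd_def
    by (auto simp: of_bool_def)
qed

lemma A_good:
  assumes h: "agree h"
  shows "good sites (\<lambda>x y. Dp y x \<le> 0) (sgA sites wd (cA h) (cB h)) p \<longleftrightarrow> good_node pl e A i h p"
    and "height sites (\<lambda>x y. Dp y x \<le> 0) (sgA sites wd (cA h) (cB h)) = slen pl e A i h"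
proof -
  interpret L: lin_carrier sites "\<lambda>x y. Dp y x \<le> 0" by (rule defect_order.lin[OF order_sites])
  have z: "sgA sites wd (cA h) (cB h) x = 0" if "x \<in> sites - cn i h" for x
    using that sgA_eq[OF h, of x] conts_sgn[OF agree_proper[OF h], of x i] site_mod[of x] by auto
  have s: "sgA sites wd (cA h) (cB h) x = sgp pl * sgn_at h x" if "x \<in> cn i h" for x
    using sgA_eq[OF h, of x] conts_A[OF h] that by auto
  have l: "(Dp y x \<le> 0) = (dpol pl (df h) y x \<le> 0)" if "x \<in> cn i h" "y \<in> cn i h" for x y
    using df_A[OF h, of x y] df_A[OF h, of y x] that unfolding Dp_def dpol_def conts_def by simp
  have "good sites (\<lambda>x y. Dp y x \<le> 0) (sgA sites wd (cA h) (cB h)) p \<longleftrightarrow>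
      good (cn i h) (\<lambda>x y. Dp y x \<le> 0) (sgA sites wd (cA h) (cB h)) p"
    by (rule L.good_carrier(1)[OF conts_A[OF h]]) (rule z)
  also have "\<dots> \<longleftrightarrow> good_node pl e A i h p"
    unfolding good_node_def by (rule good_cong(1)) (fact s l)+
  finally show "good sites (\<lambda>x y. Dp y x \<le> 0) (sgA sites wd (cA h) (cB h)) p \<longleftrightarrow> good_node pl e A i h p" .
  have "height sites (\<lambda>x y. Dp y x \<le> 0) (sgA sites wd (cA h) (cB h)) =
      height (cn i h) (\<lambda>x y. Dp y x \<le> 0) (sgA sites wd (cA h) (cB h))"
    by (rule L.good_carrier(2)[OF conts_A[OF h]]) (rule z)
  also have "\<dots> = slen pl e A i h"
    unfolding slen_def by (rule good_cong(2)) (fact s l)+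
  finally show "height sites (\<lambda>x y. Dp y x \<le> 0) (sgA sites wd (cA h) (cB h)) = slen pl e A i h" .
qed

lemma B_good:
  assumes h: "agree h"
  shows "good sites (\<lambda>x y. shifted Dp wd y x \<le> 0) (sgA sites (\<lambda>y. \<not> wd y) (cB h) (cA h)) p \<longleftrightarrow> good_node pl e A j h (p + 1)"
    and "height sites (\<lambda>x y. shifted Dp wd y x \<le> 0) (sgA sites (\<lambda>y. \<not> wd y) (cB h) (cA h)) = slen pl e A j h"
proof -
  interpret L: lin_carrier sites "\<lambda>x y. shifted Dp wd y x \<le> 0"
    by (rule defect_order.lin[OF defect_order.defect_order_shifted[OF order_sites]])
  let ?N = "{y\<in>sites. y + 1 \<in> cn j h}"
  let ?s = "sgA sites (\<lambda>y. \<not> wd y) (cB h) (cA h)"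
  have sub: "?N \<subseteq> sites" by auto
  have z: "?s x = 0" if "x \<in> sites - ?N" for x
    using that sgB_eq[OF h, of x] conts_sgn[OF agree_proper[OF h], of "x + 1" j] succ_mod[OF site_mod, of x] by auto
  have s: "?s x = sgp pl * sgn_at h (x + 1)" if "x \<in> ?N" for x using sgB_eq[OF h, of x] that by auto
  have l: "(shifted Dp wd y x \<le> 0) = (dpol pl (df h) (y + 1) (x + 1) \<le> 0)" if "x \<in> ?N" "y \<in> ?N" for x y
    using df_B[OF h, of y x] that by simp
  have inj: "inj_on (\<lambda>y::int. y + 1) ?N" by (rule inj_onI) simp
  have "good sites (\<lambda>x y. shifted Dp wd y x \<le> 0) ?s p \<longleftrightarrow> good ?N (\<lambda>x y. shifted Dp wd y x \<le> 0) ?s p"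
    by (rule L.good_carrier(1)[OF sub]) (rule z)
  also have "\<dots> \<longleftrightarrow> good ?N (\<lambda>x y. dpol pl (df h) (y + 1) (x + 1) \<le> 0) (\<lambda>x. sgp pl * sgn_at h (x + 1)) p"
    by (rule good_cong(1)) (fact s l)+
  also have "\<dots> \<longleftrightarrow> good_node pl e A j h (p + 1)"
  proof (cases "p \<in> ?N")
    case True
    then show ?thesis unfolding good_node_def
      using good_image(1)[OF inj True, of "\<lambda>x y. dpol pl (df h) y x \<le> 0" "\<lambda>x. sgp pl * sgn_at h x"] 
      by (simp only: conts_B[OF h, symmetric])
  next
    case False
    have "p \<in> ?N" if "p + 1 \<in> cn j h"
    proof -
      have "p + 1 \<in> (\<lambda>y. y + 1) ` ?N" using that unfolding conts_B[OF h, symmetric] .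
      then show ?thesis by auto
    qed
    then show ?thesis using False unfolding good_node_def good_def by blast
  qed
  finally show "good sites (\<lambda>x y. shifted Dp wd y x \<le> 0) ?s p \<longleftrightarrow> good_node pl e A j h (p + 1)" .
  have "height sites (\<lambda>x y. shifted Dp wd y x \<le> 0) ?s = height ?N (\<lambda>x y. shifted Dp wd y x \<le> 0) ?s"
    by (rule L.good_carrier(2)[OF sub]) (rule z)
  also have "\<dots> = height ?N (\<lambda>x y. dpol pl (df h) (y + 1) (x + 1) \<le> 0) (\<lambda>x. sgp pl * sgn_at h (x + 1))"
    by (rule good_cong(2)) (fact s l)+
  also have "\<dots> = slen pl e A j h" unfolding slen_def
    using good_image(2)[OF inj, of "\<lambda>x y. dpol pl (df h) y x \<le> 0" "\<lambda>x. sgp pl * sgn_at h x"]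
    by (simp only: conts_B[OF h, symmetric])
  finally show "height sites (\<lambda>x y. shifted Dp wd y x \<le> 0) ?s = slen pl e A j h" .
qed

lemma A_step:
  assumes h: "agree h" and p: "good_node pl e A i h p"
  shows "agree (toggle pl h p)" "cA (toggle pl h p) = (cA h)(p := False)" "cB (toggle pl h p) = cB h"
proof -
  note pc = good_node_D[OF agree_proper[OF h] p]
  have pm: "p mod int e = int i" using pc(1) unfolding conts_def by simp
  show "agree (toggle pl h p)" using h V_toggle(1)[OF agree_V[OF h] p] pm unfolding agree_def toggle_def by auto
  have hp: "(h p \<noteq> h (p - 1)) = pl" "h p = h (p - 1) \<or> h p = h (p - 1) + 1"
    using conts_cases(3)[OF agree_proper[OF h] pc(1)] pc(2) by (auto simp: sgp_def split: if_splits)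
  show "cA (toggle pl h p) = (cA h)(p := False)"
  proof
    fix y
    have "y - 1 \<noteq> p" if "y \<in> sites" using mods(1)[OF site_mod[OF that]] pm by auto
    then show "cA (toggle pl h p) y = ((cA h)(p := False)) y"
      using hp unfolding cA_def toggle_def sgp_def by (cases "y = p") auto
  qed
  show "cB (toggle pl h p) = cB h"
  proof
    fix y
    have "y + 1 \<noteq> p" "y + 2 \<noteq> p" if "y \<in> sites" using mods[OF site_mod[OF that]] pm by auto
    then show "cB (toggle pl h p) y = cB h y" unfolding cB_def toggle_def by auto
  qed
qed

lemma B_step:
  assumes h: "agree h" and p: "good_node pl e A j h (p + 1)"
  shows "agree (toggle pl h (p + 1))" "cB (toggle pl h (p + 1)) = (cB h)(p := False)" "cA (toggle pl h (p + 1)) = cA h"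
proof -
  note pc = good_node_D[OF agree_proper[OF h] p]
  have pm: "(p + 1) mod int e = int j" using pc(1) unfolding conts_def by simp
  show "agree (toggle pl h (p + 1))" using h V_toggle(1)[OF agree_V[OF h] p] pm unfolding agree_def toggle_def by auto
  have a: "p + 1 + 1 = p + 2" "p + 1 - 1 = p" by simp_all
  note hc = conts_cases(1,3)[OF agree_proper[OF h] pc(1), unfolded a]
  have hp: "(h (p + 1) = h (p + 2)) = pl" "h (p + 2) = h p + 1" "h (p + 1) = h p \<or> h (p + 1) = h p + 1"
    using hc pc(2) by (auto simp: sgp_def split: if_splits)
  show "cB (toggle pl h (p + 1)) = (cB h)(p := False)"
  proof
    fix y
    have "y + 2 \<noteq> p + 1" if "y \<in> sites" using mods(4)[OF site_mod[OF that]] pm by metis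
    then show "cB (toggle pl h (p + 1)) y = ((cB h)(p := False)) y"
      using hp unfolding cB_def toggle_def sgp_def by (cases "y = p") auto
  qed
  show "cA (toggle pl h (p + 1)) = cA h"
  proof
    fix y
    have "y \<noteq> p + 1" "y - 1 \<noteq> p + 1" if "y \<in> sites" using mods[OF site_mod[OF that]] pm by metis+
    then show "cA (toggle pl h (p + 1)) y = cA h y" unfolding cA_def toggle_def by auto
  qed
qed

lemma agree_z: "agree z" unfolding agree_def using zV by simp

text \<open>The pair excluded by \<open>forb\<close> consists of an addable and a removable node of
  residue \<open>i\<close> with defect 1, so \<open>defect_not_one\<close> applies for either
  polarity. Closure holds because \<open>allowed\<close> collects the bits of actual
  vertices.\<close>

sublocale M: pair_model sites Dp wd allowed
proof (intro pair_model.intro pair_model_axioms.intro order_sites)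
  fix a b x y
  assume "allowed a b" and H: "x \<in> sites" "y \<in> sites" "Dp x y = 1" "\<not> wd x" "wd y" "\<not> a x" "b x" "a y" "\<not> b y"
  then obtain h where h: "agree h" "a = cA h" "b = cB h" unfolding allowed_def by blast
  note proper = agree_proper[OF h(1)]
  have xs: "sgp pl * sgn_at h x = -1" and ys: "sgp pl * sgn_at h y = 1"
    using sgA_eq[OF h(1) H(1)] sgA_eq[OF h(1) H(2)] H h unfolding sgA_def by auto
  then have c: "x \<in> cn i h" "y \<in> cn i h" using conts_sgn[OF proper] site_mod H by auto
  have m: "x mod int e = int i" "y mod int e = int i" using site_mod H by auto
  have d: "dpol pl (df h) x y = 1" using H(3) df_A[OF h(1) m] df_A[OF h(1) m(2,1)] unfolding Dp_def dpol_def by (cases pl) simp_all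
  show False
  proof (cases pl)
    case True
    then show False using defect_not_one[OF proper c(1) _ c(2)] xs ys d by (simp add: sgp_def dpol_def)
  next
    case False
    then show False using defect_not_one[OF proper c(2) _ c(1)] xs ys d by (simp add: sgp_def dpol_def)
  qed
next
  fix a b p assume "allowed a b" and g: "good sites (\<lambda>x y. Dp y x \<le> 0) (sgA sites wd a b) p"
  then obtain h where h: "agree h" "a = cA h" "b = cB h" unfolding allowed_def by blast
  have "good_node pl e A i h p" using g A_good(1)[OF h(1)] unfolding h(2,3) by simp
  from A_step[OF h(1) this] show "allowed (a(p := False)) b" unfolding allowed_def h(2,3) by metis
next
  fix a b p assume "allowed a b" and g: "good sites (\<lambda>x y. shifted Dp wd y x \<le> 0) (sgA sites (\<lambda>x. \<not> wd x) b a) p"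
  then obtain h where h: "agree h" "a = cA h" "b = cB h" unfolding allowed_def by blast
  have "good_node pl e A j h (p + 1)" using g B_good(1)[OF h(1)] unfolding h(2,3) by simp
  from B_step[OF h(1) this] show "allowed a (b(p := False))" unfolding allowed_def h(2,3) by metis
qed

text \<open>The values at \<open>y - 1\<close> and \<open>y + 2\<close> are frozen and the two bits
  fix the values between; off the sites the total rise is 0 or 3, which leaves no choice.\<close>

lemma cfg_inj:
  assumes h: "agree h" "agree h'" and eq: "cA h = cA h'" "cB h = cB h'"
  shows "h = h'"
proof
  have R: "h y = h' y \<and> h (y + 1) = h' (y + 1)" if m: "y mod int e = int i" for y
  proof -
    note E = agree_eq[OF h(1) m] agree_eq[OF h(2) m] and arrow = steps[OF agree_proper[OF h(1)], of y] steps[OF agree_proper[OF h(2)], of y]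
    show ?thesis
    proof (cases "y \<in> sites")
      case True
      have "(h y \<noteq> h (y - 1)) = (h' y \<noteq> h' (y - 1))" "(h (y + 1) = h (y + 2)) = (h' (y + 1) = h' (y + 2))"
        using fun_cong[OF eq(1), of y] fun_cong[OF eq(2), of y] True unfolding cA_def cB_def by auto
      then show ?thesis using E arrow by linarith
    next
      case False
      then show ?thesis using E arrow m unfolding sites_def by auto
    qed
  qed
  fix x
  show "h x = h' x"
  proof (cases "x mod int e = int i \<or> x mod int e = int j")
    case True
    then show ?thesis using R[of x] R[of "x - 1"] pred_mod[of x] by auto
  next
    case False
    then show ?thesis using h unfolding agree_def by auto
  qed
qed

section \<open>Transfer of squares and octagons to the crystal\<close>

lemma M_gA: "agree h \<Longrightarrow> M.gA (cA h) (cB h) p = good_node pl e A i h p" using A_good(1) .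
lemma M_gB: "agree h \<Longrightarrow> M.gB (cA h) (cB h) p = good_node pl e A j h (p + 1)" using B_good(1) .
lemma M_hA: "agree h \<Longrightarrow> M.hA (cA h) (cB h) = slen pl e A i h" using A_good(2) .
lemma M_hB: "agree h \<Longrightarrow> M.hB (cA h) (cB h) = slen pl e A j h" using B_good(2) .

lemma arrow_A:
  assumes "agree h" "M.gA (cA h) (cB h) p"
  shows "\<exists>h'. arrow pl i h h' \<and> agree h' \<and> cA h' = (cA h)(p := False) \<and> cB h' = cB h"
  using A_step[OF assms(1)] assms agree_V ie unfolding M_gA[OF assms(1)] arrow_def by blast

lemma arrow_B:
  assumes "agree h" "M.gB (cA h) (cB h) p"
  shows "\<exists>h'. arrow pl j h h' \<and> agree h' \<and> cB h' = (cB h)(p := False) \<and> cA h' = cA h"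
  using B_step[OF assms(1)] assms agree_V j_less unfolding M_gB[OF assms(1)] arrow_def by blast

lemma A_arrow:
  assumes "agree h" "arrow pl i h h'"
  shows "\<exists>p. M.gA (cA h) (cB h) p \<and> agree h' \<and> cA h' = (cA h)(p := False) \<and> cB h' = cB h"
  using A_step[OF assms(1)] assms(2) M_gA[OF assms(1)] unfolding arrow_def by blast

lemma B_arrow:
  assumes "agree h" "arrow pl j h h'"
  shows "\<exists>p. M.gB (cA h) (cB h) p \<and> agree h' \<and> cB h' = (cB h)(p := False) \<and> cA h' = cA h"
proof -
  obtain q where "good_node pl e A j h (q - 1 + 1)" "h' = toggle pl h (q - 1 + 1)" using assms(2) unfolding arrow_def by auto
  then show ?thesis using B_step[OF assms(1)] M_gB[OF assms(1)] by blast
qed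

text \<open>Each clearing of a bit is realised by an arrow, and two paths with equal final bits end
  in the same vertex by \<open>cfg_inj\<close>.\<close>

lemma two_squares:
  assumes y: "arrow pl i z y" and v: "arrow pl j z v"
  shows "slen pl e A j y = slen pl e A j z \<Longrightarrow> \<exists>u. arrow pl j y u \<and> arrow pl i v u \<and> slen pl e A i v = slen pl e A i z + 1"
    and "slen pl e A i v = slen pl e A i z \<Longrightarrow> \<exists>u. arrow pl j y u \<and> arrow pl i v u \<and> slen pl e A j y = slen pl e A j z + 1"
    and "slen pl e A j y = slen pl e A j z \<or> slen pl e A j y = slen pl e A j z + 1"
    and "slen pl e A i v = slen pl e A i z \<or> slen pl e A i v = slen pl e A i z + 1"
    and "\<lbrakk>slen pl e A j y = slen pl e A j z + 1; slen pl e A i v = slen pl e A i z + 1\<rbrakk> \<Longrightarrow>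
      octagon_at pl i j z y v"
proof -
  obtain p where p: "M.gA (cA z) (cB z) p" "agree y" "cA y = (cA z)(p := False)" "cB y = cB z"
    using A_arrow[OF agree_z y] by blast
  obtain q where q: "M.gB (cA z) (cB z) q" "agree v" "cB v = (cB z)(q := False)" "cA v = cA z"
    using B_arrow[OF agree_z v] by blast
  have allowed: "allowed (cA z) (cB z)" unfolding allowed_def using agree_z by blast
  have hy: "M.hB ((cA z)(p := False)) (cB z) = slen pl e A j y" using M_hB[OF p(2)] p by simp
  have hv: "M.hA (cA z) ((cB z)(q := False)) = slen pl e A i v" using M_hA[OF q(2)] q by simp
  note hz = M_hA[OF agree_z] M_hB[OF agree_z]
  have close: "\<exists>u. arrow pl j y u \<and> arrow pl i v u" 
    if g: "M.gB ((cA z)(p := False)) (cB z) q" "M.gA (cA z) ((cB z)(q := False)) p"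
  proof -
    obtain u where u: "arrow pl j y u" "agree u" "cB u = (cB y)(q := False)" "cA u = cA y"
      using arrow_B[OF p(2), of q] g(1) p by auto
    obtain u' where u': "arrow pl i v u'" "agree u'" "cA u' = (cA v)(p := False)" "cB u' = cB v"
      using arrow_A[OF q(2), of p] g(2) q by auto
    have "u = u'" using cfg_inj[OF u(2) u'(2)] u u' p q by simp
    then show ?thesis using u u' by blast
  qed
  show "\<exists>u. arrow pl j y u \<and> arrow pl i v u \<and> slen pl e A i v = slen pl e A i z + 1" if "slen pl e A j y = slen pl e A j z"
    using M.square[OF allowed p(1) q(1)] close that hy hv hz by simp
  \<comment> \<open>The exchanged model gives the square when it is the length for residue
    \<open>i\<close> that stays fixed.\<close>
  interpret W: pair_model sites "shifted Dp wd" "\<lambda>x. \<not> wd x" "\<lambda>a b. allowed b a" by (rule M.swap)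
  note W = M.shifted_shifted not_not
  show "\<exists>u. arrow pl j y u \<and> arrow pl i v u \<and> slen pl e A j y = slen pl e A j z + 1" if "slen pl e A i v = slen pl e A i z"
    using W.square[unfolded W, OF allowed q(1) p(1)] close that hy hv hz by simp
  show "slen pl e A j y = slen pl e A j z \<or> slen pl e A j y = slen pl e A j z + 1"
    using M.upd_a(3)[OF p(1)] hy hz by (simp split: if_splits)
  show "slen pl e A i v = slen pl e A i z \<or> slen pl e A i v = slen pl e A i z + 1"
    using M.upd_b(3)[OF q(1)] hv hz by (simp split: if_splits)
  assume "slen pl e A j y = slen pl e A j z + 1" "slen pl e A i v = slen pl e A i z + 1"
  then obtain q1 q2 p2 p1 p3 q3 where o:
     "M.gB ((cA z)(p := False)) (cB z) q1" "M.gB ((cA z)(p := False)) ((cB z)(q1 := False)) q2"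
     "M.gA ((cA z)(p := False)) ((cB z)(q1 := False, q2 := False)) p2"
     "M.gA (cA z) ((cB z)(q := False)) p1" "M.gA ((cA z)(p1 := False)) ((cB z)(q := False)) p3"
     "M.gB ((cA z)(p1 := False, p3 := False)) ((cB z)(q := False)) q3"
     "(cA z)(p := False, p2 := False) = (cA z)(p1 := False, p3 := False)"
     "(cB z)(q1 := False, q2 := False) = (cB z)(q := False, q3 := False)"
     "M.hB ((cA z)(p1 := False, p3 := False)) ((cB z)(q := False)) = M.hB (cA z) (cB z)"
     "M.hA ((cA z)(p := False)) ((cB z)(q1 := False, q2 := False)) = M.hA (cA z) (cB z)"
    using M.octagon[OF allowed p(1) q(1)] hy hv hz by auto
  obtain y1 where y1: "arrow pl j y y1" "agree y1" "cB y1 = (cB z)(q1 := False)" "cA y1 = (cA z)(p := False)"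
    using arrow_B[OF p(2), of q1] o(1) p by auto
  obtain y2 where y2: "arrow pl j y1 y2" "agree y2" "cB y2 = (cB z)(q1 := False, q2 := False)" "cA y2 = (cA z)(p := False)"
    using arrow_B[OF y1(2), of q2] o(2) y1 by auto
  obtain u where u: "arrow pl i y2 u" "agree u" "cA u = (cA z)(p := False, p2 := False)" "cB u = (cB z)(q1 := False, q2 := False)"
    using arrow_A[OF y2(2), of p2] o(3) y2 by auto
  obtain v1 where v1: "arrow pl i v v1" "agree v1" "cA v1 = (cA z)(p1 := False)" "cB v1 = (cB z)(q := False)"
    using arrow_A[OF q(2), of p1] o(4) q by auto
  obtain v2 where v2: "arrow pl i v1 v2" "agree v2" "cA v2 = (cA z)(p1 := False, p3 := False)" "cB v2 = (cB z)(q := False)"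
    using arrow_A[OF v1(2), of p3] o(5) v1 by auto
  obtain u' where u': "arrow pl j v2 u'" "agree u'" "cB u' = (cB z)(q := False, q3 := False)" "cA u' = (cA z)(p1 := False, p3 := False)"
    using arrow_B[OF v2(2), of q3] o(6) v2 by auto
  have "u = u'" by (rule cfg_inj[OF u(2) u'(2)]) (use u u' o(7,8) in auto)
  moreover have "slen pl e A j v2 = slen pl e A j z" "slen pl e A i y2 = slen pl e A i z"
    using M_hB[OF v2(2)] M_hA[OF y2(2)] v2 y2 o(9,10) hz by auto
  ultimately show "octagon_at pl i j z y v"
    unfolding octagon_at_def using y1 y2 u v1 v2 u' by blast
qed

end

section \<open>The crystals are isomorphic\<close>

context arm
begin

lemma adjE_sym: "adjE e i k \<longleftrightarrow> adjE e k i" unfolding adjE_def by blast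

text \<open>The model expects the second residue to be the successor of the first; for the opposite
  orientation the two residues and the two arrows exchange roles.\<close>

lemma adjacent:
  assumes ik: "adjE e i k" and z: "arrow pl i z y" "arrow pl k z v"
  shows "slen pl e A k y = slen pl e A k z \<Longrightarrow> \<exists>u. arrow pl k y u \<and> arrow pl i v u \<and> slen pl e A i v = slen pl e A i z + 1"
    and "slen pl e A k y = slen pl e A k z \<or> slen pl e A k y = slen pl e A k z + 1"
    and "\<lbrakk>slen pl e A k y = slen pl e A k z + 1; slen pl e A i v = slen pl e A i z + 1\<rbrakk> \<Longrightarrow>
      octagon_at pl i k z y v"
proof -
  have "(slen pl e A k y = slen pl e A k z \<longrightarrow> (\<exists>u. arrow pl k y u \<and> arrow pl i v u \<and> slen pl e A i v = slen pl e A i z + 1)) \<and>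
    (slen pl e A k y = slen pl e A k z \<or> slen pl e A k y = slen pl e A k z + 1) \<and>
    (slen pl e A k y = slen pl e A k z + 1 \<and> slen pl e A i v = slen pl e A i z + 1 \<longrightarrow> octagon_at pl i k z y v)"
  proof (cases "k = (i + 1) mod e")
    case True
    interpret W: two_residues e A i k pl z
      by unfold_locales (use ik True arrow_V[OF z(1)] in \<open>auto simp: adjE_def\<close>)
    show ?thesis using W.two_squares[OF z] by blast
  next
    case False
    interpret W: two_residues e A k i pl z
      by unfold_locales (use ik False arrow_V[OF z(1)] in \<open>auto simp: adjE_def\<close>)
    show ?thesis using W.two_squares(2,4,5)[OF z(2,1)] octagon_at_swap by blast
  qed
  then show "slen pl e A k y = slen pl e A k z \<Longrightarrow> \<exists>u. arrow pl k y u \<and> arrow pl i v u \<and> slen pl e A i v = slen pl e A i z + 1"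
    "slen pl e A k y = slen pl e A k z \<or> slen pl e A k y = slen pl e A k z + 1"
    "\<lbrakk>slen pl e A k y = slen pl e A k z + 1; slen pl e A i v = slen pl e A i z + 1\<rbrakk> \<Longrightarrow> octagon_at pl i k z y v"
    by blast+
qed

abbreviation "ar \<equiv> arrow False"
abbreviation "eps \<equiv> slen True e A"
abbreviation "phi \<equiv> slen False e A"

lemma ar_True: "ar i x y \<longleftrightarrow> arrow True i y x" using arrow_inverse[of False i x y] by simp

lemma ar_rk: "ar i x y \<Longrightarrow> x \<in> V \<and> y \<in> V \<and> rk y = Suc (rk x)"
  using V_toggle[of x False i] unfolding arrow_def by auto

lemma slen_ex: "\<lbrakk>h \<in> V; 0 < slen pl e A i h\<rbrakk> \<Longrightarrow> \<exists>h'. arrow pl i h h'"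
proof -
  assume a: "h \<in> V" "0 < slen pl e A i h"
  then obtain p where "good_node pl e A i h p" using slen_pos V_proper by blast
  then have "p mod int e = int i" using good_node_D[OF V_proper[OF a(1)]] unfolding conts_def by blast
  then have "int i < int e" using e_pos by (metis of_nat_0_less_iff pos_mod_bound)
  then show ?thesis using arrow_ex a by simp
qed

lemma ar_eps: "ar i x y \<Longrightarrow> eps i y = eps i x + 1"
  using arrow_slen[of True i y x] ar_True by simp

lemma ar_phi: "ar i x y \<Longrightarrow> phi i y = phi i x - 1"
  by (rule arrow_slen)

lemma weight: "ar k x y \<Longrightarrow> phi i y - eps i y = phi i x - eps i x - cartE e i k"
  using arrow_wsum[of False k x y i] slen_diff[of x i] slen_diff[of y i] V_proper arrow_V[of False k x y] by (simp add: sgp_def)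

lemma weight_adj:
  assumes "ar k x y" "adjE e i k" "i \<noteq> k" shows "phi i y - eps i y = phi i x - eps i x + 1"
  using weight[OF assms(1), of i] assms(2,3) unfolding cartE_def by simp

text \<open>The model yields conditions on \<open>eps\<close> at \<open>z\<close>. As an arrow of an
  adjacent residue raises \<open>phi - eps\<close> by 1, they translate into conditions on
  \<open>phi\<close> at elements below \<open>z\<close>, the form that can be transported.\<close>

lemma down:
  assumes z: "ar i y z" "ar k v z" and ik: "i \<noteq> k"
  shows "(\<exists>u. ar k u y \<and> ar i u v \<and> (\<not> adjE e i k \<or> phi i y = phi i u \<or> phi k v = phi k u)) \<or>
       (\<exists>y1 y2 u v1 v2. ar k y1 y \<and> ar k y2 y1 \<and> ar i u y2 \<and> ar i v1 v \<and> ar i v2 v1 \<and> ar k u v2 \<and>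
          phi k y2 = phi k u + 1 \<and> phi i v2 = phi i u + 1)"
proof (cases "adjE e i k")
  case False
  then show ?thesis using nonadjacent(1)[OF ik False] z unfolding ar_True by blast
next
  case True
  have wsum': "adjE e k i" using True adjE_sym by blast
  have zT: "arrow True i z y" "arrow True k z v" using z unfolding ar_True by auto
  note W = weight_adj[OF z(1) wsum' ik[symmetric]] weight_adj[OF z(2) True ik]
  note P = ar_phi[OF z(1)] ar_phi[OF z(2)]
  consider (a) "eps k y = eps k z" | (b) "eps i v = eps i z" | (c) "eps k y = eps k z + 1" "eps i v = eps i z + 1"
    using adjacent(2)[OF True zT] adjacent(2)[OF wsum' zT(2,1)] by blast
  then show ?thesis
  proof cases
    case a
    obtain u where u: "ar k u y" "ar i u v" "eps i v = eps i z + 1"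
      using adjacent(1)[OF True zT a] unfolding ar_True by blast
    have "phi i y = phi i u" using W P ar_phi[OF u(2)] u(3) by simp
    then show ?thesis using u by blast
  next
    case b
    obtain u where u: "ar i u v" "ar k u y" "eps k y = eps k z + 1"
      using adjacent(1)[OF wsum' zT(2,1) b] unfolding ar_True by blast
    have "phi k v = phi k u" using W P ar_phi[OF u(2)] u(3) by simp
    then show ?thesis using u by blast
  next
    case c
    obtain y1 y2 u v1 v2 where o: "ar k y1 y" "ar k y2 y1" "ar i u y2" "ar i v1 v" "ar i v2 v1" "ar k u v2"
       "eps k v2 = eps k z" "eps i y2 = eps i z"
      using adjacent(3)[OF True zT c] unfolding octagon_at_def ar_True by blast
    have "phi k y2 = phi k u + 1"
      using W(1) c(1) ar_phi[OF o(1)] ar_phi[OF o(2)] ar_phi[OF o(6)] o(7) P(2) ar_eps[OF z(2)]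
        weight_adj[OF o(4) wsum' ik[symmetric]] weight_adj[OF o(5) wsum' ik[symmetric]] by linarith
    moreover have "phi i v2 = phi i u + 1"
      using W(2) c(2) ar_phi[OF o(4)] ar_phi[OF o(5)] ar_phi[OF o(3)] o(8) P(1) ar_eps[OF z(1)]
        weight_adj[OF o(1) True ik] weight_adj[OF o(2) True ik] by linarith
    ultimately show ?thesis using o by blast
  qed
qed

lemma up_square:
  assumes u: "ar k u y" "ar i u v" and ik: "i \<noteq> k" and c: "\<not> adjE e i k \<or> phi i y = phi i u \<or> phi k v = phi k u"
  shows "\<exists>z. ar i y z \<and> ar k v z"
proof (cases "adjE e i k")
  case False
  then show ?thesis using nonadjacent(1)[OF ik False u(2,1)] by blast
next
  case True
  then have wsum': "adjE e k i" using adjE_sym by blast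
  show ?thesis using c adjacent(1)[OF wsum' u] adjacent(1)[OF True u(2,1)] True by blast
qed

lemma up_octagon:
  assumes u: "ar i u y2" "ar k u v2" and ik: "i \<noteq> k" and c: "phi k y2 = phi k u + 1" "phi i v2 = phi i u + 1"
  shows "\<exists>y1 y z v v1. ar k y2 y1 \<and> ar k y1 y \<and> ar i y z \<and> ar i v2 v1 \<and> ar i v1 v \<and> ar k v z"
proof (cases "adjE e i k")
  case False
  \<comment> \<open>Here the length for residue \<open>k\<close> does not change along an
    \<open>i\<close>-arrow, contradicting the assumed increase.\<close>
  then show ?thesis using nonadjacent(2)[OF ik False u] c by simp
next
  case True
  show ?thesis using adjacent(3)[OF True u c] unfolding octagon_at_def by blast
qed

lemma A_regular_empty: "A_regular e A {}"
  unfolding A_reg_proper using proper_empty by (simp add: young_def)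

lemma root_V: "prof {} \<in> V" "rk (prof {}) = 0"
  using A_regular_empty rk_prof[OF A_regular_empty] unfolding V_def by auto

text \<open>The right side does not mention \<open>A\<close>, so the crystals of two arm sequences
  share their root weight.\<close>

lemma root_weight: "phi i (prof {}) - eps i (prof {}) = - sum (sgn_at (prof {})) (conts e i (prof {}))"
  using slen_diff[OF proper_empty, of i] unfolding wsum_def by simp

lemma local_crystal:
  "local_crystal V rk ar eps phi (prof {}) (adjE e) (cartE e) (\<lambda>i. - sum (sgn_at (prof {})) (conts e i (prof {})))"
proof (unfold_locales, goal_cases)
  case 1 then show ?case by (rule ar_rk)
next
  case 2 then show ?case by (rule arrow_det)
next
  case 3 then show ?case unfolding ar_True by (rule arrow_det)
next
  case 4 then show ?case using slen_nonneg V_proper by blast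
next
  case 5 then show ?case unfolding ar_True by (rule slen_ex)
next
  case 6 then show ?case by (rule slen_ex)
next
  case 7 then show ?case by (rule ar_eps)
next
  case 8 then show ?case by (rule arrow_pos)
next
  case 9 then show ?case by (rule weight)
next
  case (13 x)
  then have "\<exists>i y. arrow True i x y" using source[of x] unfolding arrow_def by blast
  then show ?case unfolding ar_True .
next
  case 14 then show ?case by (rule down)
next
  case 15 then show ?case by (rule up_square)
next
  case 16 then show ?case by (rule up_octagon)
qed (rule root_V root_weight)+

lemma arrow_iff:
  assumes "A_regular e A Y" "A_regular e A Z"
  shows "i < e \<and> f_op e A i Y = Some Z \<longleftrightarrow> ar i (prof Y) (prof Z)"
proof -
  have y: "young Y" "young Z" "prof Y \<in> V" using assms A_reg_proper unfolding V_def by auto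
  show ?thesis
  proof
    assume a: "i < e \<and> f_op e A i Y = Some Z"
    then obtain p where p: "good_node False e A i (prof Y) p" "Z = insert (node_at (prof Y) p) Y"
      unfolding f_op_iff[OF arm e_pos y(1)] f_good_good_node by blast
    then show "ar i (prof Y) (prof Z)" unfolding arrow_def using up_Y(3)[OF assms(1) p(1)] a y(3) by blast
  next
    assume "ar i (prof Y) (prof Z)"
    then obtain p where p: "i < e" "good_node False e A i (prof Y) p" "prof Z = toggle False (prof Y) p" unfolding arrow_def by blast
    have "Z = insert (node_at (prof Y) p) Y"
      using prof_inj[OF y(2)] up_Y(2,3)[OF assms(1) p(2)] p(3) A_reg_proper by auto
    then show "i < e \<and> f_op e A i Y = Some Z" unfolding f_op_iff[OF arm e_pos y(1)] f_good_good_node using p by blast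
  qed
qed

end

text \<open>Rank is the number of nodes, so the abstract isomorphism, carried back from profiles to
  diagrams, preserves size; this makes it compatible with truncation.\<close>

lemma crystal_bijection:
  assumes "3 \<le> e" "arm_seq e A" "arm_seq e B"
  shows "\<exists>\<phi>. bij_betw \<phi> {Y. A_regular e A Y} {Y. A_regular e B Y} \<and>
    (\<forall>Y. A_regular e A Y \<longrightarrow> card (\<phi> Y) = card Y) \<and>
    (\<forall>Y Z i. A_regular e A Y \<longrightarrow> A_regular e A Z \<longrightarrow>
       (i < e \<and> f_op e A i Y = Some Z \<longleftrightarrow> i < e \<and> f_op e B i (\<phi> Y) = Some (\<phi> Z)))"
proof -
  interpret X: arm e A by unfold_locales (use assms in auto)
  interpret Y: arm e B by unfold_locales (use assms in auto)
  interpret P: crystal_pair X.V X.rk X.ar X.eps X.phi "prof {}" Y.V Y.rk Y.ar Y.eps Y.phi "prof {}" "adjE e" "cartE e"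
     "\<lambda>i. - sum (sgn_at (prof {})) (conts e i (prof {}))"
    unfolding crystal_pair_def using X.local_crystal Y.local_crystal by blast
  obtain \<psi> where \<psi>: "bij_betw \<psi> X.V Y.V" "\<And>x. x \<in> X.V \<Longrightarrow> Y.rk (\<psi> x) = X.rk x"
     "\<And>x y i. x \<in> X.V \<Longrightarrow> y \<in> X.V \<Longrightarrow> X.ar i x y \<longleftrightarrow> Y.ar i (\<psi> x) (\<psi> y)"
    using P.iso by blast
  let ?RA = "{Y. A_regular e A Y}" and ?RB = "{Y. A_regular e B Y}"
  have bA: "bij_betw prof ?RA X.V" and bB: "bij_betw prof ?RB Y.V"
    unfolding X.V_def Y.V_def using X.prof_inj_on Y.prof_inj_on by (auto simp: bij_betw_def)
  define \<phi> where "\<phi> = inv_into ?RB prof \<circ> (\<psi> \<circ> prof)"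
  have b: "bij_betw \<phi> ?RA ?RB" unfolding \<phi>_def
    by (rule bij_betw_trans[OF bij_betw_trans[OF bA \<psi>(1)] bij_betw_inv_into[OF bB]])
  have p: "prof (\<phi> Y) = \<psi> (prof Y)" "A_regular e B (\<phi> Y)" "prof Y \<in> X.V" if "A_regular e A Y" for Y
  proof -
    show v: "prof Y \<in> X.V" using that unfolding X.V_def by blast
    then have "\<psi> (prof Y) \<in> Y.V" using \<psi>(1) bij_betwE by blast
    then show "prof (\<phi> Y) = \<psi> (prof Y)" unfolding \<phi>_def using bij_betw_inv_into_right[OF bB] by simp
    show "A_regular e B (\<phi> Y)" using b that bij_betwE by blast
  qed
  have "card (\<phi> Y) = card Y" if "A_regular e A Y" for Y
    using Y.rk_prof[OF p(2)[OF that]] X.rk_prof[OF that] \<psi>(2)[OF p(3)[OF that]] p(1)[OF that] by simp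
  moreover have "(i < e \<and> f_op e A i Y = Some Z) = (i < e \<and> f_op e B i (\<phi> Y) = Some (\<phi> Z))"
    if "A_regular e A Y" "A_regular e A Z" for Y Z i
    unfolding X.arrow_iff[OF that] Y.arrow_iff[OF p(2)[OF that(1)] p(2)[OF that(2)]] p(1)[OF that(1)] p(1)[OF that(2)]
    by (rule \<psi>(3)[OF p(3)[OF that(1)] p(3)[OF that(2)]])
  ultimately show ?thesis using b by blast
qed

theorem mainTheorem10:
  fixes e :: nat and A B :: "nat \<Rightarrow> int"
  assumes "e \<ge> 3" and "arm_seq e A" and "arm_seq e B"
  shows "(\<forall>n. crystal_iso e A (Rn_vertices e A n) B (Rn_vertices e B n)) \<and>
         crystal_iso e A (R_vertices e A) B (R_vertices e B)"
proof -
  obtain \<phi> where b: "bij_betw \<phi> {Y. A_regular e A Y} {Y. A_regular e B Y}"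
    and c: "\<And>Y. A_regular e A Y \<Longrightarrow> card (\<phi> Y) = card Y"
    and f: "\<And>Y Z i. \<lbrakk>A_regular e A Y; A_regular e A Z\<rbrakk> \<Longrightarrow>
       (i < e \<and> f_op e A i Y = Some Z) = (i < e \<and> f_op e B i (\<phi> Y) = Some (\<phi> Z))"
    using crystal_bijection[OF assms] by blast
  have reg: "A_regular e B (\<phi> Y)" if "A_regular e A Y" for Y using b that bij_betwE by blast
  \<comment> \<open>One bijection serves every truncation: \<open>Q\<close> is a bound on the size,
    or always true for the full crystal.\<close>
  have iso: "crystal_iso e A {Y. A_regular e A Y \<and> Q (card Y)} B {Y. A_regular e B Y \<and> Q (card Y)}" for Q
  proof -
    have "\<phi> ` {Y. A_regular e A Y \<and> Q (card Y)} = {Y. A_regular e B Y \<and> Q (card Y)}"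
    proof
      show "\<phi> ` {Y. A_regular e A Y \<and> Q (card Y)} \<subseteq> {Y. A_regular e B Y \<and> Q (card Y)}" using reg c by auto
      show "{Y. A_regular e B Y \<and> Q (card Y)} \<subseteq> \<phi> ` {Y. A_regular e A Y \<and> Q (card Y)}"
      proof
        fix Z assume Z: "Z \<in> {Y. A_regular e B Y \<and> Q (card Y)}"
        then obtain Y where "A_regular e A Y" "Z = \<phi> Y" using bij_betw_imp_surj_on[OF b] by blast
        then show "Z \<in> \<phi> ` {Y. A_regular e A Y \<and> Q (card Y)}" using Z c by auto
      qed
    qed
    moreover have "inj_on \<phi> {Y. A_regular e A Y \<and> Q (card Y)}"
      using bij_betw_imp_inj_on[OF b] by (rule inj_on_subset) blast
    ultimately have bQ: "bij_betw \<phi> {Y. A_regular e A Y \<and> Q (card Y)} {Y. A_regular e B Y \<and> Q (card Y)}"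
      unfolding bij_betw_def by blast
    have "crystal_arrow e A {Y. A_regular e A Y \<and> Q (card Y)} Y i Z \<longleftrightarrow>
        crystal_arrow e B {Y. A_regular e B Y \<and> Q (card Y)} (\<phi> Y) i (\<phi> Z)"
      if "Y \<in> {Y. A_regular e A Y \<and> Q (card Y)}" "Z \<in> {Y. A_regular e A Y \<and> Q (card Y)}" for Y Z i
      using f[of Y Z i] reg c that unfolding crystal_arrow_def by simp
    then show ?thesis using bQ unfolding crystal_iso_def by blast
  qed
  have "crystal_iso e A (Rn_vertices e A n) B (Rn_vertices e B n)" for n
    using iso[of "\<lambda>m. m \<le> n * e"] unfolding Rn_vertices_def .
  moreover have "crystal_iso e A (R_vertices e A) B (R_vertices e B)"
    using iso[of "\<lambda>_. True"] unfolding R_vertices_def by simp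
  ultimately show ?thesis by blast
qed

end
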